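(* Let $K$ be a non-archimedean local field with ring of integers $\mathcal{O}$, maximal ideal $\mathfrak{p}$ and residue field $\mathcal{O}/\mathfrak{p}=F_q$ of odd characteristic, let $F$ be a quadratic extension of $K$ with ring of integers $\mathcal{R}$ and maximal ideal $\mathcal{P}$, and let $e\geq 1$ and $m\ge 1$. (a) Let $A=\mathcal{O}/\mathfrak{p}^e$ with identity involution, let $h$ be a non-degenerate hermitian (i.e. symmetric bilinear) form on a free $A$-module $V$ of rank $m$, and let $O_m(A)$ be its unitary (i.e. orthogonal) group. Then $$|O_m(A)|=q^{m(m-1)(e-1)/2}\,|O_m(q)|,$$ where $O_m(q)$ is the orthogonal group of rank $m$ over $F_q$ associated to the reduction $\overline{h}$ of $h$ modulo the maximal ideal of $A$. (b) Let $A=\mathcal{R}/\mathcal{P}^e$ with involution $*$ inherited from $\mathcal{R}$, let $h$ be a non-degenerate $*$-hermitian form on a free $A$-module $V$ of rank $m$, and let $U_m(A)$ be its unitary group. If $F/K$ is unramified then $$|U_m(A)|=q^{m^2(e-1)}\,|U_m(q^2)|,$$ where $U_m(q^2)$ is the unitary group of rank $m$ over $\mathcal{R}/\mathcal{P}\cong F_{q^2}$ associated to the reduction of $h$. If $F/K$ is ramified and $e$ is even then $$|U_m(A)|=q^{(m^2(e-1)+m)/2}\,|O_m(q)|,$$ and if $F/K$ is ramified and $e$ is odd then $$|U_m(A)|=q^{m^2(e-1)/2}\,|O_m(q)|.$$ Here $O_m(q)$ is the orthogonal group of rank $m$ over $F_q$ associated to the reduction $\overline{h}$ of $h$ modulo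 the maximal ideal of $A$.
   Context: The involution of $\mathcal{R}$ is the restriction of the non-trivial automorphism of $F$ over $K$; it induces an involution on $\mathcal{R}/\mathcal{P}^e$. In the ramified case, $\mathcal{R}=\mathcal{O}[\rho]$ with $\rho^2=\pi$ a prime element of $\mathcal{O}$, $\mathcal{P}=(\rho)$, $\mathcal{R}/\mathcal{P}\cong F_q$, and the involution is $\rho\mapsto-\rho$. In the unramified case, $\mathcal{R}=\mathcal{O}[\tau]$ where $\tau^2$ is a unit of $\mathcal{O}$ that is not a square in $\mathcal{O}$, $\mathcal{R}/\mathcal{P}\cong F_{q^2}$, and the involution is $\tau\mapsto-\tau$. For a ring $A$ with involution $*$, a $*$-hermitian form on $V$ is a biadditive map $h:V\times V\to A$, $A$-linear in the second variable, with $h(v,u)=h(u,v)^*$; it is non-degenerate if $u\mapsto h(u,-)$ is a bijection from $V$ onto $\mathrm{Hom}_A(V,A)$. The unitary group of $(V,h)$ is the group of all $A$-linear automorphisms of $V$ preserving $h$. If $\mathfrak{r}$ is the maximal ideal of $A$, the reduction $\overline{h}$ of $h$ modulo $\mathfrak{r}$ is the form on $V/V\mathfrak{r}$ over $A/\mathfrak{r}$ given by $\overline{h}(v+V\mathfrak{r},w+V\mathfrak{r})=h(v,w)+\mathfrak{r}$, hermitian with respect to the involution induced on $A/\mathfrak{r}$ (which is the identity in (a) and in the ramified case of (b), so that $\overline{h}$ is then a symmetric bilinear form over $F_q$). *)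

theory Defs
  imports Complex_Main "HOL-Algebra.Algebra"
begin

text \<open>The characteristic is the additive order of 1, which \<open>group.ord\<close> makes \<open>0\<close> if infinite.\<close>

definition ring_char :: "('a, 'b) ring_scheme \<Rightarrow> nat" where
  "ring_char R = group.ord (add_monoid R) \<one>\<^bsub>R\<^esub>"

definition abs_integers :: "('a, 'b) ring_scheme \<Rightarrow> ('a \<Rightarrow> real) \<Rightarrow> ('a, 'b) ring_scheme" where
  "abs_integers K v = K\<lparr>carrier := {x \<in> carrier K. v x \<le> 1}\<rparr>"

definition abs_max_ideal :: "('a, 'b) ring_scheme \<Rightarrow> ('a \<Rightarrow> real) \<Rightarrow> 'a set" where
  "abs_max_ideal K v = {x \<in> carrier K. v x < 1}"

text \<open>
  A non-archimedean local field: a field that is complete with respect to a non-trivial discrete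
  non-archimedean absolute value and has a finite residue field.  Discreteness and
  non-triviality are expressed by the value group being infinite cyclic.
\<close>

locale nonarch_local_field = field K for K :: "('a, 'b) ring_scheme" (structure) and v :: "'a \<Rightarrow> real" +
  assumes abs_nonneg: "x \<in> carrier K \<Longrightarrow> 0 \<le> v x"
    and abs_eq_0_iff: "x \<in> carrier K \<Longrightarrow> v x = 0 \<longleftrightarrow> x = \<zero>"
    and abs_mult: "\<lbrakk>x \<in> carrier K; y \<in> carrier K\<rbrakk> \<Longrightarrow> v (x \<otimes> y) = v x * v y"
    and abs_ultrametric: "\<lbrakk>x \<in> carrier K; y \<in> carrier K\<rbrakk> \<Longrightarrow> v (x \<oplus> y) \<le> max (v x) (v y)"
    and discrete: "\<exists>c. 0 < c \<and> c < 1 \<and> v ` (carrier K - {\<zero>}) = range (\<lambda>n::int. c powi n)"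
    and complete:
      "\<lbrakk>range s \<subseteq> carrier K;
        \<forall>\<epsilon>>0. \<exists>N::nat. \<forall>i\<ge>N. \<forall>j\<ge>N. v (s i \<ominus> s j) < \<epsilon>\<rbrakk>
       \<Longrightarrow> \<exists>l\<in>carrier K. (\<lambda>i. v (s i \<ominus> l)) \<longlonglongrightarrow> 0"
    and finite_residue_field: "finite (carrier (abs_integers K v Quot abs_max_ideal K v))"

text \<open>The integral closure in \<open>F\<close> of the ring \<open>S\<close>, whose carrier is a subring of \<open>F\<close>.\<close>

definition integral_closure :: "('a, 'b) ring_scheme \<Rightarrow> ('a, 'c) ring_scheme \<Rightarrow> ('a, 'b) ring_scheme"
  where "integral_closure F S =
    F\<lparr>carrier := {x \<in> carrier F. \<exists>p. polynomial\<^bsub>F\<^esub> (carrier S) p \<and> p \<noteq> [] \<and>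
                     hd p = \<one>\<^bsub>F\<^esub> \<and> ring.eval F p x = \<zero>\<^bsub>F\<^esub>}\<rparr>"

text \<open>
  For rings of integers \<open>\<O> \<subseteq> \<R>\<close> of local fields, with maximal ideals \<open>p\<close> and \<open>P\<close>: the extension is
  unramified if its ramification index is 1, i.e. \<open>p\<R> = P\<close>.  (Separability of the
  residue extension is automatic, the residue fields being finite.)
\<close>

definition unramified :: "'a set \<Rightarrow> ('a, 'b) ring_scheme \<Rightarrow> 'a set \<Rightarrow> bool" where
  "unramified p R P \<longleftrightarrow> Idl\<^bsub>R\<^esub> p = P"

definition ideal_power :: "('a, 'b) ring_scheme \<Rightarrow> 'a set \<Rightarrow> nat \<Rightarrow> 'a set" where
  "ideal_power R I n = I [^]\<^bsub>ideals_set R\<^esub> n"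

definition nontrivial_automorphism ::
  "('a, 'b) ring_scheme \<Rightarrow> 'a set \<Rightarrow> ('a \<Rightarrow> 'a) \<Rightarrow> bool" where
  "nontrivial_automorphism F K \<sigma> \<longleftrightarrow>
     \<sigma> \<in> ring_iso F F \<and> (\<forall>x\<in>K. \<sigma> x = x) \<and> (\<exists>x\<in>carrier F. \<sigma> x \<noteq> x)"

text \<open>
  The map that an involution of a ring induces on the cosets of an invariant ideal:
  the coset of \<open>a\<close> is sent to its image, the coset of \<open>a\<^sup>*\<close>.
\<close>

definition induced :: "('a \<Rightarrow> 'a) \<Rightarrow> 'a set \<Rightarrow> 'a set" where
  "induced star B = star ` B"

definition free_of_rank :: "('a, 'b) ring_scheme \<Rightarrow> ('a, 'v, 'c) module_scheme \<Rightarrow> nat \<Rightarrow> bool" where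
  "free_of_rank A V m \<longleftrightarrow>
     (\<exists>b. b \<in> {..<m} \<rightarrow> carrier V \<and>
        (\<forall>v\<in>carrier V. \<exists>!a. a \<in> {..<m} \<rightarrow>\<^sub>E carrier A \<and>
           v = (\<Oplus>\<^bsub>V\<^esub>i\<in>{..<m}. a i \<odot>\<^bsub>V\<^esub> b i)))"

definition linear_functionals :: "('a, 'b) ring_scheme \<Rightarrow> ('a, 'v, 'c) module_scheme \<Rightarrow> ('v \<Rightarrow> 'a) set"
  where "linear_functionals A V =
    {f \<in> carrier V \<rightarrow>\<^sub>E carrier A.
       (\<forall>v\<in>carrier V. \<forall>w\<in>carrier V. f (v \<oplus>\<^bsub>V\<^esub> w) = f v \<oplus>\<^bsub>A\<^esub> f w) \<and>
       (\<forall>a\<in>carrier A. \<forall>v\<in>carrier V. f (a \<odot>\<^bsub>V\<^esub> v) = a \<otimes>\<^bsub>A\<^esub> f v)}"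

text \<open>\<open>A\<close> is commutative, so that right \<open>A\<close>-modules are rendered as (left) modules.\<close>

definition hermitian_form ::
  "('a, 'b) ring_scheme \<Rightarrow> ('a \<Rightarrow> 'a) \<Rightarrow> ('a, 'v, 'c) module_scheme \<Rightarrow> ('v \<Rightarrow> 'v \<Rightarrow> 'a) \<Rightarrow> bool" where
  "hermitian_form A star V h \<longleftrightarrow>
     (\<forall>u\<in>carrier V. \<forall>v\<in>carrier V. h u v \<in> carrier A) \<and>
     (\<forall>u\<in>carrier V. \<forall>v\<in>carrier V. \<forall>w\<in>carrier V. h (u \<oplus>\<^bsub>V\<^esub> v) w = h u w \<oplus>\<^bsub>A\<^esub> h v w) \<and>
     (\<forall>u\<in>carrier V. \<forall>v\<in>carrier V. \<forall>w\<in>carrier V. h u (v \<oplus>\<^bsub>V\<^esub> w) = h u v \<oplus>\<^bsub>A\<^esub> h u w) \<and>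
     (\<forall>a\<in>carrier A. \<forall>u\<in>carrier V. \<forall>v\<in>carrier V. h u (a \<odot>\<^bsub>V\<^esub> v) = a \<otimes>\<^bsub>A\<^esub> h u v) \<and>
     (\<forall>u\<in>carrier V. \<forall>v\<in>carrier V. h v u = star (h u v))"

definition nondegenerate ::
  "('a, 'b) ring_scheme \<Rightarrow> ('a, 'v, 'c) module_scheme \<Rightarrow> ('v \<Rightarrow> 'v \<Rightarrow> 'a) \<Rightarrow> bool" where
  "nondegenerate A V h \<longleftrightarrow>
     bij_betw (\<lambda>u. \<lambda>v\<in>carrier V. h u v) (carrier V) (linear_functionals A V)"

definition unitary_group ::
  "('a, 'b) ring_scheme \<Rightarrow> ('a, 'v, 'c) module_scheme \<Rightarrow> ('v \<Rightarrow> 'v \<Rightarrow> 'a) \<Rightarrow> ('v \<Rightarrow> 'v) monoid" where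
  "unitary_group A V h = (BijGroup (carrier V))\<lparr>carrier :=
     {g \<in> Bij (carrier V).
        (\<forall>v\<in>carrier V. \<forall>w\<in>carrier V. g (v \<oplus>\<^bsub>V\<^esub> w) = g v \<oplus>\<^bsub>V\<^esub> g w) \<and>
        (\<forall>a\<in>carrier A. \<forall>v\<in>carrier V. g (a \<odot>\<^bsub>V\<^esub> v) = a \<odot>\<^bsub>V\<^esub> g v) \<and>
        (\<forall>v\<in>carrier V. \<forall>w\<in>carrier V. h (g v) (g w) = h v w)}\<rparr>"

text \<open>The submodule \<open>Vr\<close> of \<open>V\<close>: all finite sums of products of elements of \<open>r\<close> and of \<open>V\<close>.\<close>

definition ideal_smult :: "'a set \<Rightarrow> ('a, 'v, 'c) module_scheme \<Rightarrow> 'v set" where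
  "ideal_smult r V = generate (add_monoid V) {a \<odot>\<^bsub>V\<^esub> v | a v. a \<in> r \<and> v \<in> carrier V}"

text \<open>
  The \<open>A/r\<close>-module \<open>V/Vr\<close> and the reduced form, with operations on cosets given by unions over
  representatives, as in \<open>rcoset_mult\<close>.  The multiplicative fields of the module
  record play no role.
\<close>

definition reduced_module :: "'a set \<Rightarrow> ('a, 'v, 'c) module_scheme \<Rightarrow> ('a set, 'v set) module" where
  "reduced_module r V =
    \<lparr>carrier = a_rcosets\<^bsub>V\<^esub> (ideal_smult r V), monoid.mult = undefined, one = undefined,
     ring.zero = ideal_smult r V, ring.add = set_add V,
     module.smult = (\<lambda>\<alpha> B. \<Union>a\<in>\<alpha>. \<Union>v\<in>B. ideal_smult r V +>\<^bsub>V\<^esub> (a \<odot>\<^bsub>V\<^esub> v))\<rparr>"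

definition reduced_form ::
  "('a, 'b) ring_scheme \<Rightarrow> 'a set \<Rightarrow> ('v \<Rightarrow> 'v \<Rightarrow> 'a) \<Rightarrow> 'v set \<Rightarrow> 'v set \<Rightarrow> 'a set" where
  "reduced_form A r h B C = (\<Union>v\<in>B. \<Union>w\<in>C. r +>\<^bsub>A\<^esub> h v w)"

definition reduced_unitary_group ::
  "('a, 'b) ring_scheme \<Rightarrow> 'a set \<Rightarrow> ('a, 'v, 'c) module_scheme \<Rightarrow> ('v \<Rightarrow> 'v \<Rightarrow> 'a)
     \<Rightarrow> ('v set \<Rightarrow> 'v set) monoid" where
  "reduced_unitary_group A r V h =
     unitary_group (A Quot r) (reduced_module r V) (reduced_form A r h)"

end

theory Submission
  imports Defs "HOL-Library.Z2"
begin

text \<open>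
  Both parts are instances of one count. Let \<open>A\<close> be a finite commutative ring with involution \<open>*\<close> in
  which \<open>2\<close> is invertible, let \<open>r = \<pi>A\<close> be a nilpotent ideal with \<open>r\<^sup>* = r\<close>, and let \<open>h\<close> be a
  non-degenerate hermitian form on a free module \<open>V\<close> of rank \<open>m\<close>. Let \<open>G\<close> be the set of all
  endomorphisms of \<open>V\<close> that preserve \<open>h\<close> modulo \<open>r\<close>. It is fibred in two ways.

  \<^item> Reduction maps \<open>G\<close> onto the unitary group of the reduced form. To lift an isometry of \<open>V/Vr\<close>
    choose images of the basis; two lifts differ by a linear map \<open>V \<rightarrow> Vr\<close>, so each fibre has
    \<open>|r|\<^bsup>m\<^sup>2\<^esup>\<close> elements (\<open>card_fibre_reduction\<close>).
  \<^item> The change of the Gram matrix maps \<open>G\<close> to the hermitian matrices with entries in \<open>r\<close>. Its fibre over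
    \<open>0\<close> is the unitary group \<open>U\<close> of \<open>h\<close>, and all fibres have the size of \<open>U\<close>, because every
    hermitian form congruent to \<open>h\<close> modulo \<open>r\<close> is \<open>h(S_, S_)\<close> for some \<open>S \<equiv> 1\<close> modulo \<open>r\<close> (\<open>congruent_forms\<close>). To
    find \<open>S\<close>, write the form as \<open>h(T_, _)\<close> with \<open>T\<close> self-adjoint. The operators congruent to \<open>1\<close> form
    a group of odd order \<open>n\<close>, so \<open>S = T\<^bsup>(n+1)/2\<^esup>\<close> has square \<open>T\<close>, and it is self-adjoint like
    \<open>T\<close>.

  With \<open>r\<^sup>+\<close> and \<open>r\<^sup>-\<close> the symmetric and skew elements of \<open>r\<close> there are
  \<open>|r\<^sup>+|\<^bsup>m\<^esup> |r|\<^bsup>m(m-1)/2\<^esup>\<close> such matrices, and \<open>|r| = |r\<^sup>+| |r\<^sup>-|\<close>. Comparing the two counts of \<open>G\<close> gives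
  \<open>|U| = |r\<^sup>-|\<^bsup>m\<^esup> |r|\<^bsup>m(m-1)/2\<^esup> |U(V/Vr)|\<close> (\<open>order_unitary_group\<close>).

  It remains to count \<open>r\<^sup>+\<close> and \<open>r\<^sup>-\<close>. For \<open>A = \<O>/p\<^bsup>e\<^esup>\<close> with trivial involution \<open>r\<^sup>- = 0\<close> and
  \<open>|r| = q\<^bsup>e-1\<^esup>\<close>. For the quadratic extension, \<open>F = K \<oplus> K\<theta>\<close> where the involution negates \<open>\<theta>\<close> and
  \<open>d = \<theta>\<^sup>2\<close> is a unit or a prime element of \<open>\<O>\<close>. The square root \<open>w\<close> of the absolute value of the norm is given by
  \<open>w(a + b\<theta>) = max |a| (|b| |d|\<^bsup>1/2\<^esup>)\<close>: for a prime element \<open>d\<close> the two terms cannot have the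
  same value, and for a unit \<open>d\<close> Hensel's lemma shows that \<open>d\<close> is not a square modulo \<open>p\<close>. Hence \<open>w\<close> is
  a discrete absolute value, the integral closure of \<open>\<O>\<close> is its valuation ring, and \<open>F/K\<close> is unramified
  exactly if \<open>d\<close> is a unit. Symmetric classes are represented by elements of \<open>K\<close> and skew classes by
  elements of \<open>K\<theta>\<close>, so that both are counted by quotients \<open>p\<^sup>i/p\<^sup>j\<close>.
\<close>

section \<open>Counting and cancellation\<close>

text \<open>
  The points cancel in pairs when they are counted in the field with two elements.
\<close>

lemma even_card_fixpoint_free_involution:
  assumes "\<And>x. x \<in> S \<Longrightarrow> f x \<in> S" "\<And>x. x \<in> S \<Longrightarrow> f (f x) = x" "\<And>x. x \<in> S \<Longrightarrow> f x \<noteq> x"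
  shows "even (card S)"
proof -
  have "(\<Sum>x\<in>S. 1 :: bit) = 0"
    by (rule sum_involution_eq_0[where h = f]) (use assms in auto)
  then have "of_nat (card S) = (0 :: bit)" by simp
  moreover have "of_nat n = (0 :: bit) \<longleftrightarrow> even n" for n
    by (induct n) auto
  ultimately show ?thesis by blast
qed

lemma (in abelian_group) odd_card_no_2_torsion:
  assumes S: "finite S" "\<zero> \<in> S" "S \<subseteq> carrier G" "\<And>x. x \<in> S \<Longrightarrow> \<ominus> x \<in> S"
    and tor: "\<And>x. x \<in> S \<Longrightarrow> x \<oplus> x = \<zero> \<Longrightarrow> x = \<zero>"
  shows "odd (card S)"
proof -
  have "even (card (S - {\<zero>}))"
  proof (rule even_card_fixpoint_free_involution[where f = "\<lambda>x. \<ominus> x"])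
    fix x assume x: "x \<in> S - {\<zero>}"
    then have xc: "x \<in> carrier G" using S by auto
    then show "\<ominus> (\<ominus> x) = x" by simp
    show "\<ominus> x \<in> S - {\<zero>}" using x S xc by (auto simp: add.inv_eq_1_iff)
    show "\<ominus> x \<noteq> x"
    proof
      assume "\<ominus> x = x"
      then have "x \<oplus> x = \<zero>" using r_neg[OF xc] by simp
      then show False using tor x by auto
    qed
  qed
  moreover have "card S = Suc (card (S - {\<zero>}))"
    using card.remove[OF S(1,2)] .
  ultimately show ?thesis by simp
qed

lemma card_eq_card_mult_fibre:
  assumes "finite S" "finite Y" "f ` S \<subseteq> Y" "\<And>y. y \<in> Y \<Longrightarrow> card {x \<in> S. f x = y} = k"
  shows "card S = k * card Y"
proof -
  have "card S = (\<Sum>y\<in>Y. \<Sum>x\<in>{x \<in> S. f x = y}. 1)"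
    using sum.group[OF assms(1-3), of "\<lambda>_. 1 :: nat"] by simp
  also have "\<dots> = k * card Y" using assms(4) by simp
  finally show ?thesis .
qed

text \<open>
  This product counts hermitian matrices: one factor \<open>x\<close> for each diagonal entry,
  and one factor \<open>y\<close> for each entry below the diagonal.
\<close>

lemma prod_lower_triangle:
  "(\<Prod>(j, i)\<in>(SIGMA j:{..<m}. {..j}). if i = j then x else y) = x ^ m * y ^ (m * (m - 1) div 2)"
  for x y :: nat
proof -
  have "(\<Prod>(j, i)\<in>(SIGMA j:{..<m}. {..j}). if i = j then x else y)
      = (\<Prod>j<m. \<Prod>i\<le>j. if i = j then x else y)"
    by (subst prod.Sigma) auto
  also have "\<dots> = (\<Prod>j<m. x * y ^ j)"
  proof (rule prod.cong[OF refl])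
    fix j
    have "(\<Prod>i\<le>j. if i = j then x else y) = (\<Prod>i<Suc j. if i = j then x else y)"
      by (simp only: lessThan_Suc_atMost)
    also have "\<dots> = x * (\<Prod>i<j. if i = j then x else y)" by (simp add: mult.commute)
    also have "(\<Prod>i<j. if i = j then x else y) = (\<Prod>i<j. y)" by (rule prod.cong) auto
    finally show "(\<Prod>i\<le>j. if i = j then x else y) = x * y ^ j" by simp
  qed
  also have "\<dots> = x ^ m * y ^ (\<Sum>j<m. j)"
    by (simp add: prod.distrib power_sum)
  also have "(\<Sum>j<m. j) = m * (m - 1) div 2"
    using Sum_Ico_nat[of 0 m] by (simp add: atLeast0LessThan)
  finally show ?thesis .
qed

lemma (in abelian_group) minus_eq_zero_iff:
  "x \<in> carrier G \<Longrightarrow> y \<in> carrier G \<Longrightarrow> x \<ominus> y = \<zero> \<longleftrightarrow> x = y"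
  by (metis a_inv_closed minus_eq minus_equality minus_minus r_neg)

lemma (in abelian_group) add_minus_cancel:
  "x \<in> carrier G \<Longrightarrow> y \<in> carrier G \<Longrightarrow> y \<oplus> (x \<ominus> y) = x"
  by (metis a_inv_closed a_lcomm minus_eq r_neg r_zero)

lemma (in abelian_group) add_minus_cancel_left:
  "x \<in> carrier G \<Longrightarrow> y \<in> carrier G \<Longrightarrow> x \<oplus> y \<ominus> x = y"
  by (metis a_closed a_comm a_inv_closed add_minus_cancel a_assoc minus_eq r_neg r_zero)

lemma (in abelian_subgroup) a_rcos_eq_iff:
  assumes "x \<in> carrier G" "y \<in> carrier G"
  shows "H +> x = H +> y \<longleftrightarrow> x \<ominus> y \<in> H"
proof
  assume "H +> x = H +> y"
  then have "x \<in> H +> y" using a_rcos_self[OF assms(1)] by simp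
  then show "x \<ominus> y \<in> H" using a_rcos_module[OF assms(2,1)] by (simp add: minus_eq)
next
  assume "x \<ominus> y \<in> H"
  then have "x \<in> H +> y" using a_rcos_module[OF assms(2,1)] by (simp add: minus_eq)
  then show "H +> x = H +> y" using a_repr_independence[OF _ assms(2) a_subgroup] by simp
qed

lemma powi_le_iff:
  fixes c :: real
  assumes "0 < c" "c < 1"
  shows "c powi i \<le> c powi j \<longleftrightarrow> j \<le> i"
  using power_int_strict_decreasing[of i j c] power_int_decreasing[of j i c] assms
  by (metis linorder_not_less order_less_le)

lemma powi_add: "0 < c \<Longrightarrow> c powi (i + j) = c powi i * c powi j" for c :: real
  by (simp add: power_int_add)

lemma unitary_groupD:
  assumes "g \<in> carrier (unitary_group A V h)"
  shows "g \<in> Bij (carrier V)"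
    and "\<forall>v\<in>carrier V. \<forall>w\<in>carrier V. g (v \<oplus>\<^bsub>V\<^esub> w) = g v \<oplus>\<^bsub>V\<^esub> g w"
    and "\<forall>a\<in>carrier A. \<forall>v\<in>carrier V. g (a \<odot>\<^bsub>V\<^esub> v) = a \<odot>\<^bsub>V\<^esub> g v"
    and "\<forall>v\<in>carrier V. \<forall>w\<in>carrier V. h (g v) (g w) = h v w"
  using assms by (simp_all add: unitary_group_def)

section \<open>Linear maps out of a free module\<close>

text \<open>
  The maps are extensional on the carrier, as in \<open>linear_functionals\<close>, so that
  counting functions counts linear maps.
\<close>

definition linear_maps ::
  "('a, 'b) ring_scheme \<Rightarrow> ('a, 'v, 'c) module_scheme \<Rightarrow> ('a, 'w, 'd) module_scheme \<Rightarrow> ('v \<Rightarrow> 'w) set"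
  where "linear_maps R M N =
    {f \<in> carrier M \<rightarrow>\<^sub>E carrier N.
       (\<forall>v\<in>carrier M. \<forall>w\<in>carrier M. f (v \<oplus>\<^bsub>M\<^esub> w) = f v \<oplus>\<^bsub>N\<^esub> f w) \<and>
       (\<forall>a\<in>carrier R. \<forall>v\<in>carrier M. f (a \<odot>\<^bsub>M\<^esub> v) = a \<odot>\<^bsub>N\<^esub> f v)}"

definition regular_module :: "('a, 'b) ring_scheme \<Rightarrow> ('a, 'a) module" where
  "regular_module R = \<lparr>carrier = carrier R, monoid.mult = monoid.mult R, one = \<one>\<^bsub>R\<^esub>, ring.zero = \<zero>\<^bsub>R\<^esub>,
     ring.add = ring.add R, module.smult = monoid.mult R\<rparr>"

lemma linear_mapsD:
  assumes "f \<in> linear_maps R M N"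
  shows "f \<in> extensional (carrier M)"
    and "v \<in> carrier M \<Longrightarrow> f v \<in> carrier N"
    and "v \<in> carrier M \<Longrightarrow> w \<in> carrier M \<Longrightarrow> f (v \<oplus>\<^bsub>M\<^esub> w) = f v \<oplus>\<^bsub>N\<^esub> f w"
    and "a \<in> carrier R \<Longrightarrow> v \<in> carrier M \<Longrightarrow> f (a \<odot>\<^bsub>M\<^esub> v) = a \<odot>\<^bsub>N\<^esub> f v"
  using assms by (auto simp: linear_maps_def PiE_def)

lemma linear_mapsI:
  assumes "f \<in> extensional (carrier M)"
    and "\<And>v. v \<in> carrier M \<Longrightarrow> f v \<in> carrier N"
    and "\<And>v w. v \<in> carrier M \<Longrightarrow> w \<in> carrier M \<Longrightarrow> f (v \<oplus>\<^bsub>M\<^esub> w) = f v \<oplus>\<^bsub>N\<^esub> f w"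
    and "\<And>a v. a \<in> carrier R \<Longrightarrow> v \<in> carrier M \<Longrightarrow> f (a \<odot>\<^bsub>M\<^esub> v) = a \<odot>\<^bsub>N\<^esub> f v"
  shows "f \<in> linear_maps R M N"
  using assms by (auto simp: linear_maps_def PiE_def)

lemma linear_functionals_eq: "linear_functionals R M = linear_maps R M (regular_module R)"
  by (simp add: linear_functionals_def linear_maps_def regular_module_def)

lemma (in cring) regular_module: "module R (regular_module R)"
proof (rule moduleI)
  show "abelian_group (regular_module R)"
  proof (rule abelian_groupI)
    fix x assume "x \<in> carrier (regular_module R)"
    then show "\<exists>y\<in>carrier (regular_module R). y \<oplus>\<^bsub>regular_module R\<^esub> x = \<zero>\<^bsub>regular_module R\<^esub>"
      by (auto simp: regular_module_def intro!: bexI[of _ "\<ominus> x"] l_neg)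
  qed (auto simp: regular_module_def a_assoc intro: a_comm)
qed (auto simp: regular_module_def is_cring l_distr r_distr m_assoc)

lemma linear_maps_zero:
  assumes "module R M" "module R N" "f \<in> linear_maps R M N"
  shows "f \<zero>\<^bsub>M\<^esub> = \<zero>\<^bsub>N\<^esub>"
proof -
  interpret M: module R M by fact
  interpret N: module R N by fact
  have "f (\<zero>\<^bsub>R\<^esub> \<odot>\<^bsub>M\<^esub> \<zero>\<^bsub>M\<^esub>) = \<zero>\<^bsub>R\<^esub> \<odot>\<^bsub>N\<^esub> f \<zero>\<^bsub>M\<^esub>"
    using linear_mapsD(4)[OF assms(3)] by blast
  then show ?thesis using linear_mapsD(2)[OF assms(3)] by simp
qed

lemma linear_maps_minus:
  assumes "module R M" "module R N" "f \<in> linear_maps R M N" "v \<in> carrier M"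
  shows "f (\<ominus>\<^bsub>M\<^esub> v) = \<ominus>\<^bsub>N\<^esub> f v"
proof -
  interpret M: module R M by fact
  interpret N: module R N by fact
  have "f (\<ominus>\<^bsub>M\<^esub> v) \<oplus>\<^bsub>N\<^esub> f v = \<zero>\<^bsub>N\<^esub>"
    using linear_mapsD(3)[OF assms(3), of "\<ominus>\<^bsub>M\<^esub> v" v] linear_maps_zero[OF assms(1-3)] assms(4)
    by (simp add: M.l_neg)
  then show ?thesis
    using N.minus_equality linear_mapsD(2)[OF assms(3)] assms(4) by (metis M.a_inv_closed)
qed

locale free_module = module R M for R (structure) and M (structure) +
  fixes b :: "nat \<Rightarrow> 'c" and m :: nat
  assumes basis_closed: "b \<in> {..<m} \<rightarrow> carrier M"
    and basis: "v \<in> carrier M \<Longrightarrow>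
      \<exists>!a. a \<in> {..<m} \<rightarrow>\<^sub>E carrier R \<and> v = (\<Oplus>\<^bsub>M\<^esub>i\<in>{..<m}. a i \<odot>\<^bsub>M\<^esub> b i)"
begin

lemma b_closed [simp]: "i < m \<Longrightarrow> b i \<in> carrier M"
  using basis_closed by auto

definition comb :: "(nat \<Rightarrow> 'a) \<Rightarrow> 'c" where
  "comb a = (\<Oplus>\<^bsub>M\<^esub>i\<in>{..<m}. a i \<odot>\<^bsub>M\<^esub> b i)"

definition coord :: "'c \<Rightarrow> nat \<Rightarrow> 'a" where
  "coord v = (THE a. a \<in> {..<m} \<rightarrow>\<^sub>E carrier R \<and> v = comb a)"

lemma comb_closed [simp]: "a \<in> {..<m} \<rightarrow> carrier R \<Longrightarrow> comb a \<in> carrier M"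
  unfolding comb_def by (intro M.finsum_closed) auto

lemma coord:
  assumes "v \<in> carrier M"
  shows "coord v \<in> {..<m} \<rightarrow>\<^sub>E carrier R" "comb (coord v) = v"
  using theI'[OF basis[OF assms]] by (auto simp: coord_def comb_def)

lemma coord_closed [simp]: "v \<in> carrier M \<Longrightarrow> i < m \<Longrightarrow> coord v i \<in> carrier R"
  using coord(1) by (auto simp: PiE_def)

lemma coord_unique:
  assumes "a \<in> {..<m} \<rightarrow> carrier R" "i < m"
  shows "coord (comb a) i = a i"
proof -
  have e: "comb (restrict a {..<m}) = comb a"
    unfolding comb_def by (rule M.finsum_cong') (use assms in auto)
  have "restrict a {..<m} \<in> {..<m} \<rightarrow>\<^sub>E carrier R \<and> comb a = comb (restrict a {..<m})"
    using assms(1) e by auto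
  then have "coord (comb a) = restrict a {..<m}"
    unfolding coord_def using basis[OF comb_closed[OF assms(1)]]
    by (intro the1_equality) (simp_all add: comb_def)
  then show ?thesis using assms by simp
qed

text \<open>
  All arguments that two linear or sesquilinear objects agree if they agree on the basis are
  instances of this induction.
\<close>

lemma basis_induct [consumes 1, case_names zero add smult]:
  assumes v: "v \<in> carrier M"
    and "Q \<zero>\<^bsub>M\<^esub>"
    and add: "\<And>u v. u \<in> carrier M \<Longrightarrow> v \<in> carrier M \<Longrightarrow> Q u \<Longrightarrow> Q v \<Longrightarrow> Q (u \<oplus>\<^bsub>M\<^esub> v)"
    and smult: "\<And>a i. a \<in> carrier R \<Longrightarrow> i < m \<Longrightarrow> Q (a \<odot>\<^bsub>M\<^esub> b i)"
  shows "Q v"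
proof -
  have "Q (\<Oplus>\<^bsub>M\<^esub>i\<in>I. coord v i \<odot>\<^bsub>M\<^esub> b i)" if "finite I" "I \<subseteq> {..<m}" for I
    using that
  proof (induct I rule: finite_induct)
    case empty then show ?case using assms(2) by simp
  next
    case (insert i I)
    have "(\<Oplus>\<^bsub>M\<^esub>i\<in>insert i I. coord v i \<odot>\<^bsub>M\<^esub> b i)
        = coord v i \<odot>\<^bsub>M\<^esub> b i \<oplus>\<^bsub>M\<^esub> (\<Oplus>\<^bsub>M\<^esub>i\<in>I. coord v i \<odot>\<^bsub>M\<^esub> b i)"
      using insert v by (intro M.finsum_insert) auto
    then show ?case using insert v
      by (auto intro!: add smult M.finsum_closed)
  qed
  from this[of "{..<m}"] show ?thesis using coord(2)[OF v] by (simp add: comb_def)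
qed

lemma coord_add:
  assumes "u \<in> carrier M" "v \<in> carrier M" "i < m"
  shows "coord (u \<oplus>\<^bsub>M\<^esub> v) i = coord u i \<oplus> coord v i"
proof -
  have "comb (\<lambda>i. coord u i \<oplus> coord v i)
      = (\<Oplus>\<^bsub>M\<^esub>i\<in>{..<m}. coord u i \<odot>\<^bsub>M\<^esub> b i \<oplus>\<^bsub>M\<^esub> coord v i \<odot>\<^bsub>M\<^esub> b i)"
    unfolding comb_def by (rule M.finsum_cong') (use assms in \<open>auto simp: smult_l_distr\<close>)
  also have "\<dots> = comb (coord u) \<oplus>\<^bsub>M\<^esub> comb (coord v)"
    unfolding comb_def by (rule M.finsum_addf) (use assms in auto)
  finally have "comb (\<lambda>i. coord u i \<oplus> coord v i) = u \<oplus>\<^bsub>M\<^esub> v"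
    using coord(2) assms by simp
  then show ?thesis
    using coord_unique[of "\<lambda>i. coord u i \<oplus> coord v i" i] assms by auto
qed

lemma coord_smult:
  assumes "a \<in> carrier R" "v \<in> carrier M" "i < m"
  shows "coord (a \<odot>\<^bsub>M\<^esub> v) i = a \<otimes> coord v i"
proof -
  have "comb (\<lambda>i. a \<otimes> coord v i) = a \<odot>\<^bsub>M\<^esub> comb (coord v)"
    unfolding comb_def
    by (subst finsum_smult_ldistr) (use assms in \<open>auto intro!: M.finsum_cong' simp: smult_assoc1\<close>)
  then show ?thesis
    using coord_unique[of "\<lambda>i. a \<otimes> coord v i" i] assms coord(2) by auto
qed

lemma coord_basis:
  assumes "i < m" "j < m"
  shows "coord (b i) j = (if i = j then \<one> else \<zero>)"
proof -
  have "comb (\<lambda>j. if i = j then \<one> else \<zero>) = (\<Oplus>\<^bsub>M\<^esub>j\<in>{..<m}. if i = j then b j else \<zero>\<^bsub>M\<^esub>)"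
    unfolding comb_def by (intro M.finsum_cong') auto
  also have "\<dots> = b i" using assms by (intro M.finsum_singleton) auto
  finally show ?thesis using coord_unique[of "\<lambda>j. if i = j then \<one> else \<zero>" j] assms by auto
qed

lemma linear_maps_eqI:
  assumes "module R N" "f \<in> linear_maps R M N" "g \<in> linear_maps R M N"
    and "\<And>i. i < m \<Longrightarrow> f (b i) = g (b i)"
  shows "f = g"
proof (rule extensionalityI[OF linear_mapsD(1)[OF assms(2)] linear_mapsD(1)[OF assms(3)]])
  fix v assume "v \<in> carrier M"
  then show "f v = g v"
  proof (induct v rule: basis_induct)
    case zero then show ?case 
      using linear_maps_zero[OF module_axioms assms(1,2)] linear_maps_zero[OF module_axioms assms(1,3)] by simp
  qed (use assms in \<open>auto simp: linear_mapsD(3,4)\<close>)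
qed

lemma linear_map_exists:
  assumes "module R N" "x \<in> {..<m} \<rightarrow> carrier N"
  shows "\<exists>f\<in>linear_maps R M N. \<forall>i<m. f (b i) = x i"
proof -
  interpret N: module R N by fact
  have xc [simp]: "i < m \<Longrightarrow> x i \<in> carrier N" for i using assms(2) by auto
  define f where "f = (\<lambda>v\<in>carrier M. \<Oplus>\<^bsub>N\<^esub>i\<in>{..<m}. coord v i \<odot>\<^bsub>N\<^esub> x i)"
  have "f \<in> linear_maps R M N"
  proof (rule linear_mapsI)
    fix v w assume vw: "v \<in> carrier M" "w \<in> carrier M"
    have "f (v \<oplus>\<^bsub>M\<^esub> w)
        = (\<Oplus>\<^bsub>N\<^esub>i\<in>{..<m}. coord v i \<odot>\<^bsub>N\<^esub> x i \<oplus>\<^bsub>N\<^esub> coord w i \<odot>\<^bsub>N\<^esub> x i)"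
      unfolding f_def using vw by (auto intro!: N.finsum_cong' simp: coord_add N.smult_l_distr simp del: N.finsum_addf)
    also have "\<dots> = f v \<oplus>\<^bsub>N\<^esub> f w"
      unfolding f_def using vw by (subst N.finsum_addf) auto
    finally show "f (v \<oplus>\<^bsub>M\<^esub> w) = f v \<oplus>\<^bsub>N\<^esub> f w" .
  next
    fix a v assume av: "a \<in> carrier R" "v \<in> carrier M"
    then show "f (a \<odot>\<^bsub>M\<^esub> v) = a \<odot>\<^bsub>N\<^esub> f v"
      unfolding f_def
      by (simp, subst N.finsum_smult_ldistr)
         (auto intro!: N.finsum_cong' simp: coord_smult N.smult_assoc1)
  qed (auto simp: f_def intro!: N.finsum_closed)
  moreover have "f (b i) = x i" if "i < m" for i
  proof -
    have "f (b i) = (\<Oplus>\<^bsub>N\<^esub>j\<in>{..<m}. if i = j then x j else \<zero>\<^bsub>N\<^esub>)"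
      using that unfolding f_def by (auto intro!: N.finsum_cong' simp: coord_basis)
    also have "\<dots> = x i" using that by (intro N.finsum_singleton) auto
    finally show ?thesis .
  qed
  ultimately show ?thesis by auto
qed

end

section \<open>Hermitian forms over a finite ring with a nilpotent principal ideal\<close>

text \<open>
  The element \<open>hf\<close> is one half, and \<open>u\<^sub>\<pi>\<close> witnesses that
  the ideal generated by \<open>\<pi>\<close> is stable under the involution.
\<close>

locale hermitian_module = free_module R M b m for R (structure) and M (structure) and b m +
  fixes star :: "'a \<Rightarrow> 'a" and h :: "'c \<Rightarrow> 'c \<Rightarrow> 'a" and \<pi> hf u\<^sub>\<pi> :: 'a and e :: nat
  assumes finite_R: "finite (carrier R)"
    and \<pi>: "\<pi> \<in> carrier R" and \<pi>_nilpotent: "\<pi> [^] e = \<zero>"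
    and hf: "hf \<in> carrier R" "hf \<oplus> hf = \<one>"
    and star_closed [simp]: "a \<in> carrier R \<Longrightarrow> star a \<in> carrier R"
    and star_add: "a \<in> carrier R \<Longrightarrow> a' \<in> carrier R \<Longrightarrow> star (a \<oplus> a') = star a \<oplus> star a'"
    and star_mult: "a \<in> carrier R \<Longrightarrow> a' \<in> carrier R \<Longrightarrow> star (a \<otimes> a') = star a \<otimes> star a'"
    and star_star [simp]: "a \<in> carrier R \<Longrightarrow> star (star a) = a"
    and u\<^sub>\<pi>: "u\<^sub>\<pi> \<in> carrier R" "star \<pi> = \<pi> \<otimes> u\<^sub>\<pi>"
    and herm: "hermitian_form R star M h"
    and nondeg: "nondegenerate R M h"
begin

definition r :: "'a set" where "r = {\<pi> \<otimes> a | a. a \<in> carrier R}"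
definition rM :: "'c set" where "rM = {\<pi> \<odot>\<^bsub>M\<^esub> v | v. v \<in> carrier M}"

lemma rI: "a \<in> carrier R \<Longrightarrow> \<pi> \<otimes> a \<in> r" by (auto simp: r_def)
lemma rE: "a \<in> r \<Longrightarrow> (\<And>x. x \<in> carrier R \<Longrightarrow> a = \<pi> \<otimes> x \<Longrightarrow> thesis) \<Longrightarrow> thesis"
  unfolding r_def by blast
lemma rMI: "v \<in> carrier M \<Longrightarrow> \<pi> \<odot>\<^bsub>M\<^esub> v \<in> rM" by (auto simp: rM_def)

lemma r_carrier: "a \<in> r \<Longrightarrow> a \<in> carrier R" using \<pi> by (auto simp: r_def)
lemma rM_carrier: "v \<in> rM \<Longrightarrow> v \<in> carrier M" using \<pi> by (auto simp: rM_def)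

lemma r_ideal: "ideal r R"
proof -
  have "r = PIdl \<pi>"
    unfolding r_def cgenideal_def using m_comm[OF \<pi>] by (intro Collect_cong) metis
  then show ?thesis using cgenideal_ideal[OF \<pi>] by simp
qed

sublocale r: ideal r R by (rule r_ideal)
declare r.a_Hcarr [simp del]

lemma rM_submodule: "submodule rM R M"
proof (rule submoduleI)
  show "rM \<subseteq> carrier M" using rM_carrier by auto
  have "\<pi> \<odot>\<^bsub>M\<^esub> \<zero>\<^bsub>M\<^esub> = \<zero>\<^bsub>M\<^esub>" using \<pi> by simp
  then show "\<zero>\<^bsub>M\<^esub> \<in> rM" using rMI[of "\<zero>\<^bsub>M\<^esub>"] by simp
  fix v assume "v \<in> rM"
  then obtain x where x: "x \<in> carrier M" "v = \<pi> \<odot>\<^bsub>M\<^esub> x" by (auto simp: rM_def)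
  show "\<ominus>\<^bsub>M\<^esub> v \<in> rM" using x rMI[of "\<ominus>\<^bsub>M\<^esub> x"] \<pi> by (simp add: smult_r_minus)
  { fix w assume "w \<in> rM"
    then obtain y where y: "y \<in> carrier M" "w = \<pi> \<odot>\<^bsub>M\<^esub> y" by (auto simp: rM_def)
    show "v \<oplus>\<^bsub>M\<^esub> w \<in> rM" using x y rMI[of "x \<oplus>\<^bsub>M\<^esub> y"] \<pi> by (simp add: smult_r_distr) }
  { fix a assume a: "a \<in> carrier R"
    have "a \<odot>\<^bsub>M\<^esub> v = \<pi> \<odot>\<^bsub>M\<^esub> (a \<odot>\<^bsub>M\<^esub> x)"
      using x a \<pi> by (simp add: smult_assoc1[symmetric] m_comm)
    then show "a \<odot>\<^bsub>M\<^esub> v \<in> rM" using rMI[of "a \<odot>\<^bsub>M\<^esub> x"] a x by simp }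
qed

lemma rM_closed:
  shows "\<zero>\<^bsub>M\<^esub> \<in> rM" "v \<in> rM \<Longrightarrow> w \<in> rM \<Longrightarrow> v \<oplus>\<^bsub>M\<^esub> w \<in> rM" "v \<in> rM \<Longrightarrow> \<ominus>\<^bsub>M\<^esub> v \<in> rM"
    "a \<in> carrier R \<Longrightarrow> v \<in> rM \<Longrightarrow> a \<odot>\<^bsub>M\<^esub> v \<in> rM"
proof -
  show "\<zero>\<^bsub>M\<^esub> \<in> rM"
    using subgroup.one_closed[OF submodule.axioms(1)[OF rM_submodule]] by simp
qed (rule submoduleE[OF rM_submodule]; assumption)+

lemma smult_r_rM: "a \<in> r \<Longrightarrow> v \<in> carrier M \<Longrightarrow> a \<odot>\<^bsub>M\<^esub> v \<in> rM"
proof -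
  assume a: "a \<in> r" and v: "v \<in> carrier M"
  from a obtain x where x: "x \<in> carrier R" "a = \<pi> \<otimes> x" unfolding r_def by blast
  have "\<pi> \<odot>\<^bsub>M\<^esub> (x \<odot>\<^bsub>M\<^esub> v) \<in> rM" by (intro rMI smult_closed x v)
  then show ?thesis unfolding x(2) using smult_assoc1[OF \<pi> x(1) v] by simp
qed

lemma star_r: "a \<in> r \<Longrightarrow> star a \<in> r"
proof -
  assume "a \<in> r"
  then obtain x where x: "x \<in> carrier R" "a = \<pi> \<otimes> x" by (rule rE)
  then have "star a = \<pi> \<otimes> (u\<^sub>\<pi> \<otimes> star x)" using star_mult u\<^sub>\<pi> \<pi> by (simp add: m_assoc)
  moreover have "\<pi> \<otimes> (u\<^sub>\<pi> \<otimes> star x) \<in> r" using u\<^sub>\<pi>(1) x(1) by (intro rI) simp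
  ultimately show ?thesis by simp
qed

lemma star_zero: "star \<zero> = \<zero>"
  using star_add[of \<zero> \<zero>] by (simp add: add.r_cancel_one')

lemma star_minus: "a \<in> carrier R \<Longrightarrow> star (\<ominus> a) = \<ominus> star a"
  using star_add[of "\<ominus> a" a] star_zero R.minus_equality[of "star (\<ominus> a)" "star a"] by (simp add: R.l_neg)

lemma double_eq_zero: "a \<in> carrier R \<Longrightarrow> a \<oplus> a = \<zero> \<Longrightarrow> a = \<zero>"
proof -
  assume a: "a \<in> carrier R" "a \<oplus> a = \<zero>"
  have "a = (hf \<oplus> hf) \<otimes> a" using a hf by simp
  also have "\<dots> = hf \<otimes> (a \<oplus> a)" using a(1) hf(1) by (simp add: l_distr r_distr)
  also have "\<dots> = \<zero>" using a(2) hf(1) by simp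
  finally show ?thesis .
qed

lemma finite_M: "finite (carrier M)"
proof (rule finite_surj[where f = comb])
  show "finite ({..<m} \<rightarrow>\<^sub>E carrier R)" by (intro finite_PiE finite_R) auto
  show "carrier M \<subseteq> comb ` ({..<m} \<rightarrow>\<^sub>E carrier R)"
    using coord by (metis image_eqI subsetI)
qed

lemma finite_r: "finite r" using finite_R r_carrier by (meson finite_subset subsetI)

lemma odd_card_r: "odd (card r)"
proof (rule R.odd_card_no_2_torsion[OF finite_r])
  show "r \<subseteq> carrier R" using r_carrier by blast
  show "\<And>x. x \<in> r \<Longrightarrow> x \<oplus> x = \<zero> \<Longrightarrow> x = \<zero>" using r_carrier double_eq_zero by blast
qed simp_all

text \<open>
  A vector lies in \<open>rM\<close> if and only if all its coordinates lie in
  \<open>r\<close>.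
\<close>

lemma card_rM: "card rM = card r ^ m"
proof -
  have "bij_betw comb ({..<m} \<rightarrow>\<^sub>E r) rM"
  proof (rule bij_betwI[where g = "\<lambda>v. coord v"])
    have sub: "a \<in> {..<m} \<rightarrow> carrier R" if "a \<in> {..<m} \<rightarrow>\<^sub>E r" for a
      using that r_carrier by auto
    have comb_\<pi>: "comb (\<lambda>i. \<pi> \<otimes> a i) = \<pi> \<odot>\<^bsub>M\<^esub> comb a" if "a \<in> {..<m} \<rightarrow> carrier R" for a
    proof -
      have "\<pi> \<odot>\<^bsub>M\<^esub> comb a = (\<Oplus>\<^bsub>M\<^esub>i\<in>{..<m}. \<pi> \<odot>\<^bsub>M\<^esub> (a i \<odot>\<^bsub>M\<^esub> b i))"
        unfolding comb_def using that \<pi> by (intro finsum_smult_ldistr) auto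
      also have "\<dots> = comb (\<lambda>i. \<pi> \<otimes> a i)"
        unfolding comb_def using that \<pi> by (intro M.finsum_cong') (auto simp: smult_assoc1 Pi_iff)
      finally show ?thesis by simp
    qed
    show "comb \<in> ({..<m} \<rightarrow>\<^sub>E r) \<rightarrow> rM"
    proof
      fix a assume a: "a \<in> {..<m} \<rightarrow>\<^sub>E r"
      have "\<forall>i\<in>{..<m}. \<exists>x. x \<in> carrier R \<and> a i = \<pi> \<otimes> x" using a by (meson PiE_mem rE)
      then obtain x where x: "\<And>i. i < m \<Longrightarrow> x i \<in> carrier R \<and> a i = \<pi> \<otimes> x i" by (metis lessThan_iff)
      have "comb a = comb (\<lambda>i. \<pi> \<otimes> x i)"
        unfolding comb_def using x \<pi> by (intro M.finsum_cong') auto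
      then show "comb a \<in> rM" using comb_\<pi>[of x] x rMI[of "comb x"] by auto
    qed
    show "coord \<in> rM \<rightarrow> ({..<m} \<rightarrow>\<^sub>E r)"
    proof
      fix v assume v: "v \<in> rM"
      then obtain w where w: "w \<in> carrier M" "v = \<pi> \<odot>\<^bsub>M\<^esub> w" by (auto simp: rM_def)
      show "coord v \<in> {..<m} \<rightarrow>\<^sub>E r"
        using coord(1)[OF rM_carrier[OF v]] coord_smult[OF \<pi> w(1)] w
        by (auto simp: PiE_iff intro!: rI)
    qed
    show "coord (comb a) = a" if "a \<in> {..<m} \<rightarrow>\<^sub>E r" for a
    proof (rule extensionalityI[where A = "{..<m}"])
      show "coord (comb a) \<in> extensional {..<m}" using coord(1)[OF comb_closed[OF sub[OF that]]] by (auto simp: PiE_def)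
      show "a \<in> extensional {..<m}" using that by (auto simp: PiE_def)
    qed (use coord_unique[OF sub[OF that]] in auto)
    show "comb (coord v) = v" if "v \<in> rM" for v using coord(2) rM_carrier that by auto
  qed
  then have "card rM = card ({..<m} \<rightarrow>\<^sub>E r)" by (simp add: bij_betw_same_card)
  then show ?thesis by (simp add: card_PiE)
qed

definition End where "End = linear_maps R M M"
definition Hom_r where "Hom_r = {N \<in> End. \<forall>v\<in>carrier M. N v \<in> rM}"

lemma EndD:
  assumes "f \<in> End"
  shows "v \<in> carrier M \<Longrightarrow> f v \<in> carrier M"
    and "v \<in> carrier M \<Longrightarrow> w \<in> carrier M \<Longrightarrow> f (v \<oplus>\<^bsub>M\<^esub> w) = f v \<oplus>\<^bsub>M\<^esub> f w"
    and "a \<in> carrier R \<Longrightarrow> v \<in> carrier M \<Longrightarrow> f (a \<odot>\<^bsub>M\<^esub> v) = a \<odot>\<^bsub>M\<^esub> f v"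
    and "f \<zero>\<^bsub>M\<^esub> = \<zero>\<^bsub>M\<^esub>" and "v \<in> carrier M \<Longrightarrow> f (\<ominus>\<^bsub>M\<^esub> v) = \<ominus>\<^bsub>M\<^esub> f v"
    and "f \<in> extensional (carrier M)"
proof -
  have f: "f \<in> linear_maps R M M" using assms by (simp add: End_def)
  show "v \<in> carrier M \<Longrightarrow> f v \<in> carrier M"
    and "v \<in> carrier M \<Longrightarrow> w \<in> carrier M \<Longrightarrow> f (v \<oplus>\<^bsub>M\<^esub> w) = f v \<oplus>\<^bsub>M\<^esub> f w"
    and "a \<in> carrier R \<Longrightarrow> v \<in> carrier M \<Longrightarrow> f (a \<odot>\<^bsub>M\<^esub> v) = a \<odot>\<^bsub>M\<^esub> f v"
    and "f \<in> extensional (carrier M)"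
    by (rule linear_mapsD[OF f]; assumption)+
  show "f \<zero>\<^bsub>M\<^esub> = \<zero>\<^bsub>M\<^esub>" by (rule linear_maps_zero[OF module_axioms module_axioms f])
  show "v \<in> carrier M \<Longrightarrow> f (\<ominus>\<^bsub>M\<^esub> v) = \<ominus>\<^bsub>M\<^esub> f v"
    by (rule linear_maps_minus[OF module_axioms module_axioms f])
qed

lemma finite_End: "finite End"
  by (rule finite_subset[of _ "carrier M \<rightarrow>\<^sub>E carrier M"])
     (auto simp: End_def linear_maps_def intro!: finite_PiE finite_M)

text \<open>
  A linear map into \<open>rM\<close> amounts to a free choice of the images of the
  \<open>m\<close> basis vectors.
\<close>

lemma card_Hom_r: "card Hom_r = card r ^ (m * m)"
proof -
  have "bij_betw (\<lambda>N. \<lambda>i\<in>{..<m}. N (b i)) Hom_r ({..<m} \<rightarrow>\<^sub>E rM)"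
    unfolding bij_betw_def
  proof
    show "inj_on (\<lambda>N. \<lambda>i\<in>{..<m}. N (b i)) Hom_r"
    proof (rule inj_onI)
      fix N N' assume N: "N \<in> Hom_r" "N' \<in> Hom_r"
        and eq: "(\<lambda>i\<in>{..<m}. N (b i)) = (\<lambda>i\<in>{..<m}. N' (b i))"
      have "N (b i) = N' (b i)" if "i < m" for i using fun_cong[OF eq, of i] that by simp
      then show "N = N'" using N linear_maps_eqI[OF module_axioms] by (auto simp: Hom_r_def End_def)
    qed
    show "(\<lambda>N. \<lambda>i\<in>{..<m}. N (b i)) ` Hom_r = ({..<m} \<rightarrow>\<^sub>E rM)"
    proof
      show "(\<lambda>N. \<lambda>i\<in>{..<m}. N (b i)) ` Hom_r \<subseteq> ({..<m} \<rightarrow>\<^sub>E rM)"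
        by (intro image_subsetI) (simp add: Hom_r_def restrict_PiE_iff)
      show "({..<m} \<rightarrow>\<^sub>E rM) \<subseteq> (\<lambda>N. \<lambda>i\<in>{..<m}. N (b i)) ` Hom_r"
      proof
        fix x assume x: "x \<in> {..<m} \<rightarrow>\<^sub>E rM"
        then have "x \<in> {..<m} \<rightarrow> carrier M" using rM_carrier by (meson PiE_mem Pi_I)
        then obtain N where N: "N \<in> End" "\<forall>i<m. N (b i) = x i"
          using linear_map_exists[OF module_axioms] unfolding End_def by blast
        have "N v \<in> rM" if "v \<in> carrier M" for v
          using that
        proof (induct v rule: basis_induct)
          case (smult a i)
          then show ?case using N PiE_mem[OF x, of i] EndD(3)[OF N(1)] rM_closed(4) by simp
        qed (use EndD[OF N(1)] rM_closed in auto)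
        then have "N \<in> Hom_r" using N by (simp add: Hom_r_def)
        moreover have "x = (\<lambda>i\<in>{..<m}. N (b i))"
          using N x by (intro extensionalityI[where A = "{..<m}"]) (auto simp: PiE_def)
        ultimately show "x \<in> (\<lambda>N. \<lambda>i\<in>{..<m}. N (b i)) ` Hom_r" by blast
      qed
    qed
  qed
  then have "card Hom_r = card ({..<m} \<rightarrow>\<^sub>E rM)" by (simp add: bij_betw_same_card)
  then show ?thesis by (simp add: card_PiE card_rM power_mult)
qed

subsection \<open>Sesquilinear forms and self-adjoint operators\<close>

lemma h_closed [simp]: "v \<in> carrier M \<Longrightarrow> w \<in> carrier M \<Longrightarrow> h v w \<in> carrier R"
  and h_add_left: "v \<in> carrier M \<Longrightarrow> w \<in> carrier M \<Longrightarrow> x \<in> carrier M \<Longrightarrow> h (v \<oplus>\<^bsub>M\<^esub> w) x = h v x \<oplus> h w x"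
  and h_add_right: "v \<in> carrier M \<Longrightarrow> w \<in> carrier M \<Longrightarrow> x \<in> carrier M \<Longrightarrow> h v (w \<oplus>\<^bsub>M\<^esub> x) = h v w \<oplus> h v x"
  and h_smult_right: "a \<in> carrier R \<Longrightarrow> v \<in> carrier M \<Longrightarrow> w \<in> carrier M \<Longrightarrow> h v (a \<odot>\<^bsub>M\<^esub> w) = a \<otimes> h v w"
  and h_star: "v \<in> carrier M \<Longrightarrow> w \<in> carrier M \<Longrightarrow> star (h v w) = h w v"
  using herm[unfolded hermitian_form_def] by (blast, blast, blast, blast, metis)

lemma h_smult_left:
  assumes "a \<in> carrier R" "v \<in> carrier M" "w \<in> carrier M"
  shows "h (a \<odot>\<^bsub>M\<^esub> v) w = star a \<otimes> h v w"
  using assms h_star[of w "a \<odot>\<^bsub>M\<^esub> v"] h_star[of w v] by (simp add: h_smult_right star_mult)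

lemma h_zero: "v \<in> carrier M \<Longrightarrow> h \<zero>\<^bsub>M\<^esub> v = \<zero>" "v \<in> carrier M \<Longrightarrow> h v \<zero>\<^bsub>M\<^esub> = \<zero>"
  using h_smult_left[of \<zero> "\<zero>\<^bsub>M\<^esub>" v] h_smult_right[of \<zero> v "\<zero>\<^bsub>M\<^esub>"] by (auto simp: star_zero)

lemma h_rM: "v \<in> carrier M \<Longrightarrow> w \<in> rM \<Longrightarrow> h v w \<in> r" "v \<in> rM \<Longrightarrow> w \<in> carrier M \<Longrightarrow> h v w \<in> r"
  using \<pi> star_r[of \<pi>] rI[of \<one>]
  by (auto simp: rM_def h_smult_right h_smult_left r.I_r_closed)

lemma h_eqI:
  assumes "v \<in> carrier M" "v' \<in> carrier M" "\<And>w. w \<in> carrier M \<Longrightarrow> h v w = h v' w"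
  shows "v = v'"
proof -
  have "inj_on (\<lambda>u. \<lambda>v\<in>carrier M. h u v) (carrier M)"
    using nondeg by (simp add: nondegenerate_def bij_betw_def)
  then show ?thesis using assms by (auto elim!: inj_onD intro!: restrict_ext)
qed

lemma h_represents:
  assumes "f \<in> linear_functionals R M"
  shows "\<exists>v\<in>carrier M. \<forall>w\<in>carrier M. h v w = f w"
proof -
  have "f \<in> (\<lambda>u. \<lambda>v\<in>carrier M. h u v) ` carrier M"
    using nondeg assms by (simp add: nondegenerate_def bij_betw_def)
  then show ?thesis by force
qed

text \<open>
  Divide the prescribed values by \<open>\<pi>\<close>, represent the resulting functional by
  a vector, and multiply that vector by \<open>star \<pi>\<close>; the form is semilinear on
  the left and turns this factor back into \<open>\<pi>\<close>.
\<close>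

lemma h_represents_r:
  assumes "\<And>j. j < m \<Longrightarrow> c j \<in> r"
  shows "\<exists>w\<in>rM. \<forall>j<m. h w (b j) = c j"
proof -
  have "\<forall>j. \<exists>x. j < m \<longrightarrow> x \<in> carrier R \<and> c j = \<pi> \<otimes> x" using assms by (meson rE)
  then obtain x where x: "\<And>j. j < m \<Longrightarrow> x j \<in> carrier R \<and> c j = \<pi> \<otimes> x j" by metis
  obtain f where f: "f \<in> linear_functionals R M" "\<forall>j<m. f (b j) = x j"
    using linear_map_exists[OF regular_module, of x] x
    by (auto simp: linear_functionals_eq regular_module_def)
  obtain v where v: "v \<in> carrier M" "\<forall>w\<in>carrier M. h v w = f w" using h_represents[OF f(1)] by auto
  have "star \<pi> \<odot>\<^bsub>M\<^esub> v \<in> rM" using smult_r_rM star_r rI[of \<one>] \<pi> v by simp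
  moreover have "h (star \<pi> \<odot>\<^bsub>M\<^esub> v) (b j) = c j" if "j < m" for j
    using that v f x \<pi> by (simp add: h_smult_left)
  ultimately show ?thesis by auto
qed

definition sesquilinear :: "('c \<Rightarrow> 'c \<Rightarrow> 'a) \<Rightarrow> bool" where
  "sesquilinear \<beta> \<longleftrightarrow>
     (\<forall>v\<in>carrier M. \<forall>w\<in>carrier M. \<beta> v w \<in> carrier R) \<and>
     (\<forall>v\<in>carrier M. \<forall>w\<in>carrier M. \<forall>x\<in>carrier M. \<beta> (v \<oplus>\<^bsub>M\<^esub> w) x = \<beta> v x \<oplus> \<beta> w x) \<and>
     (\<forall>v\<in>carrier M. \<forall>w\<in>carrier M. \<forall>x\<in>carrier M. \<beta> v (w \<oplus>\<^bsub>M\<^esub> x) = \<beta> v w \<oplus> \<beta> v x) \<and>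
     (\<forall>a\<in>carrier R. \<forall>v\<in>carrier M. \<forall>w\<in>carrier M. \<beta> (a \<odot>\<^bsub>M\<^esub> v) w = star a \<otimes> \<beta> v w) \<and>
     (\<forall>a\<in>carrier R. \<forall>v\<in>carrier M. \<forall>w\<in>carrier M. \<beta> v (a \<odot>\<^bsub>M\<^esub> w) = a \<otimes> \<beta> v w)"

lemma sesquilinear_h:
  assumes "f \<in> End" "g \<in> End"
  shows "sesquilinear (\<lambda>v w. h (f v) (g w))"
  using EndD[OF assms(1)] EndD[OF assms(2)]
  by (auto simp: sesquilinear_def h_add_left h_add_right h_smult_left h_smult_right)

lemma sesquilinear_eqI:
  assumes \<beta>: "sesquilinear \<beta>" and \<gamma>: "sesquilinear \<gamma>"
    and eq: "\<And>i j. i < m \<Longrightarrow> j < m \<Longrightarrow> \<beta> (b i) (b j) = \<gamma> (b i) (b j)"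
    and v: "v \<in> carrier M" and w: "w \<in> carrier M"
  shows "\<beta> v w = \<gamma> v w"
proof -
  have null: "\<delta> \<zero>\<^bsub>M\<^esub> x = \<zero>" "\<delta> x \<zero>\<^bsub>M\<^esub> = \<zero>" if "sesquilinear \<delta>" "x \<in> carrier M" for \<delta> x
  proof -
    have "\<delta> (\<zero> \<odot>\<^bsub>M\<^esub> \<zero>\<^bsub>M\<^esub>) x = star \<zero> \<otimes> \<delta> \<zero>\<^bsub>M\<^esub> x" "\<delta> x (\<zero> \<odot>\<^bsub>M\<^esub> \<zero>\<^bsub>M\<^esub>) = \<zero> \<otimes> \<delta> x \<zero>\<^bsub>M\<^esub>"
      "\<delta> \<zero>\<^bsub>M\<^esub> x \<in> carrier R" "\<delta> x \<zero>\<^bsub>M\<^esub> \<in> carrier R"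
      using that unfolding sesquilinear_def by blast+
    then show "\<delta> \<zero>\<^bsub>M\<^esub> x = \<zero>" "\<delta> x \<zero>\<^bsub>M\<^esub> = \<zero>" by (simp_all add: star_zero)
  qed
  have 1: "\<beta> (b i) w = \<gamma> (b i) w" if i: "i < m" for i
    using w
  proof (induct w rule: basis_induct)
    case zero show ?case using null[OF \<beta>] null[OF \<gamma>] i by simp
  next
    case (add w x)
    then show ?case using \<beta> \<gamma> b_closed[OF i] unfolding sesquilinear_def by metis
  next
    case (smult a j)
    then show ?case using \<beta> \<gamma> b_closed[OF i] b_closed[OF smult(2)] eq[OF i smult(2)]
      unfolding sesquilinear_def by metis
  qed
  show ?thesis
    using v
  proof (induct v rule: basis_induct)
    case zero show ?case using null[OF \<beta>] null[OF \<gamma>] w by simp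
  next
    case (add v x)
    then show ?case using \<beta> \<gamma> w unfolding sesquilinear_def by metis
  next
    case (smult a i)
    then show ?case using \<beta> \<gamma> w b_closed[OF smult(2)] 1[OF smult(2)]
      unfolding sesquilinear_def by metis
  qed
qed

text \<open>
  Non-degeneracy makes an operator out of the hermitian form with the matrix \<open>c\<close>;
  the symmetry of \<open>c\<close> says that the operator is self-adjoint.
\<close>

lemma self_adjoint_exists:
  assumes c: "\<And>i j. i < m \<Longrightarrow> j < m \<Longrightarrow> c i j \<in> r"
    and c_star: "\<And>i j. i < m \<Longrightarrow> j < m \<Longrightarrow> star (c i j) = c j i"
  shows "\<exists>N\<in>Hom_r. (\<forall>i<m. \<forall>j<m. h (N (b i)) (b j) = c i j) \<and>
    (\<forall>v\<in>carrier M. \<forall>w\<in>carrier M. h (N v) w = h v (N w))"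
proof -
  have "\<forall>i. \<exists>w. i < m \<longrightarrow> w \<in> rM \<and> (\<forall>j<m. h w (b j) = c i j)"
    using h_represents_r c by (metis (no_types, lifting))
  then obtain x where x: "\<And>i. i < m \<Longrightarrow> x i \<in> rM \<and> (\<forall>j<m. h (x i) (b j) = c i j)" by metis
  obtain N where N: "N \<in> End" "\<forall>i<m. N (b i) = x i"
    using linear_map_exists[OF module_axioms, of x] x rM_carrier unfolding End_def by blast
  have "N v \<in> rM" if "v \<in> carrier M" for v
    using that
  proof (induct v rule: basis_induct)
    case (smult a i) then show ?case using N x EndD(3)[OF N(1)] rM_closed(4) by auto
  qed (use EndD[OF N(1)] rM_closed in auto)
  then have "N \<in> Hom_r" using N by (simp add: Hom_r_def)
  moreover have Nc: "h (N (b i)) (b j) = c i j" if "i < m" "j < m" for i j using N x that by simp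
  moreover have "h (N v) w = h v (N w)" if vw: "v \<in> carrier M" "w \<in> carrier M" for v w
  proof -
    have id: "(\<lambda>x\<in>carrier M. x) \<in> End" by (auto simp: End_def intro!: linear_mapsI)
    have "h (N v) ((\<lambda>x\<in>carrier M. x) w) = h ((\<lambda>x\<in>carrier M. x) v) (N w)"
    proof (rule sesquilinear_eqI[OF sesquilinear_h[OF N(1) id] sesquilinear_h[OF id N(1)] _ vw])
      fix i j assume ij: "i < m" "j < m"
      have "h (N (b i)) (b j) = star (h (N (b j)) (b i))" using Nc c_star ij by simp
      also have "\<dots> = h (b i) (N (b j))" using ij EndD(1)[OF N(1)] by (intro h_star) auto
      finally show "h (N (b i)) ((\<lambda>x\<in>carrier M. x) (b j)) = h ((\<lambda>x\<in>carrier M. x) (b i)) (N (b j))"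
        using ij by simp
    qed
    then show ?thesis using vw by simp
  qed
  ultimately show ?thesis by blast
qed

section \<open>The congruence subgroup\<close>

lemma id_End: "(\<lambda>x\<in>carrier M. x) \<in> End"
  by (auto simp: End_def intro!: linear_mapsI)

lemma compose_End:
  assumes "f \<in> End" "g \<in> End"
  shows "compose (carrier M) f g \<in> End"
  using EndD[OF assms(1)] EndD[OF assms(2)]
  by (auto simp: End_def compose_def intro!: linear_mapsI)

lemma End_diff:
  assumes "g \<in> End" "v \<in> carrier M" "w \<in> carrier M"
  shows "g (v \<ominus>\<^bsub>M\<^esub> w) = g v \<ominus>\<^bsub>M\<^esub> g w"
  using EndD[OF assms(1)] assms(2,3) by (simp add: M.minus_eq)

lemma End_inverse:
  assumes g: "g \<in> End" and ker: "\<And>v. v \<in> carrier M \<Longrightarrow> g v = \<zero>\<^bsub>M\<^esub> \<Longrightarrow> v = \<zero>\<^bsub>M\<^esub>"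
  shows "bij_betw g (carrier M) (carrier M)"
    and "\<exists>g'\<in>End. \<forall>v\<in>carrier M. g (g' v) = v \<and> g' (g v) = v"
proof -
  have inj: "inj_on g (carrier M)"
  proof (rule inj_onI)
    fix v w assume vw: "v \<in> carrier M" "w \<in> carrier M" "g v = g w"
    then have "g (v \<ominus>\<^bsub>M\<^esub> w) = \<zero>\<^bsub>M\<^esub>"
      using End_diff[OF g vw(1,2)] EndD(1)[OF g] vw by (simp add: M.minus_eq_zero_iff)
    then have "v \<ominus>\<^bsub>M\<^esub> w = \<zero>\<^bsub>M\<^esub>" using ker vw by simp
    then show "v = w" using vw by (simp add: M.minus_eq_zero_iff)
  qed
  have "g ` carrier M \<subseteq> carrier M" using EndD(1)[OF g] by blast
  with inj have surj: "g ` carrier M = carrier M" by (simp add: endo_inj_surj finite_M)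
  then show bij: "bij_betw g (carrier M) (carrier M)" using inj by (simp add: bij_betw_def)
  define g' where "g' = (\<lambda>v\<in>carrier M. inv_into (carrier M) g v)"
  have gg': "g (g' v) = v" "g' v \<in> carrier M" if "v \<in> carrier M" for v
    using that surj unfolding g'_def by (simp_all add: f_inv_into_f inv_into_into)
  have eqI: "v = w" if "v \<in> carrier M" "w \<in> carrier M" "g v = g w" for v w
    using inj_onD[OF inj that(3,1,2)] .
  have "g' \<in> End"
    unfolding End_def
  proof (rule linear_mapsI)
    show "g' \<in> extensional (carrier M)" by (simp add: g'_def)
    fix v w assume vw: "v \<in> carrier M" "w \<in> carrier M"
    show "g' (v \<oplus>\<^bsub>M\<^esub> w) = g' v \<oplus>\<^bsub>M\<^esub> g' w"
      by (rule eqI) (simp_all add: vw gg' EndD(2)[OF g])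
  next
    fix a v assume av: "a \<in> carrier R" "v \<in> carrier M"
    show "g' (a \<odot>\<^bsub>M\<^esub> v) = a \<odot>\<^bsub>M\<^esub> g' v"
      by (rule eqI) (simp_all add: av gg' EndD(3)[OF g])
  qed (rule gg')
  moreover have "g' (g v) = v" if "v \<in> carrier M" for v
    by (rule eqI) (simp_all add: that gg' EndD(1)[OF g])
  ultimately show "\<exists>g'\<in>End. \<forall>v\<in>carrier M. g (g' v) = v \<and> g' (g v) = v"
    using gg' by blast
qed

text \<open>
  The congruence subgroup: the operators that induce the identity on \<open>M/rM\<close>.
\<close>

definition \<Gamma> where "\<Gamma> = {T \<in> End. \<forall>v\<in>carrier M. T v \<ominus>\<^bsub>M\<^esub> v \<in> rM}"

lemma \<Gamma>D: "T \<in> \<Gamma> \<Longrightarrow> T \<in> End" "T \<in> \<Gamma> \<Longrightarrow> v \<in> carrier M \<Longrightarrow> T v \<ominus>\<^bsub>M\<^esub> v \<in> rM"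
  by (auto simp: \<Gamma>_def)

text \<open>
  The argument of Nakayama's lemma: if a vector \<open>v = \<pi>\<^sup>k w\<close> is killed
  by \<open>T\<close>, then \<open>T w \<in> w + \<pi>M\<close> shows that \<open>v\<close> is
  divisible by \<open>\<pi>\<^bsup>k+1\<^esup>\<close>. As \<open>\<pi>\<close> is nilpotent,
  \<open>v = 0\<close>.
\<close>

lemma \<Gamma>_kernel:
  assumes T: "T \<in> \<Gamma>" and v: "v \<in> carrier M" "T v = \<zero>\<^bsub>M\<^esub>"
  shows "v = \<zero>\<^bsub>M\<^esub>"
proof -
  have "\<exists>w\<in>carrier M. v = \<pi> [^] k \<odot>\<^bsub>M\<^esub> w" for k :: nat
  proof (induct k)
    case 0 then show ?case using v by auto
  next
    case (Suc k)
    then obtain w where w: "w \<in> carrier M" "v = \<pi> [^] k \<odot>\<^bsub>M\<^esub> w" by blast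
    have pk: "\<pi> [^] k \<in> carrier R" using \<pi> by simp
    from \<Gamma>D(2)[OF T w(1)] obtain x where x: "x \<in> carrier M" "T w \<ominus>\<^bsub>M\<^esub> w = \<pi> \<odot>\<^bsub>M\<^esub> x"
      unfolding rM_def by blast
    have "\<zero>\<^bsub>M\<^esub> = \<pi> [^] k \<odot>\<^bsub>M\<^esub> T w"
      using v w EndD(3)[OF \<Gamma>D(1)[OF T] pk w(1)] by simp
    also have "T w = w \<oplus>\<^bsub>M\<^esub> (T w \<ominus>\<^bsub>M\<^esub> w)"
      using EndD(1)[OF \<Gamma>D(1)[OF T] w(1)] w(1) by (simp add: M.add_minus_cancel)
    also have "\<pi> [^] k \<odot>\<^bsub>M\<^esub> (w \<oplus>\<^bsub>M\<^esub> (T w \<ominus>\<^bsub>M\<^esub> w)) = v \<oplus>\<^bsub>M\<^esub> \<pi> [^] Suc k \<odot>\<^bsub>M\<^esub> x"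
      using pk w x \<pi> by (simp add: smult_r_distr smult_assoc1)
    finally have "v \<oplus>\<^bsub>M\<^esub> \<pi> [^] Suc k \<odot>\<^bsub>M\<^esub> x = \<zero>\<^bsub>M\<^esub>" by simp
    then have "v = \<ominus>\<^bsub>M\<^esub> (\<pi> [^] Suc k \<odot>\<^bsub>M\<^esub> x)"
      using v(1) x(1) pk \<pi> M.minus_equality by (metis R.nat_pow_closed smult_closed)
    then have "v = \<pi> [^] Suc k \<odot>\<^bsub>M\<^esub> (\<ominus>\<^bsub>M\<^esub> x)"
      using smult_r_minus[of "\<pi> [^] Suc k" x] x(1) \<pi> by simp
    then show ?case using x(1) by blast
  qed
  from this[of e] show ?thesis using \<pi>_nilpotent by auto
qed

lemma \<Gamma>_id: "(\<lambda>x\<in>carrier M. x) \<in> \<Gamma>"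
  using rM_closed(1) by (auto simp: \<Gamma>_def id_End M.minus_eq M.r_neg)

lemma \<Gamma>_compose:
  assumes "S \<in> \<Gamma>" "T \<in> \<Gamma>"
  shows "compose (carrier M) S T \<in> \<Gamma>"
proof -
  have "S (T v) \<ominus>\<^bsub>M\<^esub> v \<in> rM" if v: "v \<in> carrier M" for v
  proof -
    have c: "T v \<in> carrier M" "S (T v) \<in> carrier M"
      using EndD(1)[OF \<Gamma>D(1)[OF assms(1)]] EndD(1)[OF \<Gamma>D(1)[OF assms(2)]] v by auto
    have "S (T v) \<ominus>\<^bsub>M\<^esub> v = (S (T v) \<ominus>\<^bsub>M\<^esub> T v) \<oplus>\<^bsub>M\<^esub> (T v \<ominus>\<^bsub>M\<^esub> v)"
      using c v by (simp add: M.minus_eq M.a_assoc M.r_neg1)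
    then show ?thesis using \<Gamma>D(2)[OF assms(1) c(1)] \<Gamma>D(2)[OF assms(2) v] rM_closed(2) by simp
  qed
  then show ?thesis using assms compose_End by (simp add: \<Gamma>_def compose_eq)
qed

lemma \<Gamma>_inverse:
  assumes T: "T \<in> \<Gamma>"
  shows "\<exists>S\<in>\<Gamma>. \<forall>v\<in>carrier M. T (S v) = v \<and> S (T v) = v"
proof -
  obtain S where S: "S \<in> End" "\<forall>v\<in>carrier M. T (S v) = v \<and> S (T v) = v"
    using End_inverse(2)[OF \<Gamma>D(1)[OF T] \<Gamma>_kernel[OF T]] by blast
  have "S v \<ominus>\<^bsub>M\<^esub> v \<in> rM" if v: "v \<in> carrier M" for v
  proof -
    have Sv: "S v \<in> carrier M" using EndD(1)[OF S(1) v] .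
    have "\<ominus>\<^bsub>M\<^esub> (T (S v) \<ominus>\<^bsub>M\<^esub> S v) \<in> rM" using \<Gamma>D(2)[OF T Sv] by (rule rM_closed(3))
    moreover have "\<ominus>\<^bsub>M\<^esub> (T (S v) \<ominus>\<^bsub>M\<^esub> S v) = S v \<ominus>\<^bsub>M\<^esub> v"
      using S v Sv by (simp add: M.minus_eq M.minus_add M.a_comm)
    ultimately show ?thesis by simp
  qed
  then show ?thesis using S by (auto simp: \<Gamma>_def)
qed

definition \<Gamma>_group where
  "\<Gamma>_group = \<lparr>carrier = \<Gamma>, monoid.mult = compose (carrier M), one = \<lambda>x\<in>carrier M. x\<rparr>"

lemma \<Gamma>_ext: "T \<in> \<Gamma> \<Longrightarrow> T \<in> extensional (carrier M)"
  using EndD(6) \<Gamma>D(1) by blast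

lemma \<Gamma>_closed: "T \<in> \<Gamma> \<Longrightarrow> v \<in> carrier M \<Longrightarrow> T v \<in> carrier M"
  using EndD(1) \<Gamma>D(1) by blast

lemma group_\<Gamma>: "group \<Gamma>_group"
proof (rule groupI)
  fix S assume "S \<in> carrier \<Gamma>_group"
  then have S: "S \<in> \<Gamma>" by (simp add: \<Gamma>_group_def)
  then show "\<one>\<^bsub>\<Gamma>_group\<^esub> \<otimes>\<^bsub>\<Gamma>_group\<^esub> S = S"
    using \<Gamma>_ext \<Gamma>_closed by (auto simp: \<Gamma>_group_def intro: Id_compose)
  obtain T where T: "T \<in> \<Gamma>" "\<forall>v\<in>carrier M. S (T v) = v \<and> T (S v) = v" using \<Gamma>_inverse[OF S] by blast
  then have "compose (carrier M) T S = (\<lambda>x\<in>carrier M. x)"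
    by (auto simp: compose_def intro: restrict_ext)
  then show "\<exists>T\<in>carrier \<Gamma>_group. T \<otimes>\<^bsub>\<Gamma>_group\<^esub> S = \<one>\<^bsub>\<Gamma>_group\<^esub>"
    using T(1) by (auto simp: \<Gamma>_group_def)
next
  fix S T W assume "S \<in> carrier \<Gamma>_group" "T \<in> carrier \<Gamma>_group" "W \<in> carrier \<Gamma>_group"
  then have STW: "S \<in> \<Gamma>" "T \<in> \<Gamma>" "W \<in> \<Gamma>" by (simp_all add: \<Gamma>_group_def)
  then show "S \<otimes>\<^bsub>\<Gamma>_group\<^esub> T \<otimes>\<^bsub>\<Gamma>_group\<^esub> W = S \<otimes>\<^bsub>\<Gamma>_group\<^esub> (T \<otimes>\<^bsub>\<Gamma>_group\<^esub> W)"
    using \<Gamma>_closed[OF STW(3)] by (auto simp: \<Gamma>_group_def compose_def intro!: restrict_ext)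
qed (auto simp: \<Gamma>_group_def \<Gamma>_id \<Gamma>_compose)

lemma add_Hom_r_in_End:
  assumes "g \<in> End" "N \<in> Hom_r"
  shows "(\<lambda>v\<in>carrier M. g v \<oplus>\<^bsub>M\<^esub> N v) \<in> End"
proof -
  have N: "N \<in> End" using assms(2) by (simp add: Hom_r_def)
  show ?thesis
    unfolding End_def
  proof (rule linear_mapsI)
    fix v w assume "v \<in> carrier M" "w \<in> carrier M"
    then show "(\<lambda>v\<in>carrier M. g v \<oplus>\<^bsub>M\<^esub> N v) (v \<oplus>\<^bsub>M\<^esub> w)
        = (\<lambda>v\<in>carrier M. g v \<oplus>\<^bsub>M\<^esub> N v) v \<oplus>\<^bsub>M\<^esub> (\<lambda>v\<in>carrier M. g v \<oplus>\<^bsub>M\<^esub> N v) w"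
      using EndD[OF assms(1)] EndD[OF N] by (simp add: M.a_ac)
  qed (use EndD[OF assms(1)] EndD[OF N] in \<open>auto simp: smult_r_distr\<close>)
qed

lemma bij_betw_add_Hom_r:
  assumes g: "g \<in> End"
  shows "bij_betw (\<lambda>N. \<lambda>v\<in>carrier M. g v \<oplus>\<^bsub>M\<^esub> N v) Hom_r {f \<in> End. \<forall>v\<in>carrier M. f v \<ominus>\<^bsub>M\<^esub> g v \<in> rM}"
proof (rule bij_betwI[where g = "\<lambda>f. \<lambda>v\<in>carrier M. f v \<ominus>\<^bsub>M\<^esub> g v"])
  have diff: "g v \<oplus>\<^bsub>M\<^esub> x \<ominus>\<^bsub>M\<^esub> g v = x" if "v \<in> carrier M" "x \<in> carrier M" for v x
    using EndD(1)[OF g that(1)] that by (simp add: M.minus_eq M.a_ac M.r_neg1 M.r_neg2 M.r_neg)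
  show "(\<lambda>N. \<lambda>v\<in>carrier M. g v \<oplus>\<^bsub>M\<^esub> N v) \<in> Hom_r \<rightarrow> {f \<in> End. \<forall>v\<in>carrier M. f v \<ominus>\<^bsub>M\<^esub> g v \<in> rM}"
  proof
    fix N assume N: "N \<in> Hom_r"
    then show "(\<lambda>v\<in>carrier M. g v \<oplus>\<^bsub>M\<^esub> N v) \<in> {f \<in> End. \<forall>v\<in>carrier M. f v \<ominus>\<^bsub>M\<^esub> g v \<in> rM}"
      using add_Hom_r_in_End[OF g N] diff rM_carrier by (simp add: Hom_r_def)
  qed
  show "(\<lambda>f. \<lambda>v\<in>carrier M. f v \<ominus>\<^bsub>M\<^esub> g v) \<in> {f \<in> End. \<forall>v\<in>carrier M. f v \<ominus>\<^bsub>M\<^esub> g v \<in> rM} \<rightarrow> Hom_r"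
  proof
    fix f assume f: "f \<in> {f \<in> End. \<forall>v\<in>carrier M. f v \<ominus>\<^bsub>M\<^esub> g v \<in> rM}"
    then have fE: "f \<in> End" by simp
    have "(\<lambda>v\<in>carrier M. f v \<ominus>\<^bsub>M\<^esub> g v) \<in> End"
      unfolding End_def
    proof (rule linear_mapsI)
      fix v w assume "v \<in> carrier M" "w \<in> carrier M"
      then show "(\<lambda>v\<in>carrier M. f v \<ominus>\<^bsub>M\<^esub> g v) (v \<oplus>\<^bsub>M\<^esub> w)
          = (\<lambda>v\<in>carrier M. f v \<ominus>\<^bsub>M\<^esub> g v) v \<oplus>\<^bsub>M\<^esub> (\<lambda>v\<in>carrier M. f v \<ominus>\<^bsub>M\<^esub> g v) w"
        using EndD[OF fE] EndD[OF g] by (simp add: M.minus_eq M.minus_add M.a_ac)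
    qed (use EndD[OF fE] EndD[OF g] in \<open>auto simp: M.minus_eq smult_r_distr smult_r_minus\<close>)
    then show "(\<lambda>v\<in>carrier M. f v \<ominus>\<^bsub>M\<^esub> g v) \<in> Hom_r" using f by (simp add: Hom_r_def)
  qed
  show "(\<lambda>v\<in>carrier M. (\<lambda>v\<in>carrier M. g v \<oplus>\<^bsub>M\<^esub> N v) v \<ominus>\<^bsub>M\<^esub> g v) = N" if "N \<in> Hom_r" for N
  proof (rule extensionalityI[where A = "carrier M"])
    show "N \<in> extensional (carrier M)" using that EndD(6) by (simp add: Hom_r_def)
  qed (use that diff rM_carrier in \<open>auto simp: Hom_r_def\<close>)
  show "(\<lambda>v\<in>carrier M. g v \<oplus>\<^bsub>M\<^esub> (\<lambda>v\<in>carrier M. f v \<ominus>\<^bsub>M\<^esub> g v) v) = f"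
    if "f \<in> {f \<in> End. \<forall>v\<in>carrier M. f v \<ominus>\<^bsub>M\<^esub> g v \<in> rM}" for f
  proof (rule extensionalityI[where A = "carrier M"])
    show "f \<in> extensional (carrier M)" using that EndD(6) by simp
    fix v assume v: "v \<in> carrier M"
    then show "(\<lambda>v\<in>carrier M. g v \<oplus>\<^bsub>M\<^esub> (\<lambda>v\<in>carrier M. f v \<ominus>\<^bsub>M\<^esub> g v) v) v = f v"
      using that EndD(1)[OF g v] EndD(1)[of f v] by (simp add: M.add_minus_cancel)
  qed simp
qed

lemma card_\<Gamma>: "card \<Gamma> = card r ^ (m * m)"
proof -
  have "\<Gamma> = {f \<in> End. \<forall>v\<in>carrier M. f v \<ominus>\<^bsub>M\<^esub> (\<lambda>x\<in>carrier M. x) v \<in> rM}"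
    by (simp add: \<Gamma>_def)
  then show ?thesis
    using bij_betw_same_card[OF bij_betw_add_Hom_r[OF id_End]] card_Hom_r by simp
qed

text \<open>
  The group \<open>\<Gamma>\<close> has odd order \<open>n\<close>, so the power
  \<open>S\<close> of \<open>T\<close> with exponent \<open>(n+1)/2\<close> satisfies
  \<open>S\<^sup>2 = T\<close>. Powers of a self-adjoint operator are self-adjoint, whence
  \<open>h(Sv, Sw) = h(S\<^sup>2v, w)\<close>.
\<close>

lemma self_adjoint_square_root:
  assumes T: "T \<in> \<Gamma>"
    and adj: "\<And>v w. v \<in> carrier M \<Longrightarrow> w \<in> carrier M \<Longrightarrow> h (T v) w = h v (T w)"
  shows "\<exists>S\<in>\<Gamma>. \<forall>v\<in>carrier M. \<forall>w\<in>carrier M. h (S v) (S w) = h (T v) w"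
proof -
  interpret G: group \<Gamma>_group by (rule group_\<Gamma>)
  have carr: "carrier \<Gamma>_group = \<Gamma>" by (simp add: \<Gamma>_group_def)
  have app: "(S \<otimes>\<^bsub>\<Gamma>_group\<^esub> W) v = S (W v)" if "v \<in> carrier M" for S W v
    using that by (simp add: \<Gamma>_group_def compose_eq)
  have pow_closed: "T [^]\<^bsub>\<Gamma>_group\<^esub> k \<in> \<Gamma>" for k :: nat
    using G.nat_pow_closed[of T k] T carr by simp
  have pow_adj: "h ((T [^]\<^bsub>\<Gamma>_group\<^esub> k) v) w = h v ((T [^]\<^bsub>\<Gamma>_group\<^esub> k) w)"
    if "v \<in> carrier M" "w \<in> carrier M" for k :: nat and v w
    using that
  proof (induct k arbitrary: v)
    case 0 then show ?case by (simp add: \<Gamma>_group_def)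
  next
    case (Suc k)
    have "h ((T [^]\<^bsub>\<Gamma>_group\<^esub> Suc k) v) w = h (T v) ((T [^]\<^bsub>\<Gamma>_group\<^esub> k) w)"
      using Suc \<Gamma>_closed[OF T] by (simp add: app)
    also have "\<dots> = h v (T ((T [^]\<^bsub>\<Gamma>_group\<^esub> k) w))"
      using Suc.prems \<Gamma>_closed[OF pow_closed] by (intro adj)
    also have "T ((T [^]\<^bsub>\<Gamma>_group\<^esub> k) w) = (T [^]\<^bsub>\<Gamma>_group\<^esub> Suc k) w"
      using app[OF Suc.prems(2), of T "T [^]\<^bsub>\<Gamma>_group\<^esub> k"] G.nat_pow_Suc2[of T k] T carr
      by simp
    finally show ?case .
  qed
  have "odd (card \<Gamma>)" using card_\<Gamma> odd_card_r by simp
  then obtain k where k: "Suc (card \<Gamma>) = k + k" by (metis even_Suc dvd_def mult_2)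
  define S where "S = T [^]\<^bsub>\<Gamma>_group\<^esub> k"
  have "S \<otimes>\<^bsub>\<Gamma>_group\<^esub> S = T [^]\<^bsub>\<Gamma>_group\<^esub> Suc (card \<Gamma>)"
    unfolding S_def k using T carr by (intro G.nat_pow_mult) simp
  also have "\<dots> = T"
    using G.pow_order_eq_1[of T] T carr by (simp add: order_def)
  finally have SS: "S (S v) = T v" if "v \<in> carrier M" for v using app[OF that, of S S] by simp
  have "h (S v) (S w) = h (T v) w" if "v \<in> carrier M" "w \<in> carrier M" for v w
    using pow_adj[of "S v" w k] \<Gamma>_closed[OF pow_closed] that SS[OF that(1)] by (simp add: S_def)
  then show ?thesis using pow_closed S_def by blast
qed

text \<open>
  A hermitian form that is congruent to \<open>h\<close> modulo \<open>r\<close> is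
  \<open>h(Tv, w)\<close> with a self-adjoint \<open>T\<close> in \<open>\<Gamma>\<close>; the
  square root of \<open>T\<close> is an isometry between the two forms.
\<close>

lemma congruent_forms:
  assumes c: "\<And>i j. i < m \<Longrightarrow> j < m \<Longrightarrow> c i j \<in> r"
    and c_star: "\<And>i j. i < m \<Longrightarrow> j < m \<Longrightarrow> star (c i j) = c j i"
  shows "\<exists>S\<in>\<Gamma>. \<forall>i<m. \<forall>j<m. h (S (b i)) (S (b j)) = h (b i) (b j) \<oplus> c i j"
proof -
  have "\<exists>N\<in>Hom_r. (\<forall>i<m. \<forall>j<m. h (N (b i)) (b j) = c i j) \<and>
      (\<forall>v\<in>carrier M. \<forall>w\<in>carrier M. h (N v) w = h v (N w))"
    by (rule self_adjoint_exists) (fact c, fact c_star)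
  then obtain N where N: "N \<in> Hom_r" "\<And>i j. i < m \<Longrightarrow> j < m \<Longrightarrow> h (N (b i)) (b j) = c i j"
    "\<And>v w. v \<in> carrier M \<Longrightarrow> w \<in> carrier M \<Longrightarrow> h (N v) w = h v (N w)"
    by blast
  define T where "T = (\<lambda>v\<in>carrier M. (\<lambda>x\<in>carrier M. x) v \<oplus>\<^bsub>M\<^esub> N v)"
  have "T \<in> {f \<in> End. \<forall>v\<in>carrier M. f v \<ominus>\<^bsub>M\<^esub> (\<lambda>x\<in>carrier M. x) v \<in> rM}"
    unfolding T_def by (rule bij_betw_apply[OF bij_betw_add_Hom_r[OF id_End] N(1)])
  then have T: "T \<in> \<Gamma>" by (simp add: \<Gamma>_def)
  have Nv: "N v \<in> carrier M" if "v \<in> carrier M" for v using N(1) EndD(1) that by (simp add: Hom_r_def)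
  have "h (T v) w = h v (T w)" if "v \<in> carrier M" "w \<in> carrier M" for v w
    using that Nv N(3) by (simp add: T_def h_add_left h_add_right)
  from self_adjoint_square_root[OF T this]
  obtain S where S: "S \<in> \<Gamma>" "\<And>v w. v \<in> carrier M \<Longrightarrow> w \<in> carrier M \<Longrightarrow> h (S v) (S w) = h (T v) w" by blast
  have "h (S (b i)) (S (b j)) = h (b i) (b j) \<oplus> c i j" if "i < m" "j < m" for i j
    using that S(2)[of "b i" "b j"] N(2) Nv by (simp add: T_def h_add_left)
  then show ?thesis using S(1) by blast
qed

section \<open>Isometries modulo the ideal and Gram matrices\<close>

definition U where "U = {g \<in> End. \<forall>v\<in>carrier M. \<forall>w\<in>carrier M. h (g v) (g w) = h v w}"
text \<open>
  This set is fibred over the hermitian matrices with entries in \<open>r\<close>, and over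
  the unitary group of the reduced form.
\<close>

definition U_mod_r where
  "U_mod_r = {g \<in> End. \<forall>v\<in>carrier M. \<forall>w\<in>carrier M. h (g v) (g w) \<ominus> h v w \<in> r}"
definition r_sym where "r_sym = {a \<in> r. star a = a}"
definition r_skew where "r_skew = {a \<in> r. star a = \<ominus> a}"

lemma U_mod_rD:
  assumes "g \<in> U_mod_r"
  shows "g \<in> End" "v \<in> carrier M \<Longrightarrow> w \<in> carrier M \<Longrightarrow> h (g v) (g w) \<ominus> h v w \<in> r"
  using assms by (auto simp: U_mod_r_def)

lemma finite_U_mod_r: "finite U_mod_r"
  by (rule finite_subset[OF _ finite_End]) (auto simp: U_mod_r_def)

lemma carrier_unitary_group: "carrier (unitary_group R M h) = U"
proof
  show "carrier (unitary_group R M h) \<subseteq> U"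
  proof
    fix g assume "g \<in> carrier (unitary_group R M h)"
    then have g: "g \<in> Bij (carrier M)"
        "\<forall>v\<in>carrier M. \<forall>w\<in>carrier M. g (v \<oplus>\<^bsub>M\<^esub> w) = g v \<oplus>\<^bsub>M\<^esub> g w"
        "\<forall>a\<in>carrier R. \<forall>v\<in>carrier M. g (a \<odot>\<^bsub>M\<^esub> v) = a \<odot>\<^bsub>M\<^esub> g v"
        "\<forall>v\<in>carrier M. \<forall>w\<in>carrier M. h (g v) (g w) = h v w"
      by (simp_all add: unitary_group_def)
    have "g \<in> End"
      unfolding End_def using g(2,3) Bij_imp_extensional[OF g(1)] Bij_imp_funcset[OF g(1)]
      by (intro linear_mapsI) auto
    then show "g \<in> U" using g(4) by (simp add: U_def)
  qed
  show "U \<subseteq> carrier (unitary_group R M h)"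
  proof
    fix g assume "g \<in> U"
    then have g: "g \<in> End" "\<And>v w. v \<in> carrier M \<Longrightarrow> w \<in> carrier M \<Longrightarrow> h (g v) (g w) = h v w"
      by (simp_all add: U_def)
    have "v = \<zero>\<^bsub>M\<^esub>" if v: "v \<in> carrier M" "g v = \<zero>\<^bsub>M\<^esub>" for v
    proof (rule h_eqI[OF v(1) M.zero_closed])
      fix w assume w: "w \<in> carrier M"
      have "h v w = h (g v) (g w)" using g(2)[OF v(1) w] ..
      also have "\<dots> = \<zero>" unfolding v(2) using h_zero(1) EndD(1)[OF g(1) w] .
      finally show "h v w = h \<zero>\<^bsub>M\<^esub> w" using w by (simp add: h_zero)
    qed
    then have "bij_betw g (carrier M) (carrier M)" by (rule End_inverse(1)[OF g(1)])
    then show "g \<in> carrier (unitary_group R M h)"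
      using g EndD[OF g(1)] by (simp add: unitary_group_def Bij_def)
  qed
qed

lemma form_eq_mod_r:
  assumes "g \<in> U_mod_r" and "v \<in> carrier M" "w \<in> carrier M"
  shows "h (g v) (g w) = h v w \<oplus> (h (g v) (g w) \<ominus> h v w)"
  using assms EndD(1)[OF U_mod_rD(1)[OF assms(1)]] by (simp add: R.add_minus_cancel)

lemma \<Gamma>_U_mod_r: "\<Gamma> \<subseteq> U_mod_r"
proof
  fix S assume S: "S \<in> \<Gamma>"
  have "h (S v) (S w) \<ominus> h v w \<in> r" if vw: "v \<in> carrier M" "w \<in> carrier M" for v w
  proof -
    have c: "S v \<in> carrier M" "S w \<in> carrier M" using S vw \<Gamma>_closed by auto
    define x y where "x = S v \<ominus>\<^bsub>M\<^esub> v" and "y = S w \<ominus>\<^bsub>M\<^esub> w"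
    have xy: "x \<in> rM" "y \<in> rM" using \<Gamma>D(2)[OF S] vw by (simp_all add: x_def y_def)
    note xyc = rM_carrier[OF xy(1)] rM_carrier[OF xy(2)]
    have "S v = v \<oplus>\<^bsub>M\<^esub> x" using c vw by (simp add: x_def M.add_minus_cancel)
    then have "h (S v) (S w) = h v (S w) \<oplus> h x (S w)" using vw c xyc by (simp add: h_add_left)
    also have "h v (S w) = h v w \<oplus> h v y"
      using c vw xyc h_add_right[of v w y] by (simp add: y_def M.add_minus_cancel)
    also have "h v w \<oplus> h v y \<oplus> h x (S w) \<ominus> h v w = h v y \<oplus> h x (S w)"
      using c vw xyc R.add_minus_cancel_left[of "h v w" "h v y \<oplus> h x (S w)"] by (simp add: R.a_assoc)
    finally show ?thesis using h_rM c vw xy by simp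
  qed
  then show "S \<in> U_mod_r" using \<Gamma>D(1)[OF S] by (simp add: U_mod_r_def)
qed

lemma End_forms_eqI:
  assumes "f \<in> End" "g \<in> End"
    and eq: "\<And>i j. i \<le> j \<Longrightarrow> j < m \<Longrightarrow> h (f (b i)) (f (b j)) = h (g (b i)) (g (b j))"
    and vw: "v \<in> carrier M" "w \<in> carrier M"
  shows "h (f v) (f w) = h (g v) (g w)"
proof (rule sesquilinear_eqI[OF sesquilinear_h[OF assms(1,1)] sesquilinear_h[OF assms(2,2)] _ vw])
  fix i j assume ij: "i < m" "j < m"
  show "h (f (b i)) (f (b j)) = h (g (b i)) (g (b j))"
  proof (cases "i \<le> j")
    case False
    then have "star (h (f (b j)) (f (b i))) = star (h (g (b j)) (g (b i)))" using eq[of j i] ij by simp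
    then show ?thesis using ij EndD(1) assms(1,2) by (simp add: h_star)
  qed (use eq ij in simp)
qed

text \<open>
  The entries on and below the diagonal, which determine a hermitian matrix.
\<close>

definition Index where "Index = (SIGMA j:{..<m}. {..j})"
definition gram_defect where
  "gram_defect g = (\<lambda>(j, i)\<in>Index. h (g (b i)) (g (b j)) \<ominus> h (b i) (b j))"
definition Hermitian_r where
  "Hermitian_r = (\<Pi>\<^sub>E (j, i)\<in>Index. if i = j then r_sym else r)"

lemma finite_Index: "finite Index" by (simp add: Index_def)

lemma card_Hermitian_r: "card Hermitian_r = card r_sym ^ m * card r ^ (m * (m - 1) div 2)"
proof -
  have "card Hermitian_r = (\<Prod>(j, i)\<in>Index. if i = j then card r_sym else card r)"
    unfolding Hermitian_r_def
    by (simp add: card_PiE finite_Index) (auto intro!: prod.cong)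
  then show ?thesis unfolding Index_def by (simp only: prod_lower_triangle)
qed

lemma finite_Hermitian_r: "finite Hermitian_r"
  unfolding Hermitian_r_def using finite_subset[OF _ finite_r, of r_sym]
  by (intro finite_PiE finite_Index) (auto simp: finite_r r_sym_def)

lemma gram_defect_mem:
  assumes g: "g \<in> U_mod_r"
  shows "gram_defect g \<in> Hermitian_r"
  unfolding Hermitian_r_def gram_defect_def
proof (rule restrict_PiE_iff[THEN iffD2], rule ballI)
  fix x assume x: "x \<in> Index"
  obtain j i where ij: "x = (j, i)" by (cases x)
  then have l: "j < m" "i < m" using x by (auto simp: Index_def)
  have c: "g (b i) \<in> carrier M" "g (b j) \<in> carrier M" using EndD(1)[OF U_mod_rD(1)[OF g]] l by auto
  have "h (g (b i)) (g (b j)) \<ominus> h (b i) (b j) \<in> r" using U_mod_rD(2)[OF g] l by simp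
  moreover have "star (h (g (b i)) (g (b i)) \<ominus> h (b i) (b i)) = h (g (b i)) (g (b i)) \<ominus> h (b i) (b i)"
    using c l by (simp add: R.minus_eq star_add star_minus h_star)
  ultimately show "(case x of (j, i) \<Rightarrow> h (g (b i)) (g (b j)) \<ominus> h (b i) (b j))
      \<in> (case x of (j, i) \<Rightarrow> if i = j then r_sym else r)"
    using ij by (cases "i = j") (simp_all add: r_sym_def)
qed

text \<open>
  If \<open>S\<close> in \<open>\<Gamma>\<close> changes the Gram matrix of the basis by
  \<open>c\<close>, then composition with \<open>S\<close> is a bijection from the unitary
  group onto the fibre over \<open>c\<close>.
\<close>

lemma card_fibre_gram_defect:
  assumes c: "c \<in> Hermitian_r"
  shows "card {g \<in> U_mod_r. gram_defect g = c} = card U"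
proof -
  define c' where "c' i j = (if i \<le> j then c (j, i) else star (c (i, j)))" for i j
  have c_mem: "c (j, i) \<in> r" "i = j \<Longrightarrow> star (c (j, i)) = c (j, i)" if "i \<le> j" "j < m" for i j
  proof -
    have "c (j, i) \<in> (if i = j then r_sym else r)"
      using PiE_mem[OF c[unfolded Hermitian_r_def], of "(j, i)"] that by (simp add: Index_def)
    then show "c (j, i) \<in> r" "i = j \<Longrightarrow> star (c (j, i)) = c (j, i)"
      by (auto simp: r_sym_def split: if_splits)
  qed
  have "\<exists>S\<in>\<Gamma>. \<forall>i<m. \<forall>j<m. h (S (b i)) (S (b j)) = h (b i) (b j) \<oplus> c' i j"
  proof (rule congruent_forms)
    fix i j assume ij: "i < m" "j < m"
    show "c' i j \<in> r" using c_mem[of i j] c_mem[of j i] ij star_r by (simp add: c'_def)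
    show "star (c' i j) = c' j i"
      using c_mem[of i j] c_mem[of j i] ij r_carrier by (auto simp: c'_def)
  qed
  then obtain S where S: "S \<in> \<Gamma>"
    "\<And>i j. i < m \<Longrightarrow> j < m \<Longrightarrow> h (S (b i)) (S (b j)) = h (b i) (b j) \<oplus> c' i j" by blast
  obtain S' where S': "S' \<in> \<Gamma>" "\<forall>v\<in>carrier M. S (S' v) = v \<and> S' (S v) = v"
    using \<Gamma>_inverse[OF S(1)] by blast
  note SE = \<Gamma>D(1)[OF S(1)] and S'E = \<Gamma>D(1)[OF S'(1)]
  have S_closed: "v \<in> carrier M \<Longrightarrow> S v \<in> carrier M" "v \<in> carrier M \<Longrightarrow> S' v \<in> carrier M" for v
    using \<Gamma>_closed S(1) S'(1) by auto
  have "bij_betw (\<lambda>g. compose (carrier M) g S) U {g \<in> U_mod_r. gram_defect g = c}"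
  proof (rule bij_betwI[where g = "\<lambda>g. compose (carrier M) g S'"])
    show "(\<lambda>g. compose (carrier M) g S) \<in> U \<rightarrow> {g \<in> U_mod_r. gram_defect g = c}"
    proof
      fix g assume g: "g \<in> U"
      then have gE: "g \<in> End" by (simp add: U_def)
      have eq: "h (compose (carrier M) g S v) (compose (carrier M) g S w) = h (S v) (S w)"
        if "v \<in> carrier M" "w \<in> carrier M" for v w
        using g that S_closed by (simp add: compose_eq U_def)
      have "compose (carrier M) g S \<in> U_mod_r"
        unfolding U_mod_r_def using compose_End[OF gE SE] eq U_mod_rD(2)[of S] S(1) \<Gamma>_U_mod_r by auto
      moreover have "gram_defect (compose (carrier M) g S) = c"
      proof (rule extensionalityI[where A = Index])
        show "gram_defect (compose (carrier M) g S) \<in> extensional Index" by (simp add: gram_defect_def)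
        show "c \<in> extensional Index" using c by (simp add: Hermitian_r_def PiE_def)
        fix x assume x: "x \<in> Index"
        obtain j i where ij: "x = (j, i)" by (cases x)
        then have l: "i \<le> j" "j < m" "i < m" using x by (auto simp: Index_def)
        have "h (b i) (b j) \<oplus> c (j, i) \<ominus> h (b i) (b j) = c (j, i)"
          using l c_mem(1)[OF l(1,2)] r_carrier by (simp add: R.add_minus_cancel_left)
        then show "gram_defect (compose (carrier M) g S) x = c x"
          using x ij l S(2)[of i j] eq[of "b i" "b j"] by (simp add: gram_defect_def c'_def)
      qed
      ultimately show "compose (carrier M) g S \<in> {g \<in> U_mod_r. gram_defect g = c}" by simp
    qed
    show "(\<lambda>g. compose (carrier M) g S') \<in> {g \<in> U_mod_r. gram_defect g = c} \<rightarrow> U"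
    proof
      fix g assume "g \<in> {g \<in> U_mod_r. gram_defect g = c}"
      then have g: "g \<in> U_mod_r" and gc: "gram_defect g = c" by auto
      note gE = U_mod_rD(1)[OF g]
      have eq: "h (g v) (g w) = h (S v) (S w)" if vw: "v \<in> carrier M" "w \<in> carrier M" for v w
      proof (rule End_forms_eqI[OF gE SE _ vw])
        fix i j assume ij: "i \<le> j" "j < m"
        have "c (j, i) = h (g (b i)) (g (b j)) \<ominus> h (b i) (b j)"
          unfolding gc[symmetric] using ij by (simp add: gram_defect_def Index_def)
        then show "h (g (b i)) (g (b j)) = h (S (b i)) (S (b j))"
          using form_eq_mod_r[OF g, of "b i" "b j"] S(2)[of i j] ij by (simp add: c'_def)
      qed
      have "h (g (S' v)) (g (S' w)) = h v w" if "v \<in> carrier M" "w \<in> carrier M" for v w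
        using eq[of "S' v" "S' w"] that S'(2) S_closed by simp
      then show "compose (carrier M) g S' \<in> U"
        using compose_End[OF gE S'E] by (simp add: U_def compose_eq)
    qed
    have comp: "compose (carrier M) (compose (carrier M) g T) T' = g"
      if "g \<in> End" "\<And>v. v \<in> carrier M \<Longrightarrow> T (T' v) = v" "\<And>v. v \<in> carrier M \<Longrightarrow> T' v \<in> carrier M" for g T T'
    proof (rule extensionalityI[where A = "carrier M"])
      show "g \<in> extensional (carrier M)" using EndD(6)[OF that(1)] .
    qed (use that in \<open>simp_all add: compose_def\<close>)
    show "compose (carrier M) (compose (carrier M) g S) S' = g" if "g \<in> U" for g
      using that S' S_closed by (intro comp) (simp_all add: U_def)
    show "compose (carrier M) (compose (carrier M) g S') S = g" if "g \<in> {g \<in> U_mod_r. gram_defect g = c}" for g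
      using that S' S_closed by (intro comp) (simp_all add: U_mod_r_def)
  qed
  then show ?thesis by (simp add: bij_betw_same_card)
qed

lemma card_U_mod_r: "card U_mod_r = card U * (card r_sym ^ m * card r ^ (m * (m - 1) div 2))"
  unfolding card_Hermitian_r[symmetric]
  by (rule card_eq_card_mult_fibre[OF finite_U_mod_r finite_Hermitian_r _ card_fibre_gram_defect])
     (use gram_defect_mem in auto)

text \<open>
  Such an operator changes the Gram matrix in the same way as some \<open>S\<close> in
  \<open>\<Gamma>\<close>. Hence it is injective like \<open>S\<close>, and surjective because
  the module is finite.
\<close>

lemma U_mod_r_surj:
  assumes g: "g \<in> U_mod_r"
  shows "g ` carrier M = carrier M"
proof -
  define c where "c i j = h (g (b i)) (g (b j)) \<ominus> h (b i) (b j)" for i j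
  note gE = U_mod_rD(1)[OF g]
  have "\<exists>S\<in>\<Gamma>. \<forall>i<m. \<forall>j<m. h (S (b i)) (S (b j)) = h (b i) (b j) \<oplus> c i j"
  proof (rule congruent_forms)
    fix i j assume ij: "i < m" "j < m"
    show "c i j \<in> r" using U_mod_rD(2)[OF g] ij by (simp add: c_def)
    show "star (c i j) = c j i"
      using EndD(1)[OF gE] ij by (simp add: c_def R.minus_eq star_add star_minus h_star)
  qed
  then obtain S where S: "S \<in> \<Gamma>"
    "\<And>i j. i < m \<Longrightarrow> j < m \<Longrightarrow> h (S (b i)) (S (b j)) = h (b i) (b j) \<oplus> c i j" by blast
  have eq: "h (g v) (g w) = h (S v) (S w)" if vw: "v \<in> carrier M" "w \<in> carrier M" for v w
  proof (rule End_forms_eqI[OF gE \<Gamma>D(1)[OF S(1)] _ vw])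
    fix i j assume ij: "i \<le> j" "j < m"
    then show "h (g (b i)) (g (b j)) = h (S (b i)) (S (b j))"
      using form_eq_mod_r[OF g, of "b i" "b j"] S(2)[of i j] by (simp add: c_def)
  qed
  obtain S' where S': "S' \<in> \<Gamma>" "\<forall>v\<in>carrier M. S (S' v) = v \<and> S' (S v) = v"
    using \<Gamma>_inverse[OF S(1)] by blast
  have "v = \<zero>\<^bsub>M\<^esub>" if v: "v \<in> carrier M" "g v = \<zero>\<^bsub>M\<^esub>" for v
  proof (rule \<Gamma>_kernel[OF S(1) v(1)], rule h_eqI[OF \<Gamma>_closed[OF S(1) v(1)] M.zero_closed])
    fix w assume w: "w \<in> carrier M"
    have "h (S v) w = h (S v) (S (S' w))" using S' w by simp
    also have "\<dots> = h (g v) (g (S' w))" using eq[OF v(1) \<Gamma>_closed[OF S'(1) w]] ..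
    also have "\<dots> = \<zero>" unfolding v(2) using h_zero(1) EndD(1)[OF gE \<Gamma>_closed[OF S'(1) w]] .
    finally show "h (S v) w = h \<zero>\<^bsub>M\<^esub> w" using w by (simp add: h_zero)
  qed
  then show ?thesis using End_inverse(1)[OF gE] by (simp add: bij_betw_def)
qed

text \<open>
  Each element is the sum of its symmetric part \<open>(a + a\<^sup>*)/2\<close> and its skew
  part \<open>(a - a\<^sup>*)/2\<close>.
\<close>

lemma card_r: "card r = card r_sym * card r_skew"
proof -
  have "bij_betw (\<lambda>(x, y). x \<oplus> y) (r_sym \<times> r_skew) r"
  proof (rule bij_betwI[where g = "\<lambda>a. (hf \<otimes> (a \<oplus> star a), hf \<otimes> (a \<ominus> star a))"])
    have half: "hf \<otimes> (x \<oplus> x) = x" if "x \<in> carrier R" for x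
    proof -
      have "hf \<otimes> (x \<oplus> x) = (hf \<oplus> hf) \<otimes> x" using that hf(1) by (simp add: l_distr r_distr)
      then show ?thesis using that hf(2) by simp
    qed
    have star_hf: "star hf = hf"
    proof -
      have "star \<one> = \<one>" using star_mult[of \<one> "star \<one>"] by simp
      then have s: "star hf \<oplus> star hf = \<one>" using star_add[OF hf(1) hf(1)] hf(2) by simp
      have "star hf = hf \<otimes> (star hf \<oplus> star hf)" using half[of "star hf"] hf(1) by simp
      then show ?thesis using s hf(1) by simp
    qed
    show "(\<lambda>(x, y). x \<oplus> y) \<in> r_sym \<times> r_skew \<rightarrow> r" by (auto simp: r_sym_def r_skew_def)
    show "(\<lambda>a. (hf \<otimes> (a \<oplus> star a), hf \<otimes> (a \<ominus> star a))) \<in> r \<rightarrow> r_sym \<times> r_skew"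
    proof
      fix a assume a: "a \<in> r"
      note ac = r_carrier[OF a] r_carrier[OF star_r[OF a]]
      have "star (hf \<otimes> (a \<oplus> star a)) = hf \<otimes> (a \<oplus> star a)"
        using ac hf(1) by (simp add: star_mult star_add star_hf R.a_comm)
      moreover have "star (hf \<otimes> (a \<ominus> star a)) = \<ominus> (hf \<otimes> (a \<ominus> star a))"
        using ac hf(1)
        by (simp add: star_mult star_add star_minus star_hf R.minus_eq R.minus_add r_minus[symmetric] R.a_comm)
      ultimately show "(hf \<otimes> (a \<oplus> star a), hf \<otimes> (a \<ominus> star a)) \<in> r_sym \<times> r_skew"
        using a star_r[OF a] hf(1) by (simp add: r_sym_def r_skew_def R.minus_eq r.I_l_closed)
    qed
    show "(\<lambda>a. (hf \<otimes> (a \<oplus> star a), hf \<otimes> (a \<ominus> star a))) ((\<lambda>(x, y). x \<oplus> y) p) = p"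
      if p: "p \<in> r_sym \<times> r_skew" for p
    proof -
      obtain x y where xy: "p = (x, y)" "x \<in> r" "y \<in> r" "star x = x" "star y = \<ominus> y"
        using p by (auto simp: r_sym_def r_skew_def)
      note c = r_carrier[OF xy(2)] r_carrier[OF xy(3)]
      have "(x \<oplus> y) \<oplus> (x \<oplus> \<ominus> y) = x \<oplus> x" "(x \<oplus> y) \<ominus> (x \<oplus> \<ominus> y) = y \<oplus> y"
        using c by algebra+
      then have "(x \<oplus> y) \<oplus> star (x \<oplus> y) = x \<oplus> x" "(x \<oplus> y) \<ominus> star (x \<oplus> y) = y \<oplus> y"
        using c xy by (simp_all add: star_add)
      then show ?thesis using xy(1) half c by simp
    qed
    show "(\<lambda>(x, y). x \<oplus> y) (hf \<otimes> (a \<oplus> star a), hf \<otimes> (a \<ominus> star a)) = a" if a: "a \<in> r" for a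
    proof -
      note ac = r_carrier[OF a] r_carrier[OF star_r[OF a]]
      have "hf \<otimes> (a \<oplus> star a) \<oplus> hf \<otimes> (a \<ominus> star a) = hf \<otimes> ((a \<oplus> star a) \<oplus> (a \<ominus> star a))"
        using ac hf(1) by (simp add: r_distr R.minus_eq)
      also have "(a \<oplus> star a) \<oplus> (a \<ominus> star a) = a \<oplus> a"
        using ac by algebra
      finally show ?thesis using half ac by simp
    qed
  qed
  then show ?thesis by (metis bij_betw_same_card card_cartesian_product)
qed

section \<open>Reduction modulo the ideal\<close>

lemma rM_abelian_subgroup: "abelian_subgroup rM M"
  by (rule abelian_subgroupI3)
     (auto intro: additive_subgroupI M.abelian_group_axioms submodule.axioms(1)[OF rM_submodule])

sublocale rM: abelian_subgroup rM M
  by (rule rM_abelian_subgroup)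

sublocale r: abelian_subgroup r R
  by (rule abelian_subgroupI3) (auto intro: r.additive_subgroup_axioms R.abelian_group_axioms)

lemma ideal_smult_r: "ideal_smult r M = rM"
proof -
  have "{a \<odot>\<^bsub>M\<^esub> v | a v. a \<in> r \<and> v \<in> carrier M} = rM"
  proof
    show "{a \<odot>\<^bsub>M\<^esub> v | a v. a \<in> r \<and> v \<in> carrier M} \<subseteq> rM" using smult_r_rM by auto
    have "\<pi> \<in> r" using rI[of \<one>] \<pi> by simp
    then show "rM \<subseteq> {a \<odot>\<^bsub>M\<^esub> v | a v. a \<in> r \<and> v \<in> carrier M}" unfolding rM_def by auto
  qed
  moreover have "rM = generate (add_monoid M) rM"
    by (rule M.add.generateI[OF rM.a_subgroup]) auto
  ultimately show ?thesis by (simp add: ideal_smult_def)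
qed

definition cl :: "'c \<Rightarrow> 'c set" where "cl v = rM +>\<^bsub>M\<^esub> v"

lemma cl_eq_iff: "v \<in> carrier M \<Longrightarrow> w \<in> carrier M \<Longrightarrow> cl v = cl w \<longleftrightarrow> v \<ominus>\<^bsub>M\<^esub> w \<in> rM"
  by (simp add: cl_def rM.a_rcos_eq_iff)

lemma cl_self: "v \<in> carrier M \<Longrightarrow> v \<in> cl v"
  by (simp add: cl_def rM.a_rcos_self)

lemma mem_cl:
  assumes "x \<in> cl v" "v \<in> carrier M"
  shows "x \<in> carrier M" "cl x = cl v"
proof -
  show x: "x \<in> carrier M"
    using assms M.a_r_coset_subset_G[OF rM.a_subset assms(2)] unfolding cl_def by blast
  show "cl x = cl v"
    using assms M.a_repr_independence[OF _ _ rM.a_subgroup, of x v] by (simp add: cl_def)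
qed

lemma UN_cl:
  assumes "v \<in> carrier M" "\<And>x. x \<in> carrier M \<Longrightarrow> cl x = cl v \<Longrightarrow> f x = f v"
  shows "(\<Union>x\<in>cl v. f x) = f v"
proof (rule UN_constant_eq[OF cl_self[OF assms(1)]], rule ballI)
  fix x assume "x \<in> cl v"
  then show "f x = f v" using assms(2)[of x] mem_cl[OF _ assms(1)] by simp
qed

abbreviation Rbar where "Rbar \<equiv> R Quot r"
abbreviation Mbar where "Mbar \<equiv> reduced_module r M"
abbreviation hbar where "hbar \<equiv> reduced_form R r h"

lemma carrier_Mbar: "carrier Mbar = cl ` carrier M"
  by (auto simp: reduced_module_def ideal_smult_r A_RCOSETS_def' cl_def)

lemma carrier_Rbar: "carrier Rbar = (\<lambda>a. r +> a) ` carrier R"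
  by (auto simp: FactRing_def A_RCOSETS_def')

lemma add_Mbar: "v \<in> carrier M \<Longrightarrow> w \<in> carrier M \<Longrightarrow> cl v \<oplus>\<^bsub>Mbar\<^esub> cl w = cl (v \<oplus>\<^bsub>M\<^esub> w)"
  by (simp add: reduced_module_def cl_def rM.a_rcos_sum)

lemma smult_Mbar:
  assumes "a \<in> carrier R" "v \<in> carrier M"
  shows "(r +> a) \<odot>\<^bsub>Mbar\<^esub> cl v = cl (a \<odot>\<^bsub>M\<^esub> v)"
proof -
  have *: "cl (a' \<odot>\<^bsub>M\<^esub> v') = cl (a \<odot>\<^bsub>M\<^esub> v)" if "a' \<in> r +> a" "v' \<in> cl v" for a' v'
  proof -
    have a': "a' \<in> carrier R" using that(1) R.a_r_coset_subset_G[of r a] r_carrier assms(1) by auto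
    have "r +> a' = r +> a" using R.a_repr_independence[OF that(1) assms(1) r.a_subgroup] by simp
    then have d: "a' \<ominus> a \<in> r" using r.a_rcos_eq_iff[OF a' assms(1)] by simp
    have v': "v' \<in> carrier M" "v' \<ominus>\<^bsub>M\<^esub> v \<in> rM"
      using mem_cl[OF that(2) assms(2)] cl_eq_iff assms(2) by auto
    have "(a' \<ominus> a) \<odot>\<^bsub>M\<^esub> v' \<oplus>\<^bsub>M\<^esub> a \<odot>\<^bsub>M\<^esub> (v' \<ominus>\<^bsub>M\<^esub> v)
        = a' \<odot>\<^bsub>M\<^esub> v' \<ominus>\<^bsub>M\<^esub> a \<odot>\<^bsub>M\<^esub> v"
      using a' v' assms
      by (simp add: R.minus_eq M.minus_eq smult_l_distr smult_r_distr smult_l_minus smult_r_minus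
          M.a_assoc M.r_neg1)
    moreover have "(a' \<ominus> a) \<odot>\<^bsub>M\<^esub> v' \<oplus>\<^bsub>M\<^esub> a \<odot>\<^bsub>M\<^esub> (v' \<ominus>\<^bsub>M\<^esub> v) \<in> rM"
      using smult_r_rM[OF d v'(1)] rM_closed(4)[OF assms(1) v'(2)] rM_closed(2) by simp
    ultimately show ?thesis using cl_eq_iff a' v' assms by simp
  qed
  have "(r +> a) \<odot>\<^bsub>Mbar\<^esub> cl v = (\<Union>a'\<in>r +> a. \<Union>v'\<in>cl v. cl (a' \<odot>\<^bsub>M\<^esub> v'))"
    by (simp add: reduced_module_def ideal_smult_r cl_def)
  also have "\<dots> = cl (a \<odot>\<^bsub>M\<^esub> v)"
    using * r.a_rcos_self[OF assms(1)] cl_self[OF assms(2)] by blast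
  finally show ?thesis .
qed

lemma hbar_cl:
  assumes "v \<in> carrier M" "w \<in> carrier M"
  shows "hbar (cl v) (cl w) = r +> h v w"
proof -
  have *: "r +> h v' w' = r +> h v w" if "v' \<in> cl v" "w' \<in> cl w" for v' w'
  proof -
    have v': "v' \<in> carrier M" "v' \<ominus>\<^bsub>M\<^esub> v \<in> rM"
      using mem_cl[OF that(1) assms(1)] cl_eq_iff assms(1) by auto
    have w': "w' \<in> carrier M" "w' \<ominus>\<^bsub>M\<^esub> w \<in> rM"
      using mem_cl[OF that(2) assms(2)] cl_eq_iff assms(2) by auto
    have "h v' w' = h v w' \<oplus> h (v' \<ominus>\<^bsub>M\<^esub> v) w'"
      using h_add_left[of v "v' \<ominus>\<^bsub>M\<^esub> v" w'] v' w' assms by (simp add: M.add_minus_cancel)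
    also have "h v w' = h v w \<oplus> h v (w' \<ominus>\<^bsub>M\<^esub> w)"
      using h_add_right[of v w "w' \<ominus>\<^bsub>M\<^esub> w"] w' assms by (simp add: M.add_minus_cancel)
    finally have "h v' w' = h v w \<oplus> (h v (w' \<ominus>\<^bsub>M\<^esub> w) \<oplus> h (v' \<ominus>\<^bsub>M\<^esub> v) w')"
      using v' w' assms by (simp add: R.a_assoc)
    then have "h v' w' \<ominus> h v w = h v (w' \<ominus>\<^bsub>M\<^esub> w) \<oplus> h (v' \<ominus>\<^bsub>M\<^esub> v) w'"
      using R.add_minus_cancel_left[of "h v w" "h v (w' \<ominus>\<^bsub>M\<^esub> w) \<oplus> h (v' \<ominus>\<^bsub>M\<^esub> v) w'"] v' w' assms
      by simp
    then have "h v' w' \<ominus> h v w \<in> r" using h_rM v' w' assms by simp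
    then show ?thesis using r.a_rcos_eq_iff v' w' assms by simp
  qed
  show ?thesis
    unfolding reduced_form_def using * cl_self[OF assms(1)] cl_self[OF assms(2)] by blast
qed

definition reduction :: "('c \<Rightarrow> 'c) \<Rightarrow> 'c set \<Rightarrow> 'c set" where
  "reduction g = (\<lambda>B\<in>carrier Mbar. \<Union>v\<in>B. cl (g v))"

lemma reduction_cl:
  assumes "g \<in> End" "v \<in> carrier M"
  shows "reduction g (cl v) = cl (g v)"
proof -
  have "(\<Union>x\<in>cl v. cl (g x)) = cl (g v)"
  proof (rule UN_cl[OF assms(2)])
    fix x assume x: "x \<in> carrier M" "cl x = cl v"
    then have "x \<ominus>\<^bsub>M\<^esub> v \<in> rM" using cl_eq_iff assms(2) by simp
    then obtain y where y: "y \<in> carrier M" "x \<ominus>\<^bsub>M\<^esub> v = \<pi> \<odot>\<^bsub>M\<^esub> y" unfolding rM_def by blast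
    have "g x \<ominus>\<^bsub>M\<^esub> g v = \<pi> \<odot>\<^bsub>M\<^esub> g y"
      using End_diff[OF assms(1) x(1) assms(2)] y EndD(3)[OF assms(1) \<pi> y(1)] by simp
    then have "g x \<ominus>\<^bsub>M\<^esub> g v \<in> rM" using rMI EndD(1)[OF assms(1) y(1)] by simp
    then show "cl (g x) = cl (g v)" using cl_eq_iff EndD(1)[OF assms(1)] x assms(2) by simp
  qed
  then show ?thesis using assms(2) by (simp add: reduction_def carrier_Mbar)
qed

abbreviation Ubar where "Ubar \<equiv> carrier (unitary_group Rbar Mbar hbar)"

lemma finite_Mbar: "finite (carrier Mbar)"
  by (simp add: carrier_Mbar finite_M)

lemma reduction_mem:
  assumes g: "g \<in> U_mod_r"
  shows "reduction g \<in> Ubar"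
proof -
  note gE = U_mod_rD(1)[OF g]
  have gc: "g v \<in> carrier M" if "v \<in> carrier M" for v using EndD(1)[OF gE that] .
  have "reduction g ` carrier Mbar = cl ` g ` carrier M"
    using reduction_cl[OF gE] by (auto simp: carrier_Mbar image_iff)
  also have "\<dots> = carrier Mbar" using U_mod_r_surj[OF g] by (simp add: carrier_Mbar)
  finally have surj: "reduction g ` carrier Mbar = carrier Mbar" .
  then have "inj_on (reduction g) (carrier Mbar)" by (intro eq_card_imp_inj_on finite_Mbar) simp
  with surj have "reduction g \<in> Bij (carrier Mbar)"
    by (simp add: Bij_def bij_betw_def) (simp add: reduction_def)
  moreover have "hbar (cl (g v)) (cl (g w)) = hbar (cl v) (cl w)" if "v \<in> carrier M" "w \<in> carrier M" for v w
    using that gc U_mod_rD(2)[OF g that] by (simp add: hbar_cl r.a_rcos_eq_iff)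
  ultimately show ?thesis
    using gc reduction_cl[OF gE]
    by (auto simp: unitary_group_def carrier_Mbar carrier_Rbar add_Mbar smult_Mbar EndD[OF gE])
qed

text \<open>
  Lift the images under \<open>f\<close> of the classes of the basis vectors, and extend
  linearly to an operator \<open>g\<close>. The fibre consists of the operators that differ
  from \<open>g\<close> by a linear map into \<open>rM\<close>.
\<close>

lemma card_fibre_reduction:
  assumes f: "f \<in> Ubar"
  shows "card {g \<in> U_mod_r. reduction g = f} = card r ^ (m * m)"
proof -
  have fB: "f \<in> Bij (carrier Mbar)"
    and f_add: "\<And>v w. v \<in> carrier Mbar \<Longrightarrow> w \<in> carrier Mbar \<Longrightarrow> f (v \<oplus>\<^bsub>Mbar\<^esub> w) = f v \<oplus>\<^bsub>Mbar\<^esub> f w"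
    and f_smult: "\<And>a v. a \<in> carrier Rbar \<Longrightarrow> v \<in> carrier Mbar \<Longrightarrow> f (a \<odot>\<^bsub>Mbar\<^esub> v) = a \<odot>\<^bsub>Mbar\<^esub> f v"
    and f_h: "\<And>v w. v \<in> carrier Mbar \<Longrightarrow> w \<in> carrier Mbar \<Longrightarrow> hbar (f v) (f w) = hbar v w"
    using unitary_groupD[OF f] by blast+
  have cl_mem: "cl v \<in> carrier Mbar" if "v \<in> carrier M" for v using that by (simp add: carrier_Mbar)
  have "\<forall>i. \<exists>x. i < m \<longrightarrow> x \<in> carrier M \<and> cl x = f (cl (b i))"
  proof (intro allI)
    fix i
    show "\<exists>x. i < m \<longrightarrow> x \<in> carrier M \<and> cl x = f (cl (b i))"
    proof (cases "i < m")
      case True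
      then have "f (cl (b i)) \<in> cl ` carrier M"
        using funcset_mem[OF Bij_imp_funcset[OF fB] cl_mem[of "b i"]] by (simp add: carrier_Mbar)
      then show ?thesis by (metis imageE)
    qed simp
  qed
  then obtain x where x: "\<And>i. i < m \<Longrightarrow> x i \<in> carrier M" "\<And>i. i < m \<Longrightarrow> cl (x i) = f (cl (b i))"
    by metis
  then have "x \<in> {..<m} \<rightarrow> carrier M" by simp
  then obtain g where g: "g \<in> End" "\<And>i. i < m \<Longrightarrow> g (b i) = x i"
    using linear_map_exists[OF module_axioms] unfolding End_def by blast
  have smul: "f (cl (a \<odot>\<^bsub>M\<^esub> v)) = (r +> a) \<odot>\<^bsub>Mbar\<^esub> f (cl v)" if "a \<in> carrier R" "v \<in> carrier M" for a v
    using f_smult[of "r +> a" "cl v"] that cl_mem by (simp add: carrier_Rbar smult_Mbar)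
  have gf: "cl (g v) = f (cl v)" if v: "v \<in> carrier M" for v
    using v
  proof (induct v rule: basis_induct)
    case zero
    obtain y where y: "y \<in> carrier M" "f (cl \<zero>\<^bsub>M\<^esub>) = cl y"
      using funcset_mem[OF Bij_imp_funcset[OF fB] cl_mem[OF M.zero_closed]] by (auto simp: carrier_Mbar)
    have "f (cl \<zero>\<^bsub>M\<^esub>) = cl (\<zero> \<odot>\<^bsub>M\<^esub> y)"
      using smul[of \<zero> "\<zero>\<^bsub>M\<^esub>"] y by (simp add: smult_Mbar del: smult_l_null)
    then show ?case using y EndD(4)[OF g(1)] by simp
  next
    case (add u v)
    then show ?case
      using EndD(1,2)[OF g(1)] f_add[OF cl_mem cl_mem, of u v] by (simp add: add_Mbar[symmetric])
  next
    case (smult a i)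
    then show ?case
      using EndD(3)[OF g(1)] smul[of a "b i"] g(2) x by (simp add: smult_Mbar[symmetric])
  qed
  have "{g' \<in> U_mod_r. reduction g' = f} = {g' \<in> End. \<forall>v\<in>carrier M. g' v \<ominus>\<^bsub>M\<^esub> g v \<in> rM}"
  proof (intro equalityI subsetI)
    fix g' assume "g' \<in> {g' \<in> U_mod_r. reduction g' = f}"
    then have g': "g' \<in> End" "reduction g' = f" by (auto simp: U_mod_r_def)
    have "g' v \<ominus>\<^bsub>M\<^esub> g v \<in> rM" if "v \<in> carrier M" for v
    proof -
      have "cl (g' v) = cl (g v)" using reduction_cl[OF g'(1) that] g'(2) gf[OF that] by simp
      then show ?thesis using cl_eq_iff EndD(1)[OF g'(1) that] EndD(1)[OF g(1) that] by simp
    qed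
    then show "g' \<in> {g' \<in> End. \<forall>v\<in>carrier M. g' v \<ominus>\<^bsub>M\<^esub> g v \<in> rM}" using g'(1) by simp
  next
    fix g' assume "g' \<in> {g' \<in> End. \<forall>v\<in>carrier M. g' v \<ominus>\<^bsub>M\<^esub> g v \<in> rM}"
    then have g': "g' \<in> End" "\<And>v. v \<in> carrier M \<Longrightarrow> g' v \<ominus>\<^bsub>M\<^esub> g v \<in> rM" by auto
    have g'f: "cl (g' v) = f (cl v)" if "v \<in> carrier M" for v
      using that g'(2)[OF that] cl_eq_iff[of "g' v" "g v"] EndD(1)[OF g'(1)] EndD(1)[OF g(1)] gf by simp
    have "h (g' v) (g' w) \<ominus> h v w \<in> r" if vw: "v \<in> carrier M" "w \<in> carrier M" for v w
    proof -
      have "hbar (cl (g' v)) (cl (g' w)) = hbar (cl v) (cl w)"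
        using g'f vw f_h cl_mem by simp
      then show ?thesis using vw EndD(1)[OF g'(1)] by (simp add: hbar_cl r.a_rcos_eq_iff)
    qed
    then have "g' \<in> U_mod_r" using g'(1) by (simp add: U_mod_r_def)
    moreover have "reduction g' = f"
    proof (rule extensionalityI[where A = "carrier Mbar"])
      show "f \<in> extensional (carrier Mbar)" using Bij_imp_extensional[OF fB] .
      show "reduction g' \<in> extensional (carrier Mbar)" by (simp add: reduction_def)
      fix B assume "B \<in> carrier Mbar"
      then show "reduction g' B = f B" using reduction_cl[OF g'(1)] g'f by (auto simp: carrier_Mbar)
    qed
    ultimately show "g' \<in> {g' \<in> U_mod_r. reduction g' = f}" by simp
  qed
  then show ?thesis
    using bij_betw_same_card[OF bij_betw_add_Hom_r[OF g(1)]] card_Hom_r by simp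
qed

lemma finite_Ubar: "finite Ubar"
proof (rule finite_subset)
  show "finite (carrier Mbar \<rightarrow>\<^sub>E carrier Mbar)" by (intro finite_PiE finite_Mbar)
  show "Ubar \<subseteq> carrier Mbar \<rightarrow>\<^sub>E carrier Mbar"
    using unitary_groupD(1)[of _ Rbar Mbar hbar] Bij_imp_extensional Bij_imp_funcset
    unfolding PiE_def by blast
qed

lemma card_U_mod_r_reduction: "card U_mod_r = card r ^ (m * m) * card Ubar"
  by (rule card_eq_card_mult_fibre[OF finite_U_mod_r finite_Ubar _ card_fibre_reduction])
     (use reduction_mem in auto)

text \<open>
  Both counts of \<open>U_mod_r\<close> together give \<open>|U| |r\<^sup>+|\<^sup>m
  |r|\<^bsup>m(m-1)/2\<^esup> = |r|\<^bsup>m\<^sup>2\<^esup> |U'|\<close> with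
  \<open>U'\<close> the reduced group. Now write \<open>m\<^sup>2 = m + 2 (m(m-1)/2)\<close>,
  insert \<open>|r| = |r\<^sup>+| |r\<^sup>-|\<close> in the first factor, and cancel.
\<close>

theorem order_unitary_group:
  "order (unitary_group R M h)
    = card r_skew ^ m * card r ^ (m * (m - 1) div 2) * order (reduced_unitary_group R r M h)"
proof -
  define s k t where "s = card r_sym" "k = card r_skew" "t = card r ^ (m * (m - 1) div 2)"
  have "\<zero> \<in> r_sym" by (simp add: r_sym_def star_zero)
  moreover have "finite r_sym" by (rule finite_subset[OF _ finite_r]) (auto simp: r_sym_def)
  ultimately have "s > 0" by (auto simp: s_k_t_def card_gt_0_iff)
  moreover have "t > 0" using odd_card_r by (auto simp: s_k_t_def intro: odd_pos)
  moreover have "card r ^ (m * m) = s ^ m * k ^ m * (t * t)"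
  proof -
    have "even (m * (m - 1))" by (cases m) auto
    then have "m * (m - 1) div 2 + m * (m - 1) div 2 = m * (m - 1)" by (simp add: mult_2[symmetric])
    moreover have "m * m = m + m * (m - 1)" by (cases m) auto
    ultimately have "m * m = m + (m * (m - 1) div 2 + m * (m - 1) div 2)" by simp
    then have "card r ^ (m * m) = card r ^ m * (t * t)" by (simp add: power_add s_k_t_def)
    then show ?thesis by (simp add: card_r power_mult_distrib s_k_t_def)
  qed
  moreover have "card U * (s ^ m * t) = card r ^ (m * m) * card Ubar"
    using card_U_mod_r card_U_mod_r_reduction by (simp add: s_k_t_def)
  ultimately have "card U * (s ^ m * t) = (k ^ m * t * card Ubar) * (s ^ m * t)" "s ^ m * t > 0"
    by (simp_all add: mult_ac)
  then have "card U = k ^ m * t * card Ubar" by (metis mult_cancel2 less_numeral_extra(3))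
  then show ?thesis
    by (simp add: order_def carrier_unitary_group reduced_unitary_group_def s_k_t_def)
qed

end

section \<open>Fields with a discrete absolute value\<close>

text \<open>
  The constant \<open>c\<close> is the largest absolute value below \<open>1\<close>. It is a
  parameter because it serves to index the powers of the maximal ideal by their bounds
  \<open>c\<^sup>n\<close>.
\<close>

locale discrete_valued_field = field L for L (structure) +
  fixes w :: "'a \<Rightarrow> real" and c :: real
  assumes w_nonneg: "x \<in> carrier L \<Longrightarrow> 0 \<le> w x"
    and w_eq_0_iff: "x \<in> carrier L \<Longrightarrow> w x = 0 \<longleftrightarrow> x = \<zero>"
    and w_mult: "x \<in> carrier L \<Longrightarrow> y \<in> carrier L \<Longrightarrow> w (x \<otimes> y) = w x * w y"
    and w_add: "x \<in> carrier L \<Longrightarrow> y \<in> carrier L \<Longrightarrow> w (x \<oplus> y) \<le> max (w x) (w y)"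
    and c: "0 < c" "c < 1"
    and w_range: "w ` (carrier L - {\<zero>}) = range (\<lambda>n::int. c powi n)"
begin

lemma w_zero: "w \<zero> = 0" using w_eq_0_iff by simp

lemma w_one: "w \<one> = 1"
  using w_mult[of \<one> \<one>] w_eq_0_iff[of \<one>] by simp

lemma w_neg: "x \<in> carrier L \<Longrightarrow> w (\<ominus> x) = w x"
proof -
  assume x: "x \<in> carrier L"
  have "\<ominus> \<one> \<otimes> \<ominus> \<one> = \<one>" by algebra
  then have "w (\<ominus> \<one>) * w (\<ominus> \<one>) = 1" using w_mult[of "\<ominus> \<one>" "\<ominus> \<one>"] w_one by simp
  then have "w (\<ominus> \<one>) = 1"
    using w_nonneg[of "\<ominus> \<one>"] by (metis abs_of_nonneg a_inv_closed one_closed abs_mult_self_eq power2_eq_1_iff power2_eq_square abs_1 abs_minus)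
  moreover have "\<ominus> x = \<ominus> \<one> \<otimes> x" using x by algebra
  ultimately show ?thesis using w_mult[of "\<ominus> \<one>" x] x by simp
qed

lemma w_minus: "x \<in> carrier L \<Longrightarrow> y \<in> carrier L \<Longrightarrow> w (x \<ominus> y) \<le> max (w x) (w y)"
  using w_add[of x "\<ominus> y"] w_neg[of y] by (simp add: minus_eq)

lemma w_pow: "x \<in> carrier L \<Longrightarrow> w (x [^] (n::nat)) = w x ^ n"
  by (induct n) (simp_all add: w_one w_mult)

lemma w_inv: "x \<in> carrier L \<Longrightarrow> x \<noteq> \<zero> \<Longrightarrow> w (inv x) = 1 / w x"
proof -
  assume x: "x \<in> carrier L" "x \<noteq> \<zero>"
  then have "x \<in> Units L" by (simp add: field_Units)
  then have "w x * w (inv x) = 1" using w_mult[of x "inv x"] x(1) w_one by simp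
  then show ?thesis using w_eq_0_iff[OF x(1)] x(2) by (simp add: field_simps)
qed

lemma inv_mem: "x \<in> carrier L \<Longrightarrow> x \<noteq> \<zero> \<Longrightarrow> inv x \<in> carrier L" "x \<in> carrier L \<Longrightarrow> x \<noteq> \<zero> \<Longrightarrow> x \<otimes> inv x = \<one>"
  using field_Units by auto

lemma uniformizer: "\<exists>x. x \<in> carrier L \<and> x \<noteq> \<zero> \<and> w x = c"
proof -
  have "c powi 1 \<in> w ` (carrier L - {\<zero>})" unfolding w_range by blast
  then show ?thesis by auto
qed

definition \<omega> where "\<omega> = (SOME x. x \<in> carrier L \<and> x \<noteq> \<zero> \<and> w x = c)"

lemma \<omega>: "\<omega> \<in> carrier L" "\<omega> \<noteq> \<zero>" "w \<omega> = c"
  using someI_ex[OF uniformizer] by (simp_all add: \<omega>_def)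

lemma w_less_powi: "x \<in> carrier L \<Longrightarrow> w x < c powi n \<Longrightarrow> w x \<le> c powi (n + 1)"
proof (cases "x = \<zero>")
  case False
  assume x: "x \<in> carrier L" "w x < c powi n"
  then obtain k :: int where k: "w x = c powi k" using w_range False by blast
  have "n < k"
  proof (rule ccontr)
    assume "\<not> n < k"
    then have "c powi n \<le> c powi k" using c by (intro power_int_decreasing) auto
    then show False using x(2) k by simp
  qed
  then show ?thesis unfolding k using c by (intro power_int_decreasing) auto
qed (use c in \<open>simp add: w_zero\<close>)

lemma w_less_one: "x \<in> carrier L \<Longrightarrow> w x < 1 \<longleftrightarrow> w x \<le> c"
  using w_less_powi[of x 0] c by auto

text \<open>
  The \<open>n\<close>-th power of the maximal ideal (\<open>ideal_power_Pn\<close>);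
  \<open>Pn 0\<close> is the valuation ring.
\<close>

definition Pn :: "nat \<Rightarrow> 'a set" where "Pn n = {x \<in> carrier L. w x \<le> c ^ n}"

lemma Pn_0: "Pn 0 = carrier (abs_integers L w)"
  by (simp add: Pn_def abs_integers_def)

lemma Pn_1: "Pn 1 = abs_max_ideal L w"
  using w_less_one by (auto simp: Pn_def abs_max_ideal_def)

lemma Pn_antimono: "i \<le> j \<Longrightarrow> Pn j \<subseteq> Pn i"
  unfolding Pn_def using order_trans[OF _ power_decreasing[of i j c]] c by auto

lemma Pn_carrier: "x \<in> Pn n \<Longrightarrow> x \<in> carrier L" by (simp add: Pn_def)

lemma Pn_closed:
  "\<zero> \<in> Pn n" "x \<in> Pn n \<Longrightarrow> y \<in> Pn n \<Longrightarrow> x \<oplus> y \<in> Pn n"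
  "x \<in> Pn n \<Longrightarrow> y \<in> Pn n \<Longrightarrow> x \<ominus> y \<in> Pn n" "x \<in> Pn n \<Longrightarrow> \<ominus> x \<in> Pn n"
  using w_add[of x y] w_minus[of x y] w_neg[of x] c by (auto simp: Pn_def w_zero)

lemma Pn_mult: "x \<in> Pn i \<Longrightarrow> y \<in> Pn j \<Longrightarrow> x \<otimes> y \<in> Pn (i + j)"
  using w_nonneg c by (auto simp: Pn_def w_mult power_add intro!: mult_mono)

lemma Pn_subgroup: "subgroup (Pn n) (add_monoid L)"
proof (rule add.subgroupI)
  show "Pn n \<noteq> {}" using Pn_closed(1) by blast
qed (use Pn_closed Pn_carrier in auto)

lemma one_Pn_0: "\<one> \<in> Pn 0" by (simp add: Pn_def w_one)

abbreviation \<O> where "\<O> \<equiv> abs_integers L w"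

lemma \<O>_simps: "carrier \<O> = Pn 0" "\<zero>\<^bsub>\<O>\<^esub> = \<zero>" "\<one>\<^bsub>\<O>\<^esub> = \<one>" "x \<oplus>\<^bsub>\<O>\<^esub> y = x \<oplus> y" "x \<otimes>\<^bsub>\<O>\<^esub> y = x \<otimes> y"
  by (simp_all add: Pn_0) (simp_all add: abs_integers_def)

lemma cring_\<O>: "cring \<O>"
proof -
  have "subring (Pn 0) L"
    using Pn_carrier Pn_closed one_Pn_0 Pn_mult[of _ 0 _ 0] by (intro subringI) auto
  then have "subcring (Pn 0) L" by (intro subcringI') 
  moreover have "\<O> = L\<lparr>carrier := Pn 0\<rparr>" by (simp add: abs_integers_def Pn_def)
  ultimately show ?thesis using subcring_iff[of "Pn 0"] Pn_carrier by auto
qed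

lemma Pn_ideal: "ideal (Pn n) \<O>"
proof (rule idealI)
  interpret O: cring \<O> by (rule cring_\<O>)
  show "ring \<O>" by (rule O.ring_axioms)
  show "subgroup (Pn n) (add_monoid \<O>)"
  proof (rule O.add.subgroupI)
    show "Pn n \<subseteq> carrier \<O>" using Pn_antimono[of 0 n] by (simp add: \<O>_simps)
    show "Pn n \<noteq> {}" using Pn_closed by blast
    fix x assume x: "x \<in> Pn n"
    have "\<ominus>\<^bsub>\<O>\<^esub> x = \<ominus> x"
    proof (rule O.minus_equality)
      show "\<ominus> x \<oplus>\<^bsub>\<O>\<^esub> x = \<zero>\<^bsub>\<O>\<^esub>" using x Pn_carrier l_neg by (simp add: \<O>_simps)
      show "x \<in> carrier \<O>" "\<ominus> x \<in> carrier \<O>"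
        using x Pn_closed(4)[OF x] Pn_antimono[of 0 n] by (auto simp: \<O>_simps)
    qed
    then show "\<ominus>\<^bsub>\<O>\<^esub> x \<in> Pn n" using x Pn_closed by simp
  next
    fix x y assume "x \<in> Pn n" "y \<in> Pn n"
    then show "x \<oplus>\<^bsub>\<O>\<^esub> y \<in> Pn n" using Pn_closed by (simp add: \<O>_simps)
  qed
  fix a x assume "a \<in> Pn n" "x \<in> carrier \<O>"
  then show "x \<otimes>\<^bsub>\<O>\<^esub> a \<in> Pn n" "a \<otimes>\<^bsub>\<O>\<^esub> x \<in> Pn n"
    using Pn_mult[of x 0 a n] Pn_mult[of a n x 0] by (simp_all add: \<O>_simps)
qed

lemma divide_\<omega>:
  assumes "x \<in> Pn (i + j)"
  shows "\<exists>y\<in>Pn j. x = \<omega> [^] i \<otimes> y"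
proof
  have x: "x \<in> carrier L" "w x \<le> c ^ (i + j)" using assms by (auto simp: Pn_def)
  have o: "\<omega> [^] i \<in> carrier L" "\<omega> [^] i \<noteq> \<zero>"
    using \<omega> w_eq_0_iff[of "\<omega> [^] i"] w_pow[of \<omega> i] c by auto
  show "x = \<omega> [^] i \<otimes> (inv (\<omega> [^] i) \<otimes> x)"
    using x o inv_mem[OF o] by (simp add: m_assoc[symmetric])
  have "w (inv (\<omega> [^] i) \<otimes> x) = w x / c ^ i"
    using x o inv_mem[OF o] by (simp add: w_mult w_inv w_pow \<omega>)
  also have "\<dots> \<le> c ^ j" using x(2) c by (simp add: power_add field_simps)
  finally show "inv (\<omega> [^] i) \<otimes> x \<in> Pn j"
    using x o inv_mem[OF o] by (simp add: Pn_def)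
qed

lemma ideal_power_Pn: "ideal_power \<O> (Pn 1) n = Pn n"
proof (induct n)
  case 0 then show ?case by (simp add: ideal_power_def ideals_set_def \<O>_simps)
next
  case (Suc n)
  have "ideal_power \<O> (Pn 1) (Suc n) = ideal_prod \<O> (Pn n) (Pn 1)"
    using Suc by (simp add: ideal_power_def ideals_set_def)
  also have "\<dots> = Pn (Suc n)"
  proof
    show "ideal_prod \<O> (Pn n) (Pn 1) \<subseteq> Pn (Suc n)"
    proof
      fix x assume "x \<in> ideal_prod \<O> (Pn n) (Pn 1)"
      then show "x \<in> Pn (Suc n)"
        by (induct rule: ideal_prod.induct) (use Pn_mult[of _ n _ 1] Pn_closed in \<open>simp_all add: \<O>_simps\<close>)
    qed
    show "Pn (Suc n) \<subseteq> ideal_prod \<O> (Pn n) (Pn 1)"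
    proof
      fix x assume "x \<in> Pn (Suc n)"
      then obtain y where y: "y \<in> Pn 1" "x = \<omega> [^] n \<otimes> y" using divide_\<omega>[of x n 1] by auto
      have "\<omega> [^] n \<in> Pn n" using \<omega> by (simp add: Pn_def w_pow)
      then show "x \<in> ideal_prod \<O> (Pn n) (Pn 1)"
        using ideal_prod.prod[of "\<omega> [^] n" "Pn n" y "Pn 1" \<O>] y by (simp add: \<O>_simps)
    qed
  qed
  finally show ?case .
qed

text \<open>
  The elements outside of \<open>Pn 1\<close> have absolute value \<open>1\<close> and are
  units.
\<close>

lemma ideal_unit:
  assumes "ideal J \<O>" "x \<in> J" "x \<notin> Pn 1"
  shows "J = carrier \<O>"
proof -
  interpret J: ideal J \<O> by fact
  have x: "x \<in> carrier L" "w x \<le> 1" using J.a_Hcarr[OF assms(2)] by (simp_all add: \<O>_simps Pn_def)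
  then have "w x = 1" using assms(3) w_less_one[of x] by (auto simp: Pn_def)
  then have x0: "x \<noteq> \<zero>" using w_zero by auto
  then have "inv x \<in> carrier \<O>" using inv_mem x \<open>w x = 1\<close> by (simp add: \<O>_simps Pn_def w_inv)
  then have "x \<otimes>\<^bsub>\<O>\<^esub> inv x \<in> J" using J.I_r_closed assms(2) by blast
  then have "\<one>\<^bsub>\<O>\<^esub> \<in> J" using inv_mem(2)[OF x(1) x0] by (simp add: \<O>_simps)
  then show ?thesis by (rule J.one_imp_carrier)
qed

lemma one_notin_Pn: "n \<noteq> 0 \<Longrightarrow> \<one> \<notin> Pn n"
  using power_strict_decreasing[of 0 n c] c by (simp add: Pn_def w_one)

lemma maximalideal_\<O>:
  assumes "maximalideal J \<O>"
  shows "J = Pn 1"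
proof -
  interpret J: maximalideal J \<O> by fact
  have "J \<subseteq> Pn 1" using ideal_unit[OF J.ideal_axioms] J.I_notcarr by blast
  moreover have "Pn 1 \<noteq> carrier \<O>" using one_notin_Pn[of 1] one_Pn_0 by (auto simp: \<O>_simps)
  ultimately show ?thesis
    using J.I_maximal[OF Pn_ideal[of 1]] Pn_antimono[of 0 1] by (simp add: \<O>_simps)
qed

subsection \<open>Quotients by powers of the maximal ideal\<close>

abbreviation An where "An n \<equiv> \<O> Quot Pn n"
text \<open>
  As addition in the valuation ring is that of the field, the classes in the quotients are
  cosets in the field, where subtraction is easier to handle.
\<close>

definition cls where "cls n x = Pn n +> x"

lemma abelian_subgroup_Pn: "abelian_subgroup (Pn n) L"
  by (rule abelian_subgroupI3) (auto intro: additive_subgroupI Pn_subgroup abelian_group_axioms)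

lemma cls_eq_iff: "x \<in> carrier L \<Longrightarrow> y \<in> carrier L \<Longrightarrow> cls n x = cls n y \<longleftrightarrow> x \<ominus> y \<in> Pn n"
  unfolding cls_def by (rule abelian_subgroup.a_rcos_eq_iff[OF abelian_subgroup_Pn])

lemma cls_\<O>: "cls n x = Pn n +>\<^bsub>\<O>\<^esub> x"
  by (simp add: cls_def a_r_coset_def' \<O>_simps)

lemma carrier_An: "carrier (An n) = cls n ` Pn 0"
  by (auto simp: FactRing_def A_RCOSETS_def' cls_\<O> \<O>_simps)

lemma cls_hom: "cls n \<in> ring_hom \<O> (An n)"
  using ideal.rcos_ring_hom[OF Pn_ideal[of n]] by (simp add: cls_\<O>[abs_def])

lemma cls_simps:
  assumes "x \<in> Pn 0" "y \<in> Pn 0"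
  shows "cls n x \<in> carrier (An n)" "cls n (x \<oplus> y) = cls n x \<oplus>\<^bsub>An n\<^esub> cls n y"
    "cls n (x \<otimes> y) = cls n x \<otimes>\<^bsub>An n\<^esub> cls n y" "\<one>\<^bsub>An n\<^esub> = cls n \<one>"
  using assms ring_hom_closed[OF cls_hom, of x n] ring_hom_add[OF cls_hom, of x y n]
    ring_hom_mult[OF cls_hom, of x y n] ring_hom_one[OF cls_hom, of n] by (simp_all add: \<O>_simps)

lemma cring_An: "cring (An n)"
  by (rule ideal.quotient_is_cring[OF Pn_ideal cring_\<O>])

lemma cls_zero: "\<zero>\<^bsub>An n\<^esub> = cls n \<zero>"
proof -
  have "Pn n \<subseteq> carrier L" using Pn_carrier by blast
  then show ?thesis by (simp add: FactRing_def cls_def)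
qed

lemma cls_eq_zero_iff: "x \<in> carrier L \<Longrightarrow> cls n x = \<zero>\<^bsub>An n\<^esub> \<longleftrightarrow> x \<in> Pn n"
  using cls_eq_iff[of x \<zero> n] by (simp add: cls_zero minus_eq)

lemma cls_minus:
  assumes "x \<in> Pn 0"
  shows "cls n (\<ominus> x) = \<ominus>\<^bsub>An n\<^esub> cls n x"
proof -
  interpret A: cring "An n" by (rule cring_An)
  have "cls n (\<ominus> x) \<oplus>\<^bsub>An n\<^esub> cls n x = \<zero>\<^bsub>An n\<^esub>"
    using cls_simps(2)[of "\<ominus> x" x n] assms Pn_closed(4)[OF assms] Pn_carrier l_neg
    by (simp add: cls_zero)
  then show ?thesis
    using A.minus_equality[of "cls n (\<ominus> x)" "cls n x"] cls_simps(1)[of x x n] cls_simps(1)[of "\<ominus> x" x n]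
      assms Pn_closed(4)[OF assms] by simp
qed

lemma principal_cls: "{cls e \<omega> \<otimes>\<^bsub>An e\<^esub> a | a. a \<in> carrier (An e)} = cls e ` Pn 1"
proof -
  have o: "\<omega> \<in> Pn 1" "\<omega> \<in> Pn 0" using \<omega> c by (simp_all add: Pn_def)
  show ?thesis
  proof
    show "{cls e \<omega> \<otimes>\<^bsub>An e\<^esub> a | a. a \<in> carrier (An e)} \<subseteq> cls e ` Pn 1"
    proof
      fix z assume "z \<in> {cls e \<omega> \<otimes>\<^bsub>An e\<^esub> a | a. a \<in> carrier (An e)}"
      then obtain y where y: "y \<in> Pn 0" "z = cls e \<omega> \<otimes>\<^bsub>An e\<^esub> cls e y" by (auto simp: carrier_An)
      then have "z = cls e (\<omega> \<otimes> y)" using cls_simps(3) o by simp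
      then show "z \<in> cls e ` Pn 1" using Pn_mult[OF o(1) y(1)] by auto
    qed
    show "cls e ` Pn 1 \<subseteq> {cls e \<omega> \<otimes>\<^bsub>An e\<^esub> a | a. a \<in> carrier (An e)}"
    proof
      fix z assume "z \<in> cls e ` Pn 1"
      then obtain x where x: "x \<in> Pn (1 + 0)" "z = cls e x" by auto
      then obtain y where y: "y \<in> Pn 0" "x = \<omega> [^] (1::nat) \<otimes> y" using divide_\<omega>[OF x(1)] by blast
      then have "z = cls e \<omega> \<otimes>\<^bsub>An e\<^esub> cls e y" using x cls_simps(3) o \<omega> by simp
      then show "z \<in> {cls e \<omega> \<otimes>\<^bsub>An e\<^esub> a | a. a \<in> carrier (An e)}" using cls_simps(1)[OF y(1) y(1)] by blast
    qed
  qed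
qed

text \<open>
  Everything outside the image of \<open>Pn 1\<close> is a unit, so a maximal ideal is
  contained in this image.
\<close>

lemma maximalideal_An:
  assumes e: "e \<ge> 1" and r: "maximalideal r (An e)"
  shows "r = cls e ` Pn 1"
proof -
  interpret A: cring "An e" by (rule cring_An)
  interpret r: maximalideal r "An e" by fact
  have o: "\<omega> \<in> Pn 0" using \<omega> c by (simp_all add: Pn_def)
  have "PIdl\<^bsub>An e\<^esub> (cls e \<omega>) = cls e ` Pn 1"
    unfolding principal_cls[symmetric] cgenideal_def
    using A.m_comm[OF cls_simps(1)[OF o o]] by (intro Collect_cong) metis
  then have I: "ideal (cls e ` Pn 1) (An e)" using A.cgenideal_ideal[OF cls_simps(1)[OF o o]] by simp
  have "cls e ` Pn 1 \<noteq> carrier (An e)"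
  proof
    assume "cls e ` Pn 1 = carrier (An e)"
    then have "cls e \<one> \<in> cls e ` Pn 1" using A.one_closed cls_simps(4)[OF o o, of e] by simp
    then obtain x where x: "cls e \<one> = cls e x" "x \<in> Pn 1" by (rule imageE)
    then have "\<one> \<ominus> x \<in> Pn 1" using cls_eq_iff[of \<one> x] Pn_carrier Pn_antimono[OF e] by auto
    then have "x \<oplus> (\<one> \<ominus> x) \<in> Pn 1" using x(2) Pn_closed by blast
    then show False using one_notin_Pn[of 1] x(2) Pn_carrier by (simp add: add_minus_cancel)
  qed
  moreover have "r \<subseteq> cls e ` Pn 1"
  proof
    fix z assume z: "z \<in> r"
    then obtain x where x: "x \<in> Pn 0" "z = cls e x" using r.a_Hcarr by (auto simp: carrier_An)
    have "x \<in> Pn 1"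
    proof (rule ccontr)
      assume "x \<notin> Pn 1"
      then have w1: "w x = 1" using x(1) w_less_one[of x] by (auto simp: Pn_def)
      then have x0: "x \<noteq> \<zero>" using w_zero by auto
      have ix: "inv x \<in> Pn 0" using inv_mem x x0 w1 by (simp add: Pn_def w_inv)
      have "cls e x \<otimes>\<^bsub>An e\<^esub> cls e (inv x) \<in> r"
        using r.I_r_closed z x(2) cls_simps(1)[OF ix ix] by blast
      then have "\<one>\<^bsub>An e\<^esub> \<in> r"
        using cls_simps(3)[OF x(1) ix] cls_simps(4)[OF ix ix] inv_mem(2)[OF _ x0] x(1) by (simp add: Pn_def)
      then show False using r.one_imp_carrier r.I_notcarr by simp
    qed
    then show "z \<in> cls e ` Pn 1" using x(2) by blast
  qed
  ultimately show ?thesis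
    using r.I_maximal[OF I] ideal.axioms(1)[OF I] additive_subgroup.a_subset by blast
qed

end

section \<open>Cardinalities of ideal quotients\<close>

locale finite_residue_field = discrete_valued_field +
  assumes finite_residue: "finite (carrier (abs_integers L w Quot abs_max_ideal L w))"
begin

definition Q where "Q = order (An 1)"

text \<open>
  This counts \<open>Pn i\<close> modulo \<open>Pn j\<close> by means of any function that
  separates exactly the classes; with \<open>f\<close> arbitrary it also applies to elements
  of \<open>K\<close> that are multiplied by \<open>\<theta>\<close> and reduced in a larger
  field. The induction splits \<open>Pn i\<close> into the cosets of \<open>Pn (i +
  1)\<close>, one for each residue class.
\<close>

lemma card_image_Pn:
  assumes "i \<le> j"
    and "\<And>x y. x \<in> Pn i \<Longrightarrow> y \<in> Pn i \<Longrightarrow> f x = f y \<longleftrightarrow> x \<ominus> y \<in> Pn j"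
  shows "card (f ` Pn i) = Q ^ (j - i) \<and> finite (f ` Pn i)"
  using assms
proof (induct "j - i" arbitrary: i f)
  case 0
  then have "i = j" by simp
  then have "f x = f \<zero>" if "x \<in> Pn i" for x
    using 0(3)[OF that Pn_closed(1)] that Pn_closed(1,3) by simp
  then have "f ` Pn i = {f \<zero>}" using Pn_closed(1)[of i] by blast
  then show ?case using 0 by simp
next
  case (Suc d)
  then have ij: "i < j" "d = j - Suc i" by auto
  \<comment> \<open>representatives of the residue classes\<close>
  define s where "s = (\<lambda>t. SOME x. x \<in> Pn 0 \<and> cls 1 x = t)"
  have s: "s t \<in> Pn 0" "cls 1 (s t) = t" if "t \<in> carrier (An 1)" for t
  proof -
    have "\<exists>x. x \<in> Pn 0 \<and> cls 1 x = t" using that by (auto simp: carrier_An)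
    from someI_ex[OF this] show "s t \<in> Pn 0" "cls 1 (s t) = t" by (simp_all add: s_def)
  qed
  define g where "g t y = f (\<omega> [^] i \<otimes> s t \<oplus> y)" for t y
  have o: "\<omega> [^] i \<in> Pn i" using \<omega> by (simp add: Pn_def w_pow)
  have os: "\<omega> [^] i \<otimes> s t \<in> Pn i" if "t \<in> carrier (An 1)" for t
    using Pn_mult[OF o s(1)[OF that]] by simp
  have sub: "y \<in> Pn i" if "y \<in> Pn (Suc i)" for y using that Pn_antimono[of i "Suc i"] by auto
  have g: "card (g t ` Pn (Suc i)) = Q ^ d \<and> finite (g t ` Pn (Suc i))" if t: "t \<in> carrier (An 1)" for t
    unfolding ij(2)
  proof (rule Suc(1))
    fix x y assume xy: "x \<in> Pn (Suc i)" "y \<in> Pn (Suc i)"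
    have "g t x = g t y \<longleftrightarrow> (\<omega> [^] i \<otimes> s t \<oplus> x) \<ominus> (\<omega> [^] i \<otimes> s t \<oplus> y) \<in> Pn j"
      unfolding g_def using Pn_closed(2)[OF os[OF t]] sub xy by (intro Suc(4)) auto
    also have "(\<omega> [^] i \<otimes> s t \<oplus> x) \<ominus> (\<omega> [^] i \<otimes> s t \<oplus> y) = x \<ominus> y"
      using Pn_carrier os[OF t] xy by algebra
    finally show "g t x = g t y \<longleftrightarrow> x \<ominus> y \<in> Pn j" .
  qed (use ij in auto)
  have cover: "f ` Pn i = (\<Union>t\<in>carrier (An 1). g t ` Pn (Suc i))"
  proof
    show "(\<Union>t\<in>carrier (An 1). g t ` Pn (Suc i)) \<subseteq> f ` Pn i"
      using Pn_closed(2)[OF os] sub by (auto simp: g_def)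
    show "f ` Pn i \<subseteq> (\<Union>t\<in>carrier (An 1). g t ` Pn (Suc i))"
    proof
      fix z assume "z \<in> f ` Pn i"
      then obtain x where x: "x \<in> Pn (i + 0)" "z = f x" by auto
      then obtain u where u: "u \<in> Pn 0" "x = \<omega> [^] i \<otimes> u" using divide_\<omega>[OF x(1)] by blast
      have t: "cls 1 u \<in> carrier (An 1)" using cls_simps(1)[OF u(1) u(1)] .
      have "u \<ominus> s (cls 1 u) \<in> Pn 1" using cls_eq_iff[of u "s (cls 1 u)" 1] s[OF t] u(1) Pn_carrier by auto
      then have "\<omega> [^] i \<otimes> (u \<ominus> s (cls 1 u)) \<in> Pn (Suc i)" using Pn_mult[OF o, of _ 1] by simp
      moreover have "\<omega> [^] i \<otimes> s (cls 1 u) \<oplus> \<omega> [^] i \<otimes> (u \<ominus> s (cls 1 u)) = x"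
        unfolding u(2) using Pn_carrier[OF o] Pn_carrier[OF u(1)] Pn_carrier[OF s(1)[OF t]] by algebra
      ultimately have "z \<in> g (cls 1 u) ` Pn (Suc i)" unfolding g_def using x(2) by (metis imageI)
      then show "z \<in> (\<Union>t\<in>carrier (An 1). g t ` Pn (Suc i))" using t by blast
    qed
  qed
  have disj: "g t ` Pn (Suc i) \<inter> g t' ` Pn (Suc i) = {}"
    if t: "t \<in> carrier (An 1)" "t' \<in> carrier (An 1)" "t \<noteq> t'" for t t'
  proof (rule ccontr)
    assume "g t ` Pn (Suc i) \<inter> g t' ` Pn (Suc i) \<noteq> {}"
    then obtain y y' where y: "y \<in> Pn (Suc i)" "y' \<in> Pn (Suc i)" "g t y = g t' y'" by blast
    note cs = Pn_carrier[OF s(1)[OF t(1)]] Pn_carrier[OF s(1)[OF t(2)]]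
      Pn_carrier[OF y(1)] Pn_carrier[OF y(2)] Pn_carrier[OF o]
    have "(\<omega> [^] i \<otimes> s t \<oplus> y) \<ominus> (\<omega> [^] i \<otimes> s t' \<oplus> y') \<in> Pn j"
      using y(3) Suc(4)[of "\<omega> [^] i \<otimes> s t \<oplus> y" "\<omega> [^] i \<otimes> s t' \<oplus> y'"]
        Pn_closed(2)[OF os[OF t(1)] sub[OF y(1)]] Pn_closed(2)[OF os[OF t(2)] sub[OF y(2)]]
      by (simp add: g_def)
    then have "(\<omega> [^] i \<otimes> s t \<oplus> y) \<ominus> (\<omega> [^] i \<otimes> s t' \<oplus> y') \<in> Pn (Suc i)"
      using Pn_antimono[of "Suc i" j] ij by auto
    then have "((\<omega> [^] i \<otimes> s t \<oplus> y) \<ominus> (\<omega> [^] i \<otimes> s t' \<oplus> y')) \<ominus> (y \<ominus> y') \<in> Pn (Suc i)"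
      using Pn_closed(3) y(1,2) by blast
    also have "((\<omega> [^] i \<otimes> s t \<oplus> y) \<ominus> (\<omega> [^] i \<otimes> s t' \<oplus> y')) \<ominus> (y \<ominus> y') = \<omega> [^] i \<otimes> (s t \<ominus> s t')"
      using cs by algebra
    finally have "w (\<omega> [^] i \<otimes> (s t \<ominus> s t')) \<le> c ^ Suc i" by (simp add: Pn_def)
    then have "w (s t \<ominus> s t') \<le> c" using cs c by (simp add: w_mult w_pow \<omega>)
    then have "cls 1 (s t) = cls 1 (s t')" using cls_eq_iff cs by (simp add: Pn_def)
    then show False using s(2) t by simp
  qed
  have fin: "finite (carrier (An 1))" unfolding Pn_1 by (rule finite_residue)
  have "card (f ` Pn i) = (\<Sum>t\<in>carrier (An 1). card (g t ` Pn (Suc i)))"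
    unfolding cover using g disj by (intro card_UN_disjoint fin) auto
  also have "\<dots> = Q * Q ^ d" using g by (simp add: Q_def order_def)
  finally have "card (f ` Pn i) = Q ^ (j - i)" using Suc(2) by (simp flip: power_Suc)
  moreover have "finite (f ` Pn i)" unfolding cover using g fin by blast
  ultimately show ?case by simp
qed

end

section \<open>Unitary groups over quotients of a valuation ring\<close>

context discrete_valued_field
begin

text \<open>
  Here the skew and the symmetric elements of the maximal ideal of the quotient are classes of
  elements of the field, so that they can be counted there.
\<close>

theorem order_unitary_group_quotient:
  fixes star :: "'a set \<Rightarrow> 'a set" and \<sigma> :: "'a \<Rightarrow> 'a" and V :: "('a set, 'v, 'z) module_scheme"
  assumes two: "w (\<one> \<oplus> \<one>) = 1" and e: "e \<ge> 1" and fin: "finite (carrier (An e))"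
    and \<sigma>_closed: "\<And>x. x \<in> carrier L \<Longrightarrow> \<sigma> x \<in> carrier L"
    and \<sigma>_add: "\<And>x y. x \<in> carrier L \<Longrightarrow> y \<in> carrier L \<Longrightarrow> \<sigma> (x \<oplus> y) = \<sigma> x \<oplus> \<sigma> y"
    and \<sigma>_mult: "\<And>x y. x \<in> carrier L \<Longrightarrow> y \<in> carrier L \<Longrightarrow> \<sigma> (x \<otimes> y) = \<sigma> x \<otimes> \<sigma> y"
    and \<sigma>_\<sigma>: "\<And>x. x \<in> carrier L \<Longrightarrow> \<sigma> (\<sigma> x) = x"
    and w_\<sigma>: "\<And>x. x \<in> carrier L \<Longrightarrow> w (\<sigma> x) = w x"
    and star: "\<And>x. x \<in> Pn 0 \<Longrightarrow> star (cls e x) = cls e (\<sigma> x)"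
    and r: "maximalideal r (An e)"
    and V: "module (An e) V" "free_of_rank (An e) V m"
    and h: "hermitian_form (An e) star V h" "nondegenerate (An e) V h"
  defines "k \<equiv> card (cls e ` {x \<in> Pn 1. \<sigma> x \<oplus> x \<in> Pn e})"
    and "s \<equiv> card (cls e ` {x \<in> Pn 1. \<sigma> x \<ominus> x \<in> Pn e})"
  shows "order (unitary_group (An e) V h)
    = k ^ m * (s * k) ^ (m * (m - 1) div 2) * order (reduced_unitary_group (An e) r V h)"
proof -
  interpret A: cring "An e" by (rule cring_An)
  have \<sigma>_Pn: "\<sigma> x \<in> Pn n" if "x \<in> Pn n" for x n
    using that \<sigma>_closed w_\<sigma> by (simp add: Pn_def)
  have o: "\<omega> \<in> Pn 1" "\<omega> \<in> Pn 0" using \<omega> c by (simp_all add: Pn_def)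
  obtain b where "b \<in> {..<m} \<rightarrow> carrier V"
    "\<forall>v\<in>carrier V. \<exists>!a. a \<in> {..<m} \<rightarrow>\<^sub>E carrier (An e) \<and> v = (\<Oplus>\<^bsub>V\<^esub>i\<in>{..<m}. a i \<odot>\<^bsub>V\<^esub> b i)"
    using V(2) unfolding free_of_rank_def by blast
  then have free: "free_module (An e) V b m"
    using V(1) by (simp add: free_module_def free_module_axioms_def)
  have tc: "\<one> \<oplus> \<one> \<in> carrier L" "\<one> \<oplus> \<one> \<noteq> \<zero>" using two w_zero by auto
  define t where "t = inv (\<one> \<oplus> \<one>)"
  have t: "t \<in> Pn 0" "t \<oplus> t = \<one>"
  proof -
    have tC: "t \<in> carrier L" "(\<one> \<oplus> \<one>) \<otimes> t = \<one>" using inv_mem[OF tc] by (simp_all add: t_def)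
    then show "t \<oplus> t = \<one>" by (simp add: l_distr)
    show "t \<in> Pn 0" using tC(1) tc two by (simp add: Pn_def t_def w_inv)
  qed
  have "star (cls e \<omega>) \<in> cls e ` Pn 1" using star[OF o(2)] \<sigma>_Pn[OF o(1)] by simp
  then obtain u where u: "u \<in> carrier (An e)" "star (cls e \<omega>) = cls e \<omega> \<otimes>\<^bsub>An e\<^esub> u"
    unfolding principal_cls[symmetric] by blast
  have pow: "cls e \<omega> [^]\<^bsub>An e\<^esub> n = cls e (\<omega> [^] n)" for n :: nat
  proof (induct n)
    case 0 then show ?case using cls_simps(4)[OF o(2) o(2)] by simp
  next
    case (Suc n)
    have "\<omega> [^] n \<in> Pn 0" using \<omega> c by (simp add: Pn_def w_pow power_le_one)
    then show ?case using Suc cls_simps(3)[OF _ o(2)] by simp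
  qed
  have nil: "cls e \<omega> [^]\<^bsub>An e\<^esub> e = \<zero>\<^bsub>An e\<^esub>"
    unfolding pow using cls_eq_zero_iff[of "\<omega> [^] e" e] \<omega> by (simp add: Pn_def w_pow)
  interpret H: hermitian_module "An e" V b m star h "cls e \<omega>" "cls e t" u e
  proof (intro hermitian_module.intro free hermitian_module_axioms.intro)
    show "finite (carrier (An e))" by (rule fin)
    show "cls e \<omega> \<in> carrier (An e)" "cls e t \<in> carrier (An e)" using cls_simps(1) o t by auto
    show "cls e t \<oplus>\<^bsub>An e\<^esub> cls e t = \<one>\<^bsub>An e\<^esub>" using cls_simps(2,4)[of t t] t by simp
    show "cls e \<omega> [^]\<^bsub>An e\<^esub> e = \<zero>\<^bsub>An e\<^esub>" by (rule nil)
    show "u \<in> carrier (An e)" "star (cls e \<omega>) = cls e \<omega> \<otimes>\<^bsub>An e\<^esub> u" by (rule u)+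
    show "hermitian_form (An e) star V h" "nondegenerate (An e) V h" by (rule h)+
    fix a assume "a \<in> carrier (An e)"
    then obtain x where x: "x \<in> Pn 0" "a = cls e x" by (auto simp: carrier_An)
    show "star a \<in> carrier (An e)" "star (star a) = a"
      unfolding x(2) using star[OF x(1)] star[OF \<sigma>_Pn[OF x(1)]] cls_simps(1)[OF \<sigma>_Pn[OF x(1)] x(1)]
        \<sigma>_\<sigma>[OF Pn_carrier[OF x(1)]] by simp_all
    fix a' assume "a' \<in> carrier (An e)"
    then obtain y where y: "y \<in> Pn 0" "a' = cls e y" by (auto simp: carrier_An)
    have xy: "x \<oplus> y \<in> Pn 0" "x \<otimes> y \<in> Pn 0" using Pn_closed(2)[OF x(1) y(1)] Pn_mult[OF x(1) y(1)] by simp_all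
    note c = Pn_carrier[OF x(1)] Pn_carrier[OF y(1)]
    show "star (a \<oplus>\<^bsub>An e\<^esub> a') = star a \<oplus>\<^bsub>An e\<^esub> star a'"
      unfolding x(2) y(2) using cls_simps(2)[OF x(1) y(1)] star[OF xy(1)] star[OF x(1)] star[OF y(1)] \<sigma>_add[OF c]
        cls_simps(2)[OF \<sigma>_Pn[OF x(1)] \<sigma>_Pn[OF y(1)]] by simp
    show "star (a \<otimes>\<^bsub>An e\<^esub> a') = star a \<otimes>\<^bsub>An e\<^esub> star a'"
      unfolding x(2) y(2) using cls_simps(3)[OF x(1) y(1)] star[OF xy(2)] star[OF x(1)] star[OF y(1)] \<sigma>_mult[OF c]
        cls_simps(3)[OF \<sigma>_Pn[OF x(1)] \<sigma>_Pn[OF y(1)]] by simp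
  qed
  have Hr: "H.r = cls e ` Pn 1" unfolding H.r_def by (rule principal_cls)
  have r_eq: "r = H.r" unfolding Hr by (rule maximalideal_An[OF e r])
  have P10: "x \<in> Pn 0" if "x \<in> Pn 1" for x using that Pn_antimono[of 0 1] by auto
  have "H.r_skew = cls e ` {x \<in> Pn 1. \<sigma> x \<oplus> x \<in> Pn e}"
  proof -
    have "star (cls e x) = \<ominus>\<^bsub>An e\<^esub> cls e x \<longleftrightarrow> \<sigma> x \<oplus> x \<in> Pn e" if x: "x \<in> Pn 1" for x
    proof -
      have xc: "x \<in> carrier L" using Pn_carrier[OF x] .
      have "star (cls e x) = \<ominus>\<^bsub>An e\<^esub> cls e x \<longleftrightarrow> cls e (\<sigma> x) = cls e (\<ominus> x)"
        using star[OF P10[OF x]] cls_minus[OF P10[OF x]] by simp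
      also have "\<dots> \<longleftrightarrow> \<sigma> x \<oplus> x \<in> Pn e"
        using cls_eq_iff[of "\<sigma> x" "\<ominus> x" e] xc \<sigma>_closed[OF xc] by (simp add: minus_eq)
      finally show ?thesis .
    qed
    then show ?thesis unfolding H.r_skew_def Hr by auto
  qed
  moreover have "H.r_sym = cls e ` {x \<in> Pn 1. \<sigma> x \<ominus> x \<in> Pn e}"
  proof -
    have "star (cls e x) = cls e x \<longleftrightarrow> \<sigma> x \<ominus> x \<in> Pn e" if x: "x \<in> Pn 1" for x
      using star[OF P10[OF x]] cls_eq_iff[of "\<sigma> x" x e] Pn_carrier[OF x] \<sigma>_closed by simp
    then show ?thesis unfolding H.r_sym_def Hr by auto
  qed
  ultimately show ?thesis
    using H.order_unitary_group H.card_r by (simp add: r_eq k_def s_def)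
qed

section \<open>Square roots in complete fields\<close>

lemma w_minus_eq_max:
  assumes "x \<in> carrier L" "y \<in> carrier L" "w x \<noteq> w y"
  shows "w (x \<ominus> y) = max (w x) (w y)"
proof -
  have "w x \<le> max (w (x \<ominus> y)) (w y)"
    using w_add[of "x \<ominus> y" y] assms by (simp add: minus_eq a_assoc l_neg)
  moreover have "w y \<le> max (w (x \<ominus> y)) (w x)"
  proof -
    have "y = x \<ominus> (x \<ominus> y)" using assms by algebra
    then show ?thesis using w_minus[of x "x \<ominus> y"] assms by simp
  qed
  ultimately show ?thesis using w_minus[OF assms(1,2)] assms(3) by auto
qed

text \<open>
  Newton's iteration for \<open>X\<^sup>2 - d\<close>, started at an approximate root: as
  \<open>2s\<close> is a unit, each step squares the absolute value of the error
  \<open>s\<^sup>2 - d\<close>. The bound \<open>\<delta>\<^bsup>n+1\<^esup>\<close>, much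
  weaker than this, already makes the sequence converge to a root.
\<close>

lemma hensel_square:
  assumes complete: "\<And>s. range s \<subseteq> carrier L \<Longrightarrow>
        \<forall>\<epsilon>>0. \<exists>N::nat. \<forall>i\<ge>N. \<forall>j\<ge>N. w (s i \<ominus> s j) < \<epsilon> \<Longrightarrow>
        \<exists>l\<in>carrier L. (\<lambda>i. w (s i \<ominus> l)) \<longlonglongrightarrow> 0"
    and two: "w (\<one> \<oplus> \<one>) = 1"
    and d: "d \<in> carrier L" "w d = 1"
    and s0: "s0 \<in> carrier L" "w (s0 \<otimes> s0 \<ominus> d) < 1"
  shows "\<exists>t\<in>carrier L. t \<otimes> t = d"
proof -
  define f where "f = (\<lambda>s. s \<ominus> (s \<otimes> s \<ominus> d) \<otimes> inv ((\<one> \<oplus> \<one>) \<otimes> s))"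
  define s where "s n = (f ^^ n) s0" for n
  define \<delta> where "\<delta> = w (s0 \<otimes> s0 \<ominus> d)"
  have \<delta>: "0 \<le> \<delta>" "\<delta> < 1" using s0 d w_nonneg by (simp_all add: \<delta>_def)
  have unit: "w x = 1" if x: "x \<in> carrier L" "w (x \<otimes> x \<ominus> d) < 1" for x
  proof -
    have "w x * w x = 1"
    proof (rule ccontr)
      assume "w x * w x \<noteq> 1"
      then have "w (x \<otimes> x \<ominus> d) = max (w x * w x) 1"
        using w_minus_eq_max[of "x \<otimes> x" d] x d by (simp add: w_mult)
      then show False using x by simp
    qed
    then show ?thesis using w_nonneg[OF x(1)]
      by (metis power2_eq_square power2_eq_1_iff abs_of_nonneg abs_minus abs_1)
  qed
  have step: "f x \<in> carrier L \<and> w (f x \<otimes> f x \<ominus> d) \<le> \<delta> ^ (Suc (Suc n)) \<and> w (f x \<ominus> x) \<le> \<delta> ^ Suc n"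
    if x: "x \<in> carrier L" "w (x \<otimes> x \<ominus> d) \<le> \<delta> ^ Suc n" for x n
  proof -
    have dn: "\<delta> ^ Suc n \<le> \<delta>" using \<delta> by (simp add: mult_left_le power_le_one)
    have wx: "w x = 1" using unit x dn \<delta> by simp
    have tx: "(\<one> \<oplus> \<one>) \<otimes> x \<in> carrier L" "w ((\<one> \<oplus> \<one>) \<otimes> x) = 1" using x two wx by (simp_all add: w_mult)
    then have tx0: "(\<one> \<oplus> \<one>) \<otimes> x \<noteq> \<zero>" using w_zero by auto
    define y where "y = x \<otimes> x \<ominus> d"
    define u where "u = inv ((\<one> \<oplus> \<one>) \<otimes> x)"
    have u: "u \<in> carrier L" "(\<one> \<oplus> \<one>) \<otimes> x \<otimes> u = \<one>" "w u = 1"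
      using inv_mem[OF tx(1) tx0] w_inv[OF tx(1) tx0] tx by (simp_all add: u_def)
    have y: "y \<in> carrier L" using x d by (simp add: y_def)
    have fx: "f x = x \<ominus> y \<otimes> u" by (simp add: f_def y_def u_def)
    have "d = x \<otimes> x \<ominus> y" unfolding y_def using x(1) d(1) by algebra
    then have "f x \<otimes> f x \<ominus> d = (x \<ominus> y \<otimes> u) \<otimes> (x \<ominus> y \<otimes> u) \<ominus> (x \<otimes> x \<ominus> y)"
      using fx by simp
    also have "\<dots> = (y \<ominus> y \<otimes> ((\<one> \<oplus> \<one>) \<otimes> x \<otimes> u)) \<oplus> (y \<otimes> u) \<otimes> (y \<otimes> u)"
      using x(1) y u(1) by algebra
    also have "\<dots> = (y \<otimes> u) \<otimes> (y \<otimes> u)" unfolding u(2) using y u(1) by algebra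
    \<comment> \<open>with \<open>y = x\<^sup>2 - d\<close> and \<open>u = 1/(2x)\<close> the new error is
      \<open>y\<^sup>2u\<^sup>2\<close>\<close>
    finally have "w (f x \<otimes> f x \<ominus> d) = w y * w y" using y u by (simp add: w_mult)
    also have "\<dots> \<le> \<delta> ^ Suc n * \<delta>"
    proof (rule mult_mono)
      show wy: "w y \<le> \<delta> ^ Suc n" using x(2) unfolding y_def .
      show "w y \<le> \<delta>" using wy dn by linarith
      show "0 \<le> \<delta> ^ Suc n" using \<delta>(1) by (rule zero_le_power)
    qed (rule w_nonneg[OF y])
    finally have "w (f x \<otimes> f x \<ominus> d) \<le> \<delta> ^ (Suc (Suc n))" by (simp add: mult_ac)
    moreover have "f x \<ominus> x = \<ominus> (y \<otimes> u)" unfolding fx using x(1) y u(1) by algebra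
    then have "w (f x \<ominus> x) \<le> \<delta> ^ Suc n" using x(2) y u by (simp add: w_neg w_mult y_def)
    ultimately show ?thesis using fx x y u by simp
  qed
  have sn: "s n \<in> carrier L \<and> w (s n \<otimes> s n \<ominus> d) \<le> \<delta> ^ Suc n" for n
  proof (induct n)
    case 0 then show ?case using s0 by (simp add: s_def \<delta>_def)
  next
    case (Suc n) then show ?case using step[of "s n" n] by (simp add: s_def)
  qed
  have diff: "w (s (n + k) \<ominus> s n) \<le> \<delta> ^ Suc n" for n k
  proof (induct k)
    case 0 then show ?case using sn[of n] \<delta> by (simp add: minus_eq r_neg w_zero)
  next
    case (Suc k)
    have sc: "s (n + k) \<in> carrier L" "s (Suc (n + k)) \<in> carrier L" "s n \<in> carrier L" using sn by auto
    have "s (n + Suc k) \<ominus> s n = (s (Suc (n + k)) \<ominus> s (n + k)) \<oplus> (s (n + k) \<ominus> s n)"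
      using sc by (simp, algebra)
    then have "w (s (n + Suc k) \<ominus> s n) \<le> max (w (s (Suc (n + k)) \<ominus> s (n + k))) (w (s (n + k) \<ominus> s n))"
      using w_add[of "s (Suc (n + k)) \<ominus> s (n + k)" "s (n + k) \<ominus> s n"] sc by simp
    moreover have "w (s (Suc (n + k)) \<ominus> s (n + k)) \<le> \<delta> ^ Suc (n + k)"
      using step[of "s (n + k)" "n + k"] sn by (simp add: s_def)
    moreover have "\<delta> ^ Suc (n + k) \<le> \<delta> ^ Suc n" using \<delta> by (intro power_decreasing) auto
    ultimately show ?case using Suc by auto
  qed
  have sym: "w (s i \<ominus> s j) = w (s j \<ominus> s i)" for i j
  proof -
    have "s i \<ominus> s j = \<ominus> (s j \<ominus> s i)" using sn[of i] sn[of j] by algebra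
    then show ?thesis using sn by (simp add: w_neg)
  qed
  have lim\<delta>: "(\<lambda>n. \<delta> ^ Suc n) \<longlonglongrightarrow> 0"
    using \<delta> LIMSEQ_realpow_zero by (intro LIMSEQ_Suc) auto
  have "\<exists>l\<in>carrier L. (\<lambda>i. w (s i \<ominus> l)) \<longlonglongrightarrow> 0"
  proof (rule complete)
    show "range s \<subseteq> carrier L" using sn by auto
    show "\<forall>\<epsilon>>0. \<exists>N. \<forall>i\<ge>N. \<forall>j\<ge>N. w (s i \<ominus> s j) < \<epsilon>"
    proof (intro allI impI)
      fix \<epsilon> :: real assume "\<epsilon> > 0"
      then obtain N where N: "\<And>n. n \<ge> N \<Longrightarrow> \<delta> ^ Suc n < \<epsilon>"
        using order_tendstoD(2)[OF lim\<delta>] by (auto simp: eventually_sequentially)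
      have "w (s i \<ominus> s j) < \<epsilon>" if "i \<ge> N" "j \<ge> N" for i j
      proof (cases "i \<le> j")
        case True
        then show ?thesis using diff[of i "j - i"] N[OF that(1)] sym[of i j] by simp
      next
        case False
        then show ?thesis using diff[of j "i - j"] N[OF that(2)] by simp
      qed
      then show "\<exists>N. \<forall>i\<ge>N. \<forall>j\<ge>N. w (s i \<ominus> s j) < \<epsilon>" by blast
    qed
  qed
  then obtain l where l: "l \<in> carrier L" "(\<lambda>i. w (s i \<ominus> l)) \<longlonglongrightarrow> 0" by blast
  define C where "C = max (w l) 1"
  have bound: "w (l \<otimes> l \<ominus> d) \<le> w (s i \<ominus> l) * C + \<delta> ^ Suc i" for i
  proof -
    have si: "s i \<in> carrier L" "w (s i \<otimes> s i \<ominus> d) \<le> \<delta> ^ Suc i" using sn by auto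
    have "\<delta> ^ Suc i \<le> \<delta>" using \<delta> by (simp add: mult_left_le power_le_one)
    then have wi: "w (s i) = 1" using unit si \<delta> by simp
    have "l \<otimes> l \<ominus> d = (s i \<otimes> s i \<ominus> d) \<ominus> (s i \<ominus> l) \<otimes> (l \<oplus> s i)"
      using l(1) si(1) d(1) by algebra
    then have "w (l \<otimes> l \<ominus> d) \<le> max (w (s i \<otimes> s i \<ominus> d)) (w ((s i \<ominus> l) \<otimes> (l \<oplus> s i)))"
      using w_minus[of "s i \<otimes> s i \<ominus> d" "(s i \<ominus> l) \<otimes> (l \<oplus> s i)"] l(1) si(1) d(1) by simp
    also have "w ((s i \<ominus> l) \<otimes> (l \<oplus> s i)) = w (s i \<ominus> l) * w (l \<oplus> s i)"
      using l(1) si(1) by (simp add: w_mult)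
    also have "w (s i \<ominus> l) * w (l \<oplus> s i) \<le> w (s i \<ominus> l) * C"
      using w_add[OF l(1) si(1)] wi w_nonneg[of "s i \<ominus> l"] l(1) si(1)
      by (intro mult_left_mono) (auto simp: C_def)
    finally have "w (l \<otimes> l \<ominus> d) \<le> max (w (s i \<otimes> s i \<ominus> d)) (w (s i \<ominus> l) * C)" by auto
    moreover have "0 \<le> w (s i \<ominus> l) * C"
      using w_nonneg[of "s i \<ominus> l"] l(1) si(1) by (simp add: C_def)
    moreover have "0 \<le> \<delta> ^ Suc i" using \<delta> by simp
    ultimately show ?thesis using si(2) by linarith
  qed
  have "(\<lambda>i. w (s i \<ominus> l) * C + \<delta> ^ Suc i) \<longlonglongrightarrow> 0 * C + 0"
    by (intro tendsto_intros l(2) lim\<delta>)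
  then have "w (l \<otimes> l \<ominus> d) \<le> 0"
    using bound by (intro LIMSEQ_le_const[of _ 0 "w (l \<otimes> l \<ominus> d)"]) auto
  then have "w (l \<otimes> l \<ominus> d) = 0" using w_nonneg[of "l \<otimes> l \<ominus> d"] l(1) d(1) by simp
  then have "l \<otimes> l \<ominus> d = \<zero>" using w_eq_0_iff l(1) d(1) by simp
  then have "l \<otimes> l = d" using l(1) d(1) by (simp add: minus_eq_zero_iff)
  then show ?thesis using l(1) by blast
qed

end

section \<open>Generators of quadratic extensions\<close>

text \<open>
  The absolute value \<open>v\<close> lives on \<open>K\<close>, regarded as a field with the
  operations of \<open>F\<close>.
\<close>

locale quadratic_extension =
  field F + base: finite_residue_field "F\<lparr>carrier := K\<rparr>" v c for F (structure) and K v c +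
  fixes \<sigma> :: "'a \<Rightarrow> 'a"
  assumes K: "subfield K F"
    and complete: "\<And>s. range s \<subseteq> K \<Longrightarrow>
        \<forall>\<epsilon>>0. \<exists>N::nat. \<forall>i\<ge>N. \<forall>j\<ge>N. v (s i \<ominus>\<^bsub>F\<lparr>carrier := K\<rparr>\<^esub> s j) < \<epsilon> \<Longrightarrow>
        \<exists>l\<in>K. (\<lambda>i. v (s i \<ominus>\<^bsub>F\<lparr>carrier := K\<rparr>\<^esub> l)) \<longlonglongrightarrow> 0"
    and two: "v (\<one> \<oplus> \<one>) = 1"
    and dim: "dimension 2 K (carrier F)"
    and \<sigma>: "nontrivial_automorphism F K \<sigma>"
begin

abbreviation F\<^sub>K where "F\<^sub>K \<equiv> F\<lparr>carrier := K\<rparr>"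

lemma K_carrier: "x \<in> K \<Longrightarrow> x \<in> carrier F"
  using subfieldE(3)[OF K] by blast

text \<open>
  Negation in the record with carrier \<open>K\<close> is defined by a choice within
  \<open>K\<close>, so uniqueness of negatives is needed to identify it with negation in
  \<open>F\<close>.
\<close>

lemma K_minus: "x \<in> K \<Longrightarrow> \<ominus>\<^bsub>F\<^sub>K\<^esub> x = \<ominus> x"
proof -
  assume x: "x \<in> K"
  then have "\<ominus>\<^bsub>F\<^sub>K\<^esub> x \<oplus> x = \<zero>" "\<ominus>\<^bsub>F\<^sub>K\<^esub> x \<in> K"
    using base.l_neg[of x] base.a_inv_closed[of x] by simp_all
  then show ?thesis using minus_equality[of "\<ominus>\<^bsub>F\<^sub>K\<^esub> x" x] x K_carrier by simp
qed

lemma K_closed: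
  "\<zero> \<in> K" "\<one> \<in> K" "x \<in> K \<Longrightarrow> y \<in> K \<Longrightarrow> x \<oplus> y \<in> K" "x \<in> K \<Longrightarrow> y \<in> K \<Longrightarrow> x \<otimes> y \<in> K"
  "x \<in> K \<Longrightarrow> \<ominus> x \<in> K" "x \<in> K \<Longrightarrow> y \<in> K \<Longrightarrow> x \<ominus> y \<in> K"
  using base.zero_closed base.one_closed base.a_closed[of x y] base.m_closed[of x y]
    base.a_inv_closed[of x] base.a_inv_closed[of y] base.a_closed[of x "\<ominus> y"]
  by (simp_all add: K_minus minus_eq)

lemma K_minus_eq: "x \<in> K \<Longrightarrow> y \<in> K \<Longrightarrow> x \<ominus>\<^bsub>F\<^sub>K\<^esub> y = x \<ominus> y"
  by (simp add: a_minus_def K_minus)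

lemma v_nonneg: "x \<in> K \<Longrightarrow> 0 \<le> v x" and v_eq_0_iff: "x \<in> K \<Longrightarrow> v x = 0 \<longleftrightarrow> x = \<zero>"
  and v_mult: "x \<in> K \<Longrightarrow> y \<in> K \<Longrightarrow> v (x \<otimes> y) = v x * v y"
  and v_add: "x \<in> K \<Longrightarrow> y \<in> K \<Longrightarrow> v (x \<oplus> y) \<le> max (v x) (v y)"
  and v_neg: "x \<in> K \<Longrightarrow> v (\<ominus> x) = v x"
  and v_minus_eq_max: "x \<in> K \<Longrightarrow> y \<in> K \<Longrightarrow> v x \<noteq> v y \<Longrightarrow> v (x \<ominus> y) = max (v x) (v y)"
  and v_minus: "x \<in> K \<Longrightarrow> y \<in> K \<Longrightarrow> v (x \<ominus> y) \<le> max (v x) (v y)"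
  using base.w_nonneg[of x] base.w_eq_0_iff[of x] base.w_mult[of x y] base.w_add[of x y] base.w_neg[of x]
    base.w_minus_eq_max[of x y] base.w_minus[of x y]
  by (simp_all add: K_minus K_minus_eq)

lemma v_zero: "v \<zero> = 0" and v_one: "v \<one> = 1"
  using base.w_zero base.w_one by simp_all

lemma v_range: "range (\<lambda>n::int. c powi n) = v ` (K - {\<zero>})"
  using base.w_range by simp

lemma v_powi: "x \<in> K \<Longrightarrow> x \<noteq> \<zero> \<Longrightarrow> \<exists>n::int. v x = c powi n"
  using v_range by (metis DiffI imageI rangeE singletonD)

lemma \<sigma>_hom: "\<sigma> \<in> ring_hom F F" and \<sigma>_K: "x \<in> K \<Longrightarrow> \<sigma> x = x"
  using \<sigma> by (simp_all add: nontrivial_automorphism_def ring_iso_def)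

lemma \<sigma>_closed: "x \<in> carrier F \<Longrightarrow> \<sigma> x \<in> carrier F"
  and \<sigma>_add: "x \<in> carrier F \<Longrightarrow> y \<in> carrier F \<Longrightarrow> \<sigma> (x \<oplus> y) = \<sigma> x \<oplus> \<sigma> y"
  and \<sigma>_mult: "x \<in> carrier F \<Longrightarrow> y \<in> carrier F \<Longrightarrow> \<sigma> (x \<otimes> y) = \<sigma> x \<otimes> \<sigma> y"
  using ring_hom_closed[OF \<sigma>_hom] ring_hom_add[OF \<sigma>_hom] ring_hom_mult[OF \<sigma>_hom] by auto

lemma \<sigma>_neg: "x \<in> carrier F \<Longrightarrow> \<sigma> (\<ominus> x) = \<ominus> \<sigma> x"
proof -
  assume x: "x \<in> carrier F"
  have "\<sigma> (\<ominus> x) \<oplus> \<sigma> x = \<sigma> \<zero>" using \<sigma>_add[of "\<ominus> x" x] x by (simp add: l_neg)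
  also have "\<sigma> \<zero> = \<zero>" using \<sigma>_K K_closed by simp
  finally show ?thesis using minus_equality[of "\<sigma> (\<ominus> x)" "\<sigma> x"] x \<sigma>_closed by simp
qed

lemma \<sigma>_minus: "x \<in> carrier F \<Longrightarrow> y \<in> carrier F \<Longrightarrow> \<sigma> (x \<ominus> y) = \<sigma> x \<ominus> \<sigma> y"
  by (simp add: minus_eq \<sigma>_add \<sigma>_neg)

lemma two_nonzero: "\<one> \<oplus> \<one> \<noteq> \<zero>" using two v_zero by auto

lemma double_zero: "x \<in> carrier F \<Longrightarrow> x \<oplus> x = \<zero> \<Longrightarrow> x = \<zero>"
proof -
  assume x: "x \<in> carrier F" "x \<oplus> x = \<zero>"
  then have "(\<one> \<oplus> \<one>) \<otimes> x = \<zero>" by (simp add: l_distr)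
  then show ?thesis using integral[of "\<one> \<oplus> \<one>" x] x two_nonzero by auto
qed

lemma basis_over_K:
  assumes x: "x \<in> carrier F" "x \<notin> K" and y: "y \<in> carrier F"
  shows "\<exists>a\<in>K. \<exists>b\<in>K. y = a \<oplus> b \<otimes> x"
proof -
  have S1: "Span K [\<one>] \<subseteq> K"
  proof
    fix z assume "z \<in> Span K [\<one>]"
    then obtain k where "k \<in> K" "z = k \<otimes> \<one> \<oplus> \<zero>" by (auto simp: line_extension_mem_iff)
    then show "z \<in> K" using K_carrier by simp
  qed
  have "independent K [\<one>]" by (rule li_Cons) auto
  then have "independent K [x, \<one>]" using x S1 by (intro li_Cons) auto
  moreover have "set [x, \<one>] \<subseteq> carrier F" using x by simp
  ultimately have "Span K [x, \<one>] = carrier F"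
    using independent_length_eq_dimension[OF K dim, of "[x, \<one>]"] by simp
  then have "y \<in> line_extension K x (Span K [\<one>])" using y by simp
  then obtain b a where "b \<in> K" "a \<in> Span K [\<one>]" "y = b \<otimes> x \<oplus> a"
    unfolding line_extension_mem_iff by blast
  then show ?thesis using S1 K_carrier x a_comm by (metis m_closed subsetD)
qed

text \<open>
  If \<open>\<sigma>\<close> moves \<open>x\<close>, then \<open>x\<close> and \<open>y =
  \<sigma> x\<close> are the two roots of one quadratic polynomial over \<open>K\<close>.
  Hence \<open>x + y\<close> lies in \<open>K\<close>, so \<open>\<sigma>\<close> exchanges
  \<open>x\<close> and \<open>y\<close> and negates \<open>x - y\<close>.
\<close>

lemma imaginary_exists: "\<exists>\<theta>\<in>carrier F. \<theta> \<noteq> \<zero> \<and> \<sigma> \<theta> = \<ominus> \<theta>"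
proof -
  obtain x where x: "x \<in> carrier F" "\<sigma> x \<noteq> x"
    using \<sigma> by (auto simp: nontrivial_automorphism_def)
  then have "x \<notin> K" using \<sigma>_K by auto
  then obtain t s where st: "t \<in> K" "s \<in> K" "x \<otimes> x = t \<oplus> s \<otimes> x"
    using basis_over_K[OF x(1), of "x \<otimes> x"] x(1) by auto
  define y where "y = \<sigma> x"
  have y: "y \<in> carrier F" using x \<sigma>_closed by (simp add: y_def)
  note stc = K_carrier[OF st(1)] K_carrier[OF st(2)]
  have yy: "y \<otimes> y = t \<oplus> s \<otimes> y"
    using \<sigma>_mult[OF x(1) x(1)] st \<sigma>_add[of t "s \<otimes> x"] \<sigma>_mult[of s x] \<sigma>_K x(1) stc by (simp add: y_def)
  have "(x \<ominus> y) \<otimes> (x \<oplus> y \<ominus> s) = (x \<otimes> x \<ominus> s \<otimes> x) \<ominus> (y \<otimes> y \<ominus> s \<otimes> y)"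
    using x(1) y stc by algebra
  also have "\<dots> = \<zero>" unfolding st(3) yy using x(1) y stc by algebra
  finally have "x \<oplus> y \<ominus> s = \<zero>"
    using integral[of "x \<ominus> y" "x \<oplus> y \<ominus> s"] x y stc minus_eq_zero_iff[of x y] by (auto simp: y_def)
  then have s: "x \<oplus> y = s" using x y stc by (simp add: minus_eq_zero_iff)
  have "\<sigma> s = s" using \<sigma>_K st by simp
  then have "\<sigma> x \<oplus> \<sigma> y = s" using \<sigma>_add[OF x(1) y] s by simp
  then have "y \<oplus> \<sigma> y = x \<oplus> y" using s by (simp add: y_def)
  then have \<sigma>y: "\<sigma> y = x" using x(1) y \<sigma>_closed by (simp add: a_comm[of x y])
  have "\<sigma> (x \<ominus> y) = y \<ominus> x" using \<sigma>_minus[OF x(1) y] \<sigma>y by (simp add: y_def)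
  also have "\<dots> = \<ominus> (x \<ominus> y)" using x(1) y by algebra
  finally have "\<sigma> (x \<ominus> y) = \<ominus> (x \<ominus> y)" .
  moreover have "x \<ominus> y \<noteq> \<zero>" using x y by (simp add: minus_eq_zero_iff y_def)
  ultimately show ?thesis using x(1) y by blast
qed

lemma imaginary_notin_K:
  assumes "\<theta> \<in> carrier F" "\<theta> \<noteq> \<zero>" "\<sigma> \<theta> = \<ominus> \<theta>"
  shows "\<theta> \<notin> K"
proof
  assume "\<theta> \<in> K"
  then have "\<theta> = \<ominus> \<theta>" using \<sigma>_K assms by simp
  then have "\<theta> \<oplus> \<theta> = \<zero>" using r_neg[OF assms(1)] by simp
  then show False using double_zero assms by blast
qed

lemma imaginary_square:
  assumes \<theta>: "\<theta> \<in> carrier F" "\<theta> \<noteq> \<zero>" "\<sigma> \<theta> = \<ominus> \<theta>"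
  shows "\<theta> \<otimes> \<theta> \<in> K"
proof -
  obtain a b where ab: "a \<in> K" "b \<in> K" "\<theta> \<otimes> \<theta> = a \<oplus> b \<otimes> \<theta>"
    using basis_over_K[OF \<theta>(1) imaginary_notin_K[OF \<theta>], of "\<theta> \<otimes> \<theta>"] \<theta>(1) by auto
  note abc = K_carrier[OF ab(1)] K_carrier[OF ab(2)]
  have "\<sigma> (\<theta> \<otimes> \<theta>) = a \<ominus> b \<otimes> \<theta>"
    unfolding ab(3) using \<sigma>_add[of a "b \<otimes> \<theta>"] \<sigma>_mult[of b \<theta>] \<sigma>_K ab \<theta> abc by (simp add: minus_eq r_minus)
  moreover have "\<sigma> (\<theta> \<otimes> \<theta>) = \<theta> \<otimes> \<theta>"
    using \<sigma>_mult[OF \<theta>(1) \<theta>(1)] \<theta> by (simp add: l_minus r_minus)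
  ultimately have e: "a \<oplus> b \<otimes> \<theta> = a \<ominus> b \<otimes> \<theta>" using ab(3) by simp
  have "b \<otimes> \<theta> \<oplus> b \<otimes> \<theta> = (a \<oplus> b \<otimes> \<theta>) \<ominus> (a \<ominus> b \<otimes> \<theta>)" using abc \<theta>(1) by algebra
  also have "\<dots> = \<zero>" unfolding e using abc \<theta>(1) by algebra
  finally have "b \<otimes> \<theta> = \<zero>" using double_zero[of "b \<otimes> \<theta>"] abc \<theta>(1) by simp
  then show ?thesis using ab abc by simp
qed

text \<open>
  Multiplication of \<open>\<theta>\<close> by an element of \<open>K\<close> shifts the
  exponent of the absolute value of \<open>\<theta>\<^sup>2\<close> by an even number.
\<close>

lemma generator_exists:
  "\<exists>\<theta>\<in>carrier F. \<theta> \<noteq> \<zero> \<and> \<sigma> \<theta> = \<ominus> \<theta> \<and> (v (\<theta> \<otimes> \<theta>) = 1 \<or> v (\<theta> \<otimes> \<theta>) = c)"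
proof -
  obtain \<theta> where \<theta>: "\<theta> \<in> carrier F" "\<theta> \<noteq> \<zero>" "\<sigma> \<theta> = \<ominus> \<theta>" using imaginary_exists by blast
  note d = imaginary_square[OF \<theta>]
  have d0: "\<theta> \<otimes> \<theta> \<noteq> \<zero>" using integral[of \<theta> \<theta>] \<theta> by auto
  obtain n :: int where n: "v (\<theta> \<otimes> \<theta>) = c powi n" using v_powi[OF d d0] by blast
  have "c powi (- (n div 2)) \<in> v ` (K - {\<zero>})" using v_range by blast
  then obtain k where "c powi (- (n div 2)) = v k" "k \<in> K - {\<zero>}" by (rule imageE)
  then have k: "k \<in> K" "k \<noteq> \<zero>" "v k = c powi (- (n div 2))" by simp_all
  note kc = K_carrier[OF k(1)]
  define \<eta> where "\<eta> = k \<otimes> \<theta>"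
  have "\<eta> \<in> carrier F" using kc \<theta> by (simp add: \<eta>_def)
  moreover have "\<eta> \<noteq> \<zero>" using integral[of k \<theta>] kc k \<theta> by (auto simp: \<eta>_def)
  moreover have "\<sigma> \<eta> = \<ominus> \<eta>" using \<sigma>_mult[OF kc \<theta>(1)] \<sigma>_K[OF k(1)] \<theta> kc by (simp add: \<eta>_def r_minus)
  moreover have "v (\<eta> \<otimes> \<eta>) = c powi (- (n div 2) + - (n div 2) + n)"
  proof -
    have "\<eta> \<otimes> \<eta> = (k \<otimes> k) \<otimes> (\<theta> \<otimes> \<theta>)" using kc \<theta>(1) unfolding \<eta>_def by algebra
    then have "v (\<eta> \<otimes> \<eta>) = v k * v k * v (\<theta> \<otimes> \<theta>)" using v_mult k K_closed d by simp
    then show ?thesis unfolding k(3) n by (simp only: powi_add[OF base.c(1)])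
  qed
  moreover have "- (n div 2) + - (n div 2) + n = 0 \<or> - (n div 2) + - (n div 2) + n = 1" by presburger
  ultimately show ?thesis by (metis power_int_0_right power_int_1_right)
qed

text \<open>
  If \<open>\<theta>\<^sup>2\<close> were a square modulo \<open>p\<close>, Hensel's lemma would give a square root of \<open>\<theta>\<^sup>2\<close> in
  \<open>K\<close>, which is \<open>\<theta>\<close> or \<open>-\<theta>\<close>.
\<close>

lemma nonresidue:
  assumes \<theta>: "\<theta> \<in> carrier F" "\<theta> \<noteq> \<zero>" "\<sigma> \<theta> = \<ominus> \<theta>" "v (\<theta> \<otimes> \<theta>) = 1" and s: "s \<in> K"
  shows "\<not> v (s \<otimes> s \<ominus> \<theta> \<otimes> \<theta>) < 1"
proof
  assume "v (s \<otimes> s \<ominus> \<theta> \<otimes> \<theta>) < 1"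
  note d = imaginary_square[OF \<theta>(1-3)]
  have "\<exists>t\<in>carrier F\<^sub>K. t \<otimes>\<^bsub>F\<^sub>K\<^esub> t = \<theta> \<otimes> \<theta>"
  proof (rule base.hensel_square)
    show "v (s \<otimes>\<^bsub>F\<^sub>K\<^esub> s \<ominus>\<^bsub>F\<^sub>K\<^esub> \<theta> \<otimes> \<theta>) < 1"
      using \<open>v (s \<otimes> s \<ominus> \<theta> \<otimes> \<theta>) < 1\<close> K_minus_eq[of "s \<otimes> s" "\<theta> \<otimes> \<theta>"] K_closed(4)[OF s s] d by simp
  qed (use complete two d s \<theta> in simp_all)
  then obtain t where t: "t \<in> K" "t \<otimes> t = \<theta> \<otimes> \<theta>" by auto
  note tc = K_carrier[OF t(1)]
  have "(\<theta> \<ominus> t) \<otimes> (\<theta> \<oplus> t) = \<theta> \<otimes> \<theta> \<ominus> t \<otimes> t" using tc \<theta>(1) by algebra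
  then have "(\<theta> \<ominus> t) \<otimes> (\<theta> \<oplus> t) = \<zero>" using t(2) \<theta>(1) by (simp add: minus_eq r_neg)
  then have "\<theta> \<ominus> t = \<zero> \<or> \<theta> \<oplus> t = \<zero>"
    using integral[of "\<theta> \<ominus> t" "\<theta> \<oplus> t"] tc \<theta>(1) by blast
  then have "\<theta> = t \<or> \<theta> = \<ominus> t"
    using tc \<theta>(1) minus_eq_zero_iff[of \<theta> t] minus_equality[of \<theta> t] by auto
  then show False using imaginary_notin_K[OF \<theta>(1-3)] t(1) K_closed by auto
qed

end

section \<open>The absolute value of a quadratic extension\<close>

text \<open>
  The extension is unramified if \<open>\<theta>\<^sup>2\<close> is a unit, and ramified if
  \<open>\<theta>\<^sup>2\<close> is a prime element (\<open>unramified_iff\<close>).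
\<close>

locale quadratic_generator = quadratic_extension +
  fixes \<theta> :: 'a
  assumes \<theta>: "\<theta> \<in> carrier F" "\<theta> \<noteq> \<zero>" "\<sigma> \<theta> = \<ominus> \<theta>"
    and v_\<theta>: "v (\<theta> \<otimes> \<theta>) = 1 \<or> v (\<theta> \<otimes> \<theta>) = c"
begin

definition d where "d = \<theta> \<otimes> \<theta>"
definition \<mu> where "\<mu> = sqrt (v d)"
text \<open>
  The absolute value of \<open>F\<close> that extends \<open>v\<close>, defined by the norm.
\<close>

definition w where "w x = sqrt (v (x \<otimes> \<sigma> x))"
definition c\<^sub>F where "c\<^sub>F = (if v d = 1 then c else sqrt c)"

lemma d: "d \<in> K" "v d = 1 \<or> v d = c"
  using imaginary_square[OF \<theta>] v_\<theta> by (simp_all add: d_def)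

lemma \<mu>: "\<mu> > 0" "\<mu> * \<mu> = v d" "v d = 1 \<Longrightarrow> \<mu> = 1"
  using d(2) base.c by (auto simp: \<mu>_def)

lemma c\<^sub>F: "0 < c\<^sub>F" "c\<^sub>F < 1" using base.c by (simp_all add: c\<^sub>F_def)

lemma coordinates: "x \<in> carrier F \<Longrightarrow> \<exists>a\<in>K. \<exists>b\<in>K. x = a \<oplus> b \<otimes> \<theta>"
  using basis_over_K[OF \<theta>(1) imaginary_notin_K[OF \<theta>]] .

lemma \<sigma>_coordinates: "a \<in> K \<Longrightarrow> b \<in> K \<Longrightarrow> \<sigma> (a \<oplus> b \<otimes> \<theta>) = a \<ominus> b \<otimes> \<theta>"
  using \<sigma>_add[of a "b \<otimes> \<theta>"] \<sigma>_mult[of b \<theta>] \<sigma>_K[of a] \<sigma>_K[of b] \<theta> K_carrier by (simp add: minus_eq r_minus)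

lemma norm_coordinates:
  assumes "a \<in> K" "b \<in> K"
  shows "(a \<oplus> b \<otimes> \<theta>) \<otimes> \<sigma> (a \<oplus> b \<otimes> \<theta>) = a \<otimes> a \<ominus> b \<otimes> b \<otimes> d"
  unfolding \<sigma>_coordinates[OF assms] d_def
  using K_carrier[OF assms(1)] K_carrier[OF assms(2)] \<theta>(1) by algebra

text \<open>
  Only the case that both terms have the same absolute value is critical. For a prime element
  \<open>d\<close> the exponents of the two terms have different parity. For a unit
  \<open>d\<close> divide by \<open>b\<^sup>2\<close>; the claim is then that \<open>d\<close>
  is not a square in the residue field.
\<close>

lemma v_norm:
  assumes ab: "a \<in> K" "b \<in> K"
  shows "v (a \<otimes> a \<ominus> b \<otimes> b \<otimes> d) = max (v a * v a) (v b * v b * v d)"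
proof (cases "v a * v a = v b * v b * v d")
  case False
  have "v (a \<otimes> a \<ominus> b \<otimes> b \<otimes> d) = max (v (a \<otimes> a)) (v (b \<otimes> b \<otimes> d))"
    using False ab d K_closed by (intro v_minus_eq_max) (simp_all add: v_mult)
  then show ?thesis using ab d K_closed by (simp add: v_mult)
next
  case True
  show ?thesis
  proof (cases "b = \<zero>")
    case True
    then have "a \<otimes> a \<ominus> b \<otimes> b \<otimes> d = a \<otimes> a" using ab d K_carrier by (simp add: minus_eq)
    then show ?thesis using True ab v_zero v_nonneg by (simp add: v_mult)
  next
    case b0: False
    have a0: "a \<noteq> \<zero>"
    proof
      assume "a = \<zero>"
      then have "v b * v b * v d = 0" using True v_zero by simp
      moreover have "v d \<noteq> 0" using d(2) base.c by auto
      ultimately have "v b = 0" by simp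
      then show False using v_eq_0_iff[OF ab(2)] b0 by simp
    qed
    obtain i j :: int where ij: "v a = c powi i" "v b = c powi j"
      using v_powi[OF ab(1) a0] v_powi[OF ab(2) b0] by blast
    have vd: "v d = 1"
    proof (rule ccontr)
      assume "v d \<noteq> 1"
      then have "c powi (i + i) = c powi (j + j + 1)"
        unfolding powi_add[OF base.c(1)] using True d(2) ij by simp
      then have "i + i = j + j + 1"
        using powi_le_iff[OF base.c, of "i + i" "j + j + 1"] powi_le_iff[OF base.c, of "j + j + 1" "i + i"] by simp
      then show False by presburger
    qed
    define b' where "b' = inv b"
    have b': "b' \<in> K" "b \<otimes> b' = \<one>"
      using subfield_m_inv[OF K, of b] ab b0 by (auto simp: b'_def)
    note cs = K_carrier[OF ab(1)] K_carrier[OF ab(2)] K_carrier[OF b'(1)] K_carrier[OF d(1)]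
    have s: "a \<otimes> b' \<in> K" using ab b' K_closed by simp
    have eq: "a \<otimes> a \<ominus> b \<otimes> b \<otimes> d = (b \<otimes> b) \<otimes> ((a \<otimes> b') \<otimes> (a \<otimes> b') \<ominus> d)"
    proof -
      have "(b \<otimes> b) \<otimes> ((a \<otimes> b') \<otimes> (a \<otimes> b') \<ominus> d) = (b \<otimes> b') \<otimes> (b \<otimes> b') \<otimes> (a \<otimes> a) \<ominus> b \<otimes> b \<otimes> d"
        using cs by algebra
      then show ?thesis unfolding b'(2) using cs by simp
    qed
    have "v a * v a = v b * v b" using True vd by simp
    then have vab: "v a = v b" using v_nonneg ab by (metis abs_of_nonneg abs_mult_self_eq real_sqrt_abs2)
    have "v b * v b' = 1" using v_mult[of b b'] ab b' v_one by simp
    then have vs: "v (a \<otimes> b') = 1" using v_mult[of a b'] ab b' vab by simp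
    have "v ((a \<otimes> b') \<otimes> (a \<otimes> b') \<ominus> d) \<le> 1"
      using v_minus[of "(a \<otimes> b') \<otimes> (a \<otimes> b')" d] s vs vd d K_closed by (simp add: v_mult)
    moreover have "\<not> v ((a \<otimes> b') \<otimes> (a \<otimes> b') \<ominus> d) < 1"
      using nonresidue[OF \<theta> _ s] vd by (simp add: d_def)
    ultimately have "v ((a \<otimes> b') \<otimes> (a \<otimes> b') \<ominus> d) = 1" by simp
    then have "v (a \<otimes> a \<ominus> b \<otimes> b \<otimes> d) = v b * v b"
      unfolding eq using ab s d K_closed by (simp add: v_mult)
    then show ?thesis using True vd by simp
  qed
qed

lemma w_coordinates:
  assumes ab: "a \<in> K" "b \<in> K"
  shows "w (a \<oplus> b \<otimes> \<theta>) = max (v a) (v b * \<mu>)"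
proof -
  have "w (a \<oplus> b \<otimes> \<theta>) = sqrt (max (v a * v a) (v b * v b * v d))"
    by (simp add: w_def norm_coordinates[OF ab] v_norm[OF ab])
  also have "\<dots> = max (sqrt (v a * v a)) (sqrt (v b * v b * v d))"
    by (rule max_of_mono[symmetric]) (simp add: mono_def)
  also have "\<dots> = max (v a) (v b * \<mu>)"
    using v_nonneg[OF ab(1)] v_nonneg[OF ab(2)] by (simp add: real_sqrt_mult \<mu>_def)
  finally show ?thesis .
qed

lemma w_K: "a \<in> K \<Longrightarrow> w a = v a" and w_K\<theta>: "b \<in> K \<Longrightarrow> w (b \<otimes> \<theta>) = v b * \<mu>"
  using w_coordinates[of a \<zero>] w_coordinates[of \<zero> b] K_closed K_carrier \<theta> v_zero v_nonneg \<mu> by simp_all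

lemma norm_K: "x \<in> carrier F \<Longrightarrow> x \<otimes> \<sigma> x \<in> K"
  using coordinates[of x] norm_coordinates d K_closed by auto

lemma \<sigma>_\<sigma>: "x \<in> carrier F \<Longrightarrow> \<sigma> (\<sigma> x) = x"
proof -
  assume "x \<in> carrier F"
  then obtain a b where ab: "a \<in> K" "b \<in> K" "x = a \<oplus> b \<otimes> \<theta>" using coordinates by blast
  have "\<sigma> (\<sigma> x) = \<sigma> (a \<oplus> (\<ominus> b) \<otimes> \<theta>)"
    unfolding ab(3) \<sigma>_coordinates[OF ab(1,2)] using ab K_carrier \<theta> by (simp add: minus_eq l_minus)
  also have "\<dots> = a \<ominus> (\<ominus> b) \<otimes> \<theta>" using \<sigma>_coordinates[of a "\<ominus> b"] ab K_closed by simp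
  also have "\<dots> = x" unfolding ab(3) using K_carrier[OF ab(1)] K_carrier[OF ab(2)] \<theta>(1) by algebra
  finally show ?thesis .
qed

lemma w_\<sigma>: "x \<in> carrier F \<Longrightarrow> w (\<sigma> x) = w x"
  using \<sigma>_\<sigma> \<sigma>_closed by (simp add: w_def m_comm)

lemma c_powi: "v d \<noteq> 1 \<Longrightarrow> c powi n = c\<^sub>F powi (2 * n)" "v d \<noteq> 1 \<Longrightarrow> \<mu> = c\<^sub>F"
  using base.c d(2) by (simp_all add: c\<^sub>F_def power_int_mult \<mu>_def)

lemma c\<^sub>F_unit: "v d = 1 \<Longrightarrow> c\<^sub>F = c" by (simp add: c\<^sub>F_def)

lemma discrete_valued_field: "discrete_valued_field F w c\<^sub>F"
proof (intro discrete_valued_field.intro field_axioms discrete_valued_field_axioms.intro)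
  show "0 < c\<^sub>F" "c\<^sub>F < 1" by (rule c\<^sub>F)+
  show "w ` (carrier F - {\<zero>}) = range (\<lambda>n::int. c\<^sub>F powi n)"
  proof
    show "w ` (carrier F - {\<zero>}) \<subseteq> range (\<lambda>n::int. c\<^sub>F powi n)"
    proof
      fix z assume "z \<in> w ` (carrier F - {\<zero>})"
      then obtain x where x: "x \<in> carrier F" "x \<noteq> \<zero>" "z = w x" by auto
      obtain a b where ab: "a \<in> K" "b \<in> K" "x = a \<oplus> b \<otimes> \<theta>" using coordinates[OF x(1)] by blast
      have "z \<noteq> 0"
      proof
        assume "z = 0"
        then have "v a \<le> 0" "v b * \<mu> \<le> 0" using x(3) ab w_coordinates by auto
        then have "v a = 0" "v b = 0"
          using v_nonneg[OF ab(1)] v_nonneg[OF ab(2)] \<mu>(1) by (auto simp: mult_le_0_iff)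
        then show False using x(2) ab v_eq_0_iff \<theta> by simp
      qed
      have A: "\<exists>n::int. v a = c\<^sub>F powi n" if a: "a \<in> K" "v a \<noteq> 0" for a
      proof -
        have "a \<noteq> \<zero>" using a(2) v_zero by auto
        then obtain n :: int where "v a = c powi n" using v_powi[OF a(1)] by blast
        then show ?thesis using c\<^sub>F_unit c_powi(1) by (cases "v d = 1") auto
      qed
      have "z = v a \<or> z = v b * \<mu>" using x(3) ab w_coordinates by (simp add: max_def)
      then show "z \<in> range (\<lambda>n::int. c\<^sub>F powi n)"
      proof
        assume "z = v a"
        then show ?thesis using A[OF ab(1)] \<open>z \<noteq> 0\<close> by auto
      next
        assume z: "z = v b * \<mu>"
        then obtain n :: int where n: "v b = c\<^sub>F powi n" using A[OF ab(2)] \<open>z \<noteq> 0\<close> by auto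
        show ?thesis
        proof (cases "v d = 1")
          case True then show ?thesis using z n \<mu>(3) by auto
        next
          case False
          then have "z = c\<^sub>F powi (n + 1)" using z n c_powi(2) c\<^sub>F by (simp add: power_int_add)
          then show ?thesis by blast
        qed
      qed
    qed
    show "range (\<lambda>n::int. c\<^sub>F powi n) \<subseteq> w ` (carrier F - {\<zero>})"
    proof
      fix z assume "z \<in> range (\<lambda>n::int. c\<^sub>F powi n)"
      then obtain n :: int where n: "z = c\<^sub>F powi n" by auto
      have A: "\<exists>a\<in>K - {\<zero>}. v a = c powi k" for k :: int
        using v_range by (metis (mono_tags, lifting) imageE rangeI)
      show "z \<in> w ` (carrier F - {\<zero>})"
      proof (cases "v d = 1 \<or> even n")
        case True
        then have "\<exists>k::int. z = c powi k"
        proof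
          assume "v d = 1" then show ?thesis using n c\<^sub>F_unit by auto
        next
          assume "even n"
          then obtain k where "n = 2 * k" by (elim evenE)
          then have "z = c powi k \<or> z = c powi n" using n c_powi(1)[of k] c\<^sub>F_unit by (cases "v d = 1") simp_all
          then show ?thesis by blast
        qed
        then obtain a where "a \<in> K - {\<zero>}" "v a = z" using A by metis
        then show ?thesis using w_K K_carrier by (intro image_eqI[of _ _ a]) auto
      next
        case False
        then obtain k where k: "n = 2 * k + 1" by (meson oddE)
        obtain b where b: "b \<in> K" "b \<noteq> \<zero>" "v b = c powi k" using A[of k] by auto
        have "w (b \<otimes> \<theta>) = z"
          using w_K\<theta>[OF b(1)] b(3) n k c_powi False c\<^sub>F by (simp add: power_int_add)
        moreover have "b \<otimes> \<theta> \<noteq> \<zero>" using integral[of b \<theta>] b K_carrier \<theta> by auto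
        ultimately show ?thesis using b K_carrier \<theta> by (intro image_eqI[of _ _ "b \<otimes> \<theta>"]) auto
      qed
    qed
  qed
next
  fix x assume x: "x \<in> carrier F"
  obtain a b where ab: "a \<in> K" "b \<in> K" "x = a \<oplus> b \<otimes> \<theta>" using coordinates[OF x] by blast
  show "0 \<le> w x" using v_nonneg[OF norm_K[OF x]] by (simp add: w_def)
  show "w x = 0 \<longleftrightarrow> x = \<zero>"
  proof
    assume "w x = 0"
    then have "x \<otimes> \<sigma> x = \<zero>" using v_eq_0_iff[OF norm_K[OF x]] by (simp add: w_def)
    then have "x = \<zero> \<or> \<sigma> x = \<zero>" using integral x \<sigma>_closed by blast
    then show "x = \<zero>" using \<sigma>_\<sigma>[OF x] \<sigma>_K[of \<zero>] K_closed by auto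
  next
    assume "x = \<zero>" then show "w x = 0" using w_K[of \<zero>] K_closed v_zero by simp
  qed
  fix y assume y: "y \<in> carrier F"
  obtain a' b' where ab': "a' \<in> K" "b' \<in> K" "y = a' \<oplus> b' \<otimes> \<theta>" using coordinates[OF y] by blast
  have "x \<otimes> y \<otimes> \<sigma> (x \<otimes> y) = (x \<otimes> \<sigma> x) \<otimes> (y \<otimes> \<sigma> y)"
    unfolding \<sigma>_mult[OF x y] using x y \<sigma>_closed[OF x] \<sigma>_closed[OF y] by algebra
  then show "w (x \<otimes> y) = w x * w y"
    using v_mult[OF norm_K[OF x] norm_K[OF y]] by (simp add: w_def real_sqrt_mult)
  have xy: "x \<oplus> y = (a \<oplus> a') \<oplus> (b \<oplus> b') \<otimes> \<theta>"
    unfolding ab(3) ab'(3)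
    using K_carrier[OF ab(1)] K_carrier[OF ab(2)] K_carrier[OF ab'(1)] K_carrier[OF ab'(2)] \<theta>(1) by algebra
  have "v (b \<oplus> b') * \<mu> \<le> max (v b) (v b') * \<mu>"
    using v_add[OF ab(2) ab'(2)] \<mu>(1) by (intro mult_right_mono) auto
  also have "\<dots> = max (v b * \<mu>) (v b' * \<mu>)" using \<mu>(1) by (simp add: max_mult_distrib_right)
  finally show "w (x \<oplus> y) \<le> max (w x) (w y)"
    using v_add[OF ab(1) ab'(1)] w_coordinates[OF ab(1,2)] w_coordinates[OF ab'(1,2)]
      w_coordinates[of "a \<oplus> a'" "b \<oplus> b'"] ab ab' K_closed xy by auto
qed

end

section \<open>Orthogonal groups over quotients of the ring of integers\<close>

context discrete_valued_field
begin

text \<open>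
  If \<open>2\<close> were not a unit, then \<open>1\<close> would have additive order
  \<open>2\<close> in the residue field.
\<close>

lemma two_unit:
  assumes odd: "odd (ring_char (An 1))"
  shows "w (\<one> \<oplus> \<one>) = 1"
proof (rule ccontr)
  assume not1: "w (\<one> \<oplus> \<one>) \<noteq> 1"
  interpret A: cring "An 1" by (rule cring_An)
  have P0: "\<one> \<in> Pn 0" by (rule one_Pn_0)
  have "w (\<one> \<oplus> \<one>) \<le> 1" using w_add[of \<one> \<one>] w_one by simp
  then have "w (\<one> \<oplus> \<one>) < 1" using not1 by simp
  then have "\<one> \<oplus> \<one> \<in> Pn 1" using w_less_one[of "\<one> \<oplus> \<one>"] by (simp add: Pn_def)
  then have "cls 1 (\<one> \<oplus> \<one>) = \<zero>\<^bsub>An 1\<^esub>" using cls_eq_zero_iff by blast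
  then have "\<one>\<^bsub>An 1\<^esub> \<oplus>\<^bsub>An 1\<^esub> \<one>\<^bsub>An 1\<^esub> = \<zero>\<^bsub>An 1\<^esub>"
    using cls_simps(2)[OF P0 P0, of 1] cls_simps(4)[OF P0 P0, of 1] by metis
  then have "\<one>\<^bsub>An 1\<^esub> [^]\<^bsub>add_monoid (An 1)\<^esub> (2::nat) = \<one>\<^bsub>add_monoid (An 1)\<^esub>"
    using A.one_closed by (simp add: numeral_2_eq_2 del: One_nat_def)
  then have "ring_char (An 1) dvd 2"
    unfolding ring_char_def using group.pow_eq_id[OF A.a_group, of "\<one>\<^bsub>An 1\<^esub>" 2] A.one_closed by simp
  then have "ring_char (An 1) \<le> 2" by (rule dvd_imp_le) simp
  moreover have "n = 1" if "odd n" "n \<le> 2" for n :: nat using that by presburger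
  ultimately have "group.ord (add_monoid (An 1)) \<one>\<^bsub>An 1\<^esub> = 1"
    using odd unfolding ring_char_def by blast
  then have "\<one>\<^bsub>An 1\<^esub> = \<zero>\<^bsub>An 1\<^esub>"
    using group.ord_eq_1[OF A.a_group, of "\<one>\<^bsub>An 1\<^esub>"] A.one_closed by simp
  then have "\<one> \<in> Pn 1" using cls_eq_zero_iff[of \<one> 1] cls_simps(4)[OF P0 P0, of 1] by simp
  then show False using one_notin_Pn[of 1] by simp
qed

end

context finite_residue_field
begin

lemma finite_An: "finite (carrier (An e))"
proof -
  have "finite (cls e ` Pn 0)"
    using card_image_Pn[of 0 e "cls e"] cls_eq_iff Pn_carrier by simp
  then show ?thesis by (simp add: carrier_An)
qed

text \<open>
  With the trivial involution only \<open>0\<close> is skew, as \<open>2\<close> is a unit.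
\<close>

theorem order_orthogonal_group_quotient:
  fixes V :: "('a set, 'v, 'z) module_scheme"
  assumes two: "w (\<one> \<oplus> \<one>) = 1" and e: "e \<ge> 1" and r: "maximalideal r (An e)"
    and V: "module (An e) V" "free_of_rank (An e) V m"
    and h: "hermitian_form (An e) (\<lambda>a. a) V h" "nondegenerate (An e) V h"
  shows "order (unitary_group (An e) V h)
    = Q ^ ((e - 1) * (m * (m - 1) div 2)) * order (reduced_unitary_group (An e) r V h)"
proof -
  have "{x \<in> Pn 1. x \<oplus> x \<in> Pn e} = Pn e"
  proof -
    have "w (x \<oplus> x) = w x" if "x \<in> carrier L" for x
    proof -
      have "x \<oplus> x = (\<one> \<oplus> \<one>) \<otimes> x" using that by algebra
      then show ?thesis using w_mult[of "\<one> \<oplus> \<one>" x] that two by simp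
    qed
    then show ?thesis using Pn_antimono[OF e] by (auto simp: Pn_def)
  qed
  moreover have "cls e ` Pn e = {cls e \<zero>}"
    using cls_eq_iff[of _ \<zero> e] Pn_carrier Pn_closed(1)[of e] Pn_closed(3)[OF _ Pn_closed(1)] by blast
  ultimately have k: "card (cls e ` {x \<in> Pn 1. x \<oplus> x \<in> Pn e}) = 1" by simp
  have "{x \<in> Pn 1. x \<ominus> x \<in> Pn e} = Pn 1"
    using Pn_closed(1)[of e] Pn_carrier by (auto simp: minus_eq r_neg)
  then have s: "card (cls e ` {x \<in> Pn 1. x \<ominus> x \<in> Pn e}) = Q ^ (e - 1)"
    using card_image_Pn[OF e, of "cls e"] cls_eq_iff Pn_carrier by simp
  have "order (unitary_group (An e) V h)
    = card (cls e ` {x \<in> Pn 1. x \<oplus> x \<in> Pn e}) ^ m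
      * (card (cls e ` {x \<in> Pn 1. x \<ominus> x \<in> Pn e}) * card (cls e ` {x \<in> Pn 1. x \<oplus> x \<in> Pn e})) ^ (m * (m - 1) div 2)
      * order (reduced_unitary_group (An e) r V h)"
    by (rule order_unitary_group_quotient[OF two e finite_An, where \<sigma> = "\<lambda>x. x"])
       (use r V h in simp_all)
  then show ?thesis unfolding k s by (simp add: power_mult)
qed

end

section \<open>Symmetric and skew classes, integral closure and ramification\<close>

context quadratic_generator
begin

sublocale D: discrete_valued_field F w c\<^sub>F
  by (rule discrete_valued_field)

text \<open>
  The exponents for which \<open>P\<^sup>n\<close> meets \<open>K\<close> in
  \<open>p\<^bsup>plus_level n\<^esup>\<close>, and \<open>K\<theta>\<close> in
  \<open>p\<^bsup>minus_level n\<^esup>\<theta>\<close>. In the ramified case \<open>p =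
  P\<^sup>2\<close> on \<open>K\<close>, so one gets \<open>n/2\<close> and
  \<open>(n-1)/2\<close>, rounded up.
\<close>

definition plus_level where "plus_level n = (if v d = 1 then n else Suc n div 2)"
definition minus_level where "minus_level n = (if v d = 1 then n else n div 2)"

lemma c\<^sub>F_powi_le_iff: "c\<^sub>F powi i \<le> c\<^sub>F ^ n \<longleftrightarrow> int n \<le> i"
  using powi_le_iff[OF c\<^sub>F, of i "int n"] by simp

lemma mem_Pn_K:
  assumes a: "a \<in> K"
  shows "a \<in> D.Pn n \<longleftrightarrow> a \<in> base.Pn (plus_level n)"
proof (cases "v d = 1 \<or> a = \<zero>")
  case True
  then show ?thesis using a w_K K_carrier v_zero base.c c\<^sub>F by (auto simp: D.Pn_def base.Pn_def plus_level_def c\<^sub>F_unit)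
next
  case False
  then obtain k where k: "v a = c powi k" using v_powi[OF a] by auto
  have "a \<in> D.Pn n \<longleftrightarrow> c\<^sub>F powi (2 * k) \<le> c\<^sub>F ^ n"
    using a w_K K_carrier k c_powi(1)[of k] False by (simp add: D.Pn_def)
  also have "\<dots> \<longleftrightarrow> int (Suc n div 2) \<le> k" unfolding c\<^sub>F_powi_le_iff by linarith
  also have "\<dots> \<longleftrightarrow> c powi k \<le> c powi int (Suc n div 2)" by (simp only: powi_le_iff[OF base.c])
  also have "\<dots> \<longleftrightarrow> a \<in> base.Pn (plus_level n)" using a k False by (simp add: base.Pn_def plus_level_def)
  finally show ?thesis .
qed

lemma mem_Pn_K\<theta>:
  assumes b: "b \<in> K"
  shows "b \<otimes> \<theta> \<in> D.Pn n \<longleftrightarrow> b \<in> base.Pn (minus_level n)"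
proof (cases "v d = 1 \<or> b = \<zero>")
  case True
  then show ?thesis using b w_K\<theta> K_carrier v_zero base.c c\<^sub>F \<theta> \<mu>
    by (auto simp: D.Pn_def base.Pn_def minus_level_def c\<^sub>F_unit D.w_zero)
next
  case False
  then obtain k where k: "v b = c powi k" using v_powi[OF b] by auto
  have "c\<^sub>F powi (2 * k + 1) = c\<^sub>F powi (2 * k) * c\<^sub>F" using powi_add[OF c\<^sub>F(1), of "2 * k" 1] by simp
  then have "b \<otimes> \<theta> \<in> D.Pn n \<longleftrightarrow> c\<^sub>F powi (2 * k + 1) \<le> c\<^sub>F ^ n"
    using b w_K\<theta>[OF b] K_carrier \<theta> k c_powi(1)[of k] c_powi(2) False by (simp add: D.Pn_def)
  also have "\<dots> \<longleftrightarrow> int (n div 2) \<le> k" unfolding c\<^sub>F_powi_le_iff by linarith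
  also have "\<dots> \<longleftrightarrow> c powi k \<le> c powi int (n div 2)" by (simp only: powi_le_iff[OF base.c])
  also have "\<dots> \<longleftrightarrow> b \<in> base.Pn (minus_level n)" using b k False by (simp add: base.Pn_def minus_level_def)
  finally show ?thesis .
qed

lemma mem_Pn_coordinates:
  assumes "a \<in> K" "b \<in> K"
  shows "a \<oplus> b \<otimes> \<theta> \<in> D.Pn n \<longleftrightarrow> a \<in> D.Pn n \<and> b \<otimes> \<theta> \<in> D.Pn n"
  using assms K_carrier \<theta> w_coordinates[OF assms] w_K[OF assms(1)] w_K\<theta>[OF assms(2)]
  by (simp add: D.Pn_def)

lemma base_Pn_K: "x \<in> base.Pn n \<Longrightarrow> x \<in> K" by (simp add: base.Pn_def)

lemma card_image_K:
  assumes "plus_level i \<le> plus_level e"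
  shows "card (D.cls e ` base.Pn (plus_level i)) = base.Q ^ (plus_level e - plus_level i) \<and> finite (D.cls e ` base.Pn (plus_level i))"
proof (rule base.card_image_Pn[OF assms])
  fix x y assume xy: "x \<in> base.Pn (plus_level i)" "y \<in> base.Pn (plus_level i)"
  note k = base_Pn_K[OF xy(1)] base_Pn_K[OF xy(2)]
  show "D.cls e x = D.cls e y \<longleftrightarrow> x \<ominus>\<^bsub>F\<^sub>K\<^esub> y \<in> base.Pn (plus_level e)"
    using D.cls_eq_iff[of x y e] k K_carrier mem_Pn_K K_closed(6)[OF k] by (simp add: K_minus_eq)
qed

lemma card_image_K\<theta>:
  assumes "minus_level i \<le> minus_level e"
  shows "card ((\<lambda>b. D.cls e (b \<otimes> \<theta>)) ` base.Pn (minus_level i)) = base.Q ^ (minus_level e - minus_level i)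
    \<and> finite ((\<lambda>b. D.cls e (b \<otimes> \<theta>)) ` base.Pn (minus_level i))"
proof (rule base.card_image_Pn[OF assms])
  fix x y assume xy: "x \<in> base.Pn (minus_level i)" "y \<in> base.Pn (minus_level i)"
  note k = base_Pn_K[OF xy(1)] base_Pn_K[OF xy(2)]
  have "x \<otimes> \<theta> \<ominus> y \<otimes> \<theta> = (x \<ominus> y) \<otimes> \<theta>"
    using K_carrier[OF k(1)] K_carrier[OF k(2)] \<theta>(1) by algebra
  then show "D.cls e (x \<otimes> \<theta>) = D.cls e (y \<otimes> \<theta>) \<longleftrightarrow> x \<ominus>\<^bsub>F\<^sub>K\<^esub> y \<in> base.Pn (minus_level e)"
    using D.cls_eq_iff[of "x \<otimes> \<theta>" "y \<otimes> \<theta>" e] k K_carrier mem_Pn_K\<theta> K_closed(6)[OF k] \<theta>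
    by (simp add: K_minus_eq)
qed

lemma plus_level_mono: "i \<le> j \<Longrightarrow> plus_level i \<le> plus_level j" "i \<le> j \<Longrightarrow> minus_level i \<le> minus_level j"
  by (simp_all add: plus_level_def minus_level_def div_le_mono)

lemma finite_An_F: "finite (carrier (D.An e))"
proof -
  let ?A = "D.cls e ` base.Pn (plus_level 0)" and ?B = "(\<lambda>b. D.cls e (b \<otimes> \<theta>)) ` base.Pn (minus_level 0)"
  have "carrier (D.An e) \<subseteq> (\<lambda>(x, y). x \<oplus>\<^bsub>D.An e\<^esub> y) ` (?A \<times> ?B)"
  proof
    fix z assume "z \<in> carrier (D.An e)"
    then obtain x where x: "x \<in> D.Pn 0" "z = D.cls e x" by (auto simp: D.carrier_An)
    obtain a b where ab: "a \<in> K" "b \<in> K" "x = a \<oplus> b \<otimes> \<theta>" using coordinates D.Pn_carrier[OF x(1)] by blast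
    then have P: "a \<in> D.Pn 0" "b \<otimes> \<theta> \<in> D.Pn 0" using x(1) mem_Pn_coordinates by auto
    then have "z = D.cls e a \<oplus>\<^bsub>D.An e\<^esub> D.cls e (b \<otimes> \<theta>)" using D.cls_simps(2) x(2) ab(3) by simp
    then show "z \<in> (\<lambda>(x, y). x \<oplus>\<^bsub>D.An e\<^esub> y) ` (?A \<times> ?B)"
      using P ab mem_Pn_K mem_Pn_K\<theta> by (intro image_eqI[of _ _ "(D.cls e a, D.cls e (b \<otimes> \<theta>))"]) auto
  qed
  moreover have "finite ?A" "finite ?B" using card_image_K[of 0 e] card_image_K\<theta>[of 0 e] plus_level_mono by auto
  ultimately show ?thesis by (meson finite_SigmaI finite_imageI finite_subset)
qed

lemma two_K: "\<one> \<oplus> \<one> \<in> K" using K_closed by simp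

lemma w_double: "x \<in> carrier F \<Longrightarrow> w (x \<oplus> x) = w x"
proof -
  assume x: "x \<in> carrier F"
  have "x \<oplus> x = (\<one> \<oplus> \<one>) \<otimes> x" using x by algebra
  then show ?thesis using D.w_mult[of "\<one> \<oplus> \<one>" x] x two w_K[OF two_K] by simp
qed

text \<open>
  For \<open>x = a + b\<theta>\<close> the element \<open>\<sigma> x + x = 2a\<close> lies in
  \<open>P\<^sup>e\<close> if and only if \<open>x\<close> and \<open>b\<theta>\<close> have
  the same class.
\<close>

lemma skew_classes:
  assumes e: "e \<ge> 1"
  shows "D.cls e ` {x \<in> D.Pn 1. \<sigma> x \<oplus> x \<in> D.Pn e} = (\<lambda>b. D.cls e (b \<otimes> \<theta>)) ` base.Pn (minus_level 1)"
proof (intro equalityI subsetI)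
  fix z assume "z \<in> D.cls e ` {x \<in> D.Pn 1. \<sigma> x \<oplus> x \<in> D.Pn e}"
  then obtain x where x: "x \<in> D.Pn 1" "\<sigma> x \<oplus> x \<in> D.Pn e" "z = D.cls e x" by auto
  obtain a b where ab: "a \<in> K" "b \<in> K" "x = a \<oplus> b \<otimes> \<theta>" using coordinates D.Pn_carrier[OF x(1)] by blast
  note abc = K_carrier[OF ab(1)] K_carrier[OF ab(2)]
  have "\<sigma> x \<oplus> x = a \<oplus> a"
    unfolding ab(3) \<sigma>_coordinates[OF ab(1,2)] using abc \<theta>(1) by algebra
  then have "a \<in> D.Pn e" using x(2) w_double[OF abc(1)] abc by (simp add: D.Pn_def)
  moreover have "x \<ominus> b \<otimes> \<theta> = a" unfolding ab(3) using abc \<theta>(1) by algebra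
  ultimately have "z = D.cls e (b \<otimes> \<theta>)" using x D.cls_eq_iff[of x "b \<otimes> \<theta>" e] D.Pn_carrier abc \<theta>(1) by simp
  moreover have "b \<in> base.Pn (minus_level 1)" using x(1) ab mem_Pn_coordinates mem_Pn_K\<theta> by simp
  ultimately show "z \<in> (\<lambda>b. D.cls e (b \<otimes> \<theta>)) ` base.Pn (minus_level 1)" by blast
next
  fix z assume "z \<in> (\<lambda>b. D.cls e (b \<otimes> \<theta>)) ` base.Pn (minus_level 1)"
  then obtain b where b: "b \<in> base.Pn (minus_level 1)" "z = D.cls e (b \<otimes> \<theta>)" by auto
  note bK = base_Pn_K[OF b(1)]
  have "\<sigma> (b \<otimes> \<theta>) \<oplus> b \<otimes> \<theta> = \<zero>"
    using \<sigma>_mult[of b \<theta>] \<sigma>_K[OF bK] K_carrier[OF bK] \<theta> by (simp add: r_minus l_neg)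
  then have "\<sigma> (b \<otimes> \<theta>) \<oplus> b \<otimes> \<theta> \<in> D.Pn e" using D.Pn_closed(1) by simp
  moreover have "b \<otimes> \<theta> \<in> D.Pn 1" using mem_Pn_K\<theta>[OF bK] b(1) by blast
  ultimately show "z \<in> D.cls e ` {x \<in> D.Pn 1. \<sigma> x \<oplus> x \<in> D.Pn e}" using b(2) by blast
qed

text \<open>
  Dually, \<open>\<sigma> x - x = -2b\<theta>\<close> lies in \<open>P\<^sup>e\<close> if and
  only if \<open>x\<close> and \<open>a\<close> have the same class.
\<close>

lemma symmetric_classes:
  assumes e: "e \<ge> 1"
  shows "D.cls e ` {x \<in> D.Pn 1. \<sigma> x \<ominus> x \<in> D.Pn e} = D.cls e ` base.Pn (plus_level 1)"
proof (intro equalityI subsetI)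
  fix z assume "z \<in> D.cls e ` {x \<in> D.Pn 1. \<sigma> x \<ominus> x \<in> D.Pn e}"
  then obtain x where x: "x \<in> D.Pn 1" "\<sigma> x \<ominus> x \<in> D.Pn e" "z = D.cls e x" by auto
  obtain a b where ab: "a \<in> K" "b \<in> K" "x = a \<oplus> b \<otimes> \<theta>" using coordinates D.Pn_carrier[OF x(1)] by blast
  note abc = K_carrier[OF ab(1)] K_carrier[OF ab(2)]
  have "\<sigma> x \<ominus> x = \<ominus> (b \<otimes> \<theta> \<oplus> b \<otimes> \<theta>)"
    unfolding ab(3) \<sigma>_coordinates[OF ab(1,2)] using abc \<theta>(1) by algebra
  then have "b \<otimes> \<theta> \<in> D.Pn e"
    using x(2) w_double[of "b \<otimes> \<theta>"] D.w_neg[of "b \<otimes> \<theta> \<oplus> b \<otimes> \<theta>"] abc \<theta>(1) by (simp add: D.Pn_def)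
  moreover have "x \<ominus> a = b \<otimes> \<theta>" unfolding ab(3) using abc \<theta>(1) by algebra
  ultimately have "z = D.cls e a" using x D.cls_eq_iff[of x a e] D.Pn_carrier abc by simp
  moreover have "a \<in> base.Pn (plus_level 1)" using x(1) ab mem_Pn_coordinates mem_Pn_K by simp
  ultimately show "z \<in> D.cls e ` base.Pn (plus_level 1)" by blast
next
  fix z assume "z \<in> D.cls e ` base.Pn (plus_level 1)"
  then obtain a where a: "a \<in> base.Pn (plus_level 1)" "z = D.cls e a" by auto
  note aK = base_Pn_K[OF a(1)]
  have "\<sigma> a \<ominus> a = \<zero>" using \<sigma>_K[OF aK] K_carrier[OF aK] by (simp add: minus_eq r_neg)
  then have "\<sigma> a \<ominus> a \<in> D.Pn e" using D.Pn_closed(1) by simp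
  moreover have "a \<in> D.Pn 1" using mem_Pn_K[OF aK] a(1) by blast
  ultimately show "z \<in> D.cls e ` {x \<in> D.Pn 1. \<sigma> x \<ominus> x \<in> D.Pn e}" using a(2) by blast
qed

lemma induced_cls:
  assumes "x \<in> D.Pn 0"
  shows "induced \<sigma> (D.cls e x) = D.cls e (\<sigma> x)"
proof -
  have x: "x \<in> carrier F" using D.Pn_carrier assms by blast
  have \<sigma>P: "\<sigma> y \<in> D.Pn e" if "y \<in> D.Pn e" for y
    using that \<sigma>_closed w_\<sigma> by (simp add: D.Pn_def)
  have "\<sigma> ` D.cls e x = (\<Union>y\<in>D.Pn e. {\<sigma> (y \<oplus> x)})"
    unfolding D.cls_def a_r_coset_def' by blast
  also have "\<dots> = (\<Union>y\<in>D.Pn e. {\<sigma> y \<oplus> \<sigma> x})"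
    using \<sigma>_add x D.Pn_carrier by (intro SUP_cong) auto
  also have "\<dots> = (\<Union>y\<in>\<sigma> ` D.Pn e. {y \<oplus> \<sigma> x})" by blast
  also have "\<sigma> ` D.Pn e = D.Pn e"
  proof (intro equalityI subsetI)
    fix y assume "y \<in> D.Pn e"
    then show "y \<in> \<sigma> ` D.Pn e" using \<sigma>P \<sigma>_\<sigma> D.Pn_carrier by (metis imageI)
  qed (use \<sigma>P in auto)
  finally show ?thesis by (simp add: induced_def D.cls_def a_r_coset_def')
qed

theorem order_unitary_group_extension:
  fixes V :: "('a set, 'v, 'z) module_scheme"
  assumes e: "e \<ge> 1" and r: "maximalideal r (D.An e)"
    and V: "module (D.An e) V" "free_of_rank (D.An e) V m"
    and h: "hermitian_form (D.An e) (induced \<sigma>) V h" "nondegenerate (D.An e) V h"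
  shows "order (unitary_group (D.An e) V h)
    = base.Q ^ ((minus_level e - minus_level 1) * m + ((plus_level e - plus_level 1) + (minus_level e - minus_level 1)) * (m * (m - 1) div 2))
      * order (reduced_unitary_group (D.An e) r V h)"
proof -
  have two_F: "w (\<one> \<oplus> \<one>) = 1" using w_K[OF two_K] two by simp
  have "order (unitary_group (D.An e) V h)
    = card (D.cls e ` {x \<in> D.Pn 1. \<sigma> x \<oplus> x \<in> D.Pn e}) ^ m
      * (card (D.cls e ` {x \<in> D.Pn 1. \<sigma> x \<ominus> x \<in> D.Pn e})
          * card (D.cls e ` {x \<in> D.Pn 1. \<sigma> x \<oplus> x \<in> D.Pn e})) ^ (m * (m - 1) div 2)
      * order (reduced_unitary_group (D.An e) r V h)"
    by (rule D.order_unitary_group_quotient[OF two_F e finite_An_F \<sigma>_closed \<sigma>_add \<sigma>_mult \<sigma>_\<sigma> w_\<sigma> induced_cls r V h])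
  also have "card (D.cls e ` {x \<in> D.Pn 1. \<sigma> x \<oplus> x \<in> D.Pn e}) = base.Q ^ (minus_level e - minus_level 1)"
    unfolding skew_classes[OF e] using card_image_K\<theta>[of 1 e] plus_level_mono(2)[OF e] by simp
  also have "card (D.cls e ` {x \<in> D.Pn 1. \<sigma> x \<ominus> x \<in> D.Pn e}) = base.Q ^ (plus_level e - plus_level 1)"
    unfolding symmetric_classes[OF e] using card_image_K[of 1 e] plus_level_mono(1)[OF e] by simp
  finally show ?thesis by (simp only: power_add power_mult add_mult_distrib power_mult_distrib)
qed

lemma w_eval_le:
  assumes x: "x \<in> carrier F" "w x > 1"
  shows "set p \<subseteq> D.Pn 0 \<Longrightarrow> w (eval p x) * w x \<le> w x ^ length p"
proof (induct p)
  case Nil then show ?case by (simp add: D.w_zero)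
next
  case (Cons a p)
  have a: "a \<in> carrier F" "w a \<le> 1" using Cons(2) by (simp_all add: D.Pn_def)
  have pc: "eval p x \<in> carrier F" using Cons(2) x by (intro eval_in_carrier) (auto simp: D.Pn_def)
  have "w (a \<otimes> x [^] length p) \<le> w x ^ length p"
    using a x D.w_nonneg[OF a(1)] by (simp add: D.w_mult D.w_pow mult_left_le_one_le)
  moreover have "w (eval p x) \<le> w (eval p x) * w x"
    using D.w_nonneg[OF pc] x by (simp add: mult_le_cancel_left1)
  then have "w (eval p x) \<le> w x ^ length p" using Cons by simp
  ultimately have "w (a \<otimes> x [^] length p \<oplus> eval p x) \<le> w x ^ length p"
    using D.w_add[of "a \<otimes> x [^] length p" "eval p x"] a x pc by simp
  then show ?case using x by simp
qed

text \<open>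
  If \<open>w x > 1\<close>, then the leading term of a monic polynomial with integral
  coefficients dominates at \<open>x\<close>, so \<open>x\<close> is not a root
  (\<open>w_eval_le\<close>). Conversely \<open>x = a + b\<theta>\<close> is a root of
  \<open>X\<^sup>2 - 2aX + (a\<^sup>2 - b\<^sup>2d)\<close>, whose coefficients are integral
  if \<open>w x \<le> 1\<close>, because \<open>w x\<close> is both \<open>max |a| (|b|
  |d|\<^bsup>1/2\<^esup>)\<close> and the square root of the constant coefficient's absolute
  value.
\<close>

lemma integral_closure_eq: "integral_closure F base.\<O> = D.\<O>"
proof -
  have "(\<exists>p. polynomial\<^bsub>F\<^esub> (carrier base.\<O>) p \<and> p \<noteq> [] \<and> hd p = \<one> \<and> eval p x = \<zero>) \<longleftrightarrow> w x \<le> 1"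
    if x: "x \<in> carrier F" for x
  proof
    assume "\<exists>p. polynomial\<^bsub>F\<^esub> (carrier base.\<O>) p \<and> p \<noteq> [] \<and> hd p = \<one> \<and> eval p x = \<zero>"
    then obtain p where p: "polynomial\<^bsub>F\<^esub> (carrier base.\<O>) p" "p \<noteq> []" "hd p = \<one>" "eval p x = \<zero>" by blast
    then obtain p' where p': "p = \<one> # p'" by (cases p) auto
    have "set p' \<subseteq> carrier base.\<O>" using p(1) unfolding p' polynomial_def by auto
    then have sub: "set p' \<subseteq> D.Pn 0"
      using w_K K_carrier by (auto simp: abs_integers_def D.Pn_def)
    show "w x \<le> 1"
    proof (rule ccontr)
      assume "\<not> w x \<le> 1"
      then have x1: "w x > 1" by simp
      have ec: "eval p' x \<in> carrier F" using sub x by (intro eval_in_carrier) (auto simp: D.Pn_def)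
      have "x [^] length p' \<oplus> eval p' x = \<zero>" using p(4) x unfolding p' by simp
      then have "x [^] length p' = \<ominus> eval p' x" using minus_equality[of "x [^] length p'" "eval p' x"] x ec by simp
      then have "w (eval p' x) = w x ^ length p'" using D.w_neg[OF ec] D.w_pow[OF x, of "length p'"] by simp
      then have "w x ^ length p' * w x \<le> w x ^ length p'" using w_eval_le[OF x x1 sub] by simp
      then show False using x1 by simp
    qed
  next
    assume wx: "w x \<le> 1"
    obtain a b where ab: "a \<in> K" "b \<in> K" "x = a \<oplus> b \<otimes> \<theta>" using coordinates[OF x] by blast
    note abc = K_carrier[OF ab(1)] K_carrier[OF ab(2)] K_carrier[OF d(1)]
    have va: "v a \<le> 1" using wx ab w_coordinates by simp
    have "sqrt (v (a \<otimes> a \<ominus> b \<otimes> b \<otimes> d)) \<le> 1"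
      using wx unfolding w_def ab(3) norm_coordinates[OF ab(1,2)] .
    then have n1: "v (a \<otimes> a \<ominus> b \<otimes> b \<otimes> d) \<le> 1" by simp
    let ?p = "[\<one>, \<ominus> (a \<oplus> a), a \<otimes> a \<ominus> b \<otimes> b \<otimes> d]"
    have "v (\<ominus> (a \<oplus> a)) \<le> 1" using v_neg[of "a \<oplus> a"] v_add[of a a] va ab K_closed by simp
    then have "set ?p \<subseteq> carrier base.\<O>"
      using n1 v_one K_closed ab d by (simp add: abs_integers_def)
    then have "polynomial\<^bsub>F\<^esub> (carrier base.\<O>) ?p" by (simp add: polynomial_def)
    moreover have "eval ?p x = \<zero>"
    proof -
      have "eval ?p x = x \<otimes> x \<oplus> (\<ominus> (a \<oplus> a)) \<otimes> x \<oplus> (a \<otimes> a \<ominus> b \<otimes> b \<otimes> d)"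
        using abc x by (simp add: numeral_2_eq_2 a_assoc)
      also have "\<dots> = \<zero>" unfolding ab(3) d_def using abc(1,2) \<theta>(1) by algebra
      finally show ?thesis .
    qed
    ultimately show "\<exists>p. polynomial\<^bsub>F\<^esub> (carrier base.\<O>) p \<and> p \<noteq> [] \<and> hd p = \<one> \<and> eval p x = \<zero>"
      by (intro exI[of _ ?p]) simp
  qed
  then have "{x \<in> carrier F. \<exists>p. polynomial\<^bsub>F\<^esub> (carrier base.\<O>) p \<and> p \<noteq> [] \<and> hd p = \<one> \<and> eval p x = \<zero>}
      = {x \<in> carrier F. w x \<le> 1}"
    by (intro Collect_cong conj_cong refl)
  then show ?thesis by (simp only: integral_closure_def abs_integers_def[of F w])
qed

text \<open>
  If \<open>d\<close> is a unit, a prime element of \<open>K\<close> is one of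
  \<open>F\<close>. Otherwise \<open>p\<close> is contained in \<open>P\<^sup>2\<close>.
\<close>

lemma unramified_iff: "unramified (base.Pn 1) D.\<O> (D.Pn 1) \<longleftrightarrow> v d = 1"
proof
  assume vd: "v d = 1"
  have "base.Pn 1 \<subseteq> D.Pn 1" using mem_Pn_K[of _ 1] base_Pn_K vd by (auto simp: plus_level_def)
  then have "Idl\<^bsub>D.\<O>\<^esub> (base.Pn 1) \<subseteq> D.Pn 1"
    using D.Pn_ideal[of 1] unfolding genideal_def by blast
  moreover have "D.Pn 1 \<subseteq> J" if J: "ideal J D.\<O>" "base.Pn 1 \<subseteq> J" for J
  proof
    fix x assume x: "x \<in> D.Pn 1"
    define o' where "o' = base.\<omega>"
    have o: "o' \<in> K" "o' \<noteq> \<zero>" "v o' = c" using base.\<omega> by (simp_all add: o'_def)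
    have oF: "o' \<in> carrier F" "w o' = c" using o K_carrier w_K by auto
    have "o' \<in> base.Pn 1" using o by (simp add: base.Pn_def)
    then have oJ: "o' \<in> J" using J by blast
    have ic: "inv o' \<in> carrier F" "o' \<otimes> inv o' = \<one>" using D.inv_mem[OF oF(1) o(2)] by auto
    have "w (inv o' \<otimes> x) = w x / c"
      using D.Pn_carrier[OF x] ic oF D.w_inv[OF oF(1) o(2)] by (simp add: D.w_mult)
    also have "\<dots> \<le> 1" using x base.c unfolding D.Pn_def by (simp add: c\<^sub>F_unit[OF vd])
    finally have "inv o' \<otimes> x \<in> carrier D.\<O>" using D.Pn_carrier[OF x] ic by (simp add: abs_integers_def)
    then have "o' \<otimes> (inv o' \<otimes> x) \<in> J" using ideal.I_r_closed[OF J(1) oJ] by (simp add: abs_integers_def)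
    then show "x \<in> J" using D.Pn_carrier[OF x] ic oF by (simp add: m_assoc[symmetric])
  qed
  then have "D.Pn 1 \<subseteq> Idl\<^bsub>D.\<O>\<^esub> (base.Pn 1)" unfolding genideal_def by blast
  ultimately show "unramified (base.Pn 1) D.\<O> (D.Pn 1)" unfolding unramified_def by blast
next
  assume unr: "unramified (base.Pn 1) D.\<O> (D.Pn 1)"
  show "v d = 1"
  proof (rule ccontr)
    assume vd: "v d \<noteq> 1"
    have "base.Pn 1 \<subseteq> D.Pn 2" using mem_Pn_K[of _ 2] base_Pn_K vd by (auto simp: plus_level_def)
    then have "Idl\<^bsub>D.\<O>\<^esub> (base.Pn 1) \<subseteq> D.Pn 2"
      using D.Pn_ideal[of 2] unfolding genideal_def by blast
    then have "D.Pn 1 \<subseteq> D.Pn 2" using unr by (simp add: unramified_def)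
    moreover have "D.\<omega> \<in> D.Pn 1" using D.\<omega> by (simp add: D.Pn_def)
    moreover have "D.\<omega> \<notin> D.Pn 2" using D.\<omega> c\<^sub>F by (simp add: D.Pn_def power2_eq_square)
    ultimately show False by blast
  qed
qed

end

section \<open>The orders of the unitary groups\<close>

lemma exponent_unramified:
  fixes m n :: nat
  shows "n * m + (n + n) * (m * (m - 1) div 2) = m\<^sup>2 * n"
proof -
  have "even (m * (m - 1))" by (cases m) auto
  then obtain j where j: "m * (m - 1) = 2 * j" by (elim evenE)
  moreover have "m\<^sup>2 = m + m * (m - 1)" by (cases m) (auto simp: power2_eq_square)
  ultimately have "m\<^sup>2 = m + 2 * j" by simp
  then show ?thesis unfolding j by (simp add: algebra_simps)
qed

lemma exponent_ramified_even:
  fixes m n :: nat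
  assumes "n \<ge> 1"
  shows "n * m + ((n - 1) + n) * (m * (m - 1) div 2) = (m\<^sup>2 * (2 * n - 1) + m) div 2"
proof -
  have "even (m * (m - 1))" by (cases m) auto
  then obtain j where j: "m * (m - 1) = 2 * j" by (elim evenE)
  moreover have "m\<^sup>2 = m + m * (m - 1)" by (cases m) (auto simp: power2_eq_square)
  ultimately have m2: "m\<^sup>2 = m + 2 * j" by simp
  obtain k where k: "n = Suc k" using assms by (cases n) auto
  have "m\<^sup>2 * (2 * n - 1) + m = 2 * (n * m + ((n - 1) + n) * j)"
    unfolding m2 k by (simp add: algebra_simps)
  then show ?thesis unfolding j by simp
qed

theorem corollary5p6:
  fixes F :: "'f ring" and K :: "'f set" and v :: "'f \<Rightarrow> real" and \<sigma> :: "'f \<Rightarrow> 'f"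
    and OK RF :: "'f ring" and p P :: "'f set" and q e m :: nat
  assumes "field F" and "subfield K F"
    and "nonarch_local_field (F\<lparr>carrier := K\<rparr>) v"
    and "OK = abs_integers (F\<lparr>carrier := K\<rparr>) v"
    and "p = abs_max_ideal (F\<lparr>carrier := K\<rparr>) v"
    and "q = order (OK Quot p)" and "odd (ring_char (OK Quot p))"
    and "ring.dimension F 2 K (carrier F)"
    and "RF = integral_closure F OK" and "maximalideal P RF"
    and "nontrivial_automorphism F K \<sigma>"
    and "e \<ge> 1" and "m \<ge> 1"
  shows
    "(\<forall>A r (V :: ('f set, 'v) module) h.
        A = OK Quot ideal_power OK p e \<and> maximalideal r A \<and>
        module A V \<and> free_of_rank A V m \<and>
        hermitian_form A (\<lambda>a. a) V h \<and> nondegenerate A V h \<longrightarrow>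
        order (unitary_group A V h) =
          q ^ (m * (m - 1) * (e - 1) div 2) * order (reduced_unitary_group A r V h))
     \<and>
     (\<forall>A r (V :: ('f set, 'v) module) h.
        A = RF Quot ideal_power RF P e \<and> maximalideal r A \<and>
        module A V \<and> free_of_rank A V m \<and>
        hermitian_form A (induced \<sigma>) V h \<and> nondegenerate A V h \<longrightarrow>
        (unramified p RF P \<longrightarrow>
           order (unitary_group A V h) =
             q ^ (m\<^sup>2 * (e - 1)) * order (reduced_unitary_group A r V h)) \<and>
        (\<not> unramified p RF P \<and> even e \<longrightarrow>
           order (unitary_group A V h) =
             q ^ ((m\<^sup>2 * (e - 1) + m) div 2) * order (reduced_unitary_group A r V h)) \<and>
        (\<not> unramified p RF P \<and> odd e \<longrightarrow>
           order (unitary_group A V h) =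
             q ^ (m\<^sup>2 * (e - 1) div 2) * order (reduced_unitary_group A r V h)))"
proof -
  interpret F: field F by fact
  interpret local: nonarch_local_field "F\<lparr>carrier := K\<rparr>" v by fact
  obtain c where c: "0 < c" "c < 1" "v ` (carrier (F\<lparr>carrier := K\<rparr>) - {\<zero>\<^bsub>F\<lparr>carrier := K\<rparr>\<^esub>}) = range (\<lambda>n::int. c powi n)"
    using local.discrete by blast
  interpret base: finite_residue_field "F\<lparr>carrier := K\<rparr>" v c
    by (intro finite_residue_field.intro discrete_valued_field.intro local.field_axioms
        discrete_valued_field_axioms.intro finite_residue_field_axioms.intro)
       (use local.abs_nonneg local.abs_eq_0_iff local.abs_mult local.abs_ultrametric c
          local.finite_residue_field in simp_all)
  have p: "p = base.Pn 1" unfolding base.Pn_1 by fact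
  have q: "q = base.Q" unfolding base.Q_def p[symmetric] \<open>q = order (OK Quot p)\<close> \<open>OK = _\<close> ..
  have two: "v (\<one>\<^bsub>F\<lparr>carrier := K\<rparr>\<^esub> \<oplus>\<^bsub>F\<lparr>carrier := K\<rparr>\<^esub> \<one>\<^bsub>F\<lparr>carrier := K\<rparr>\<^esub>) = 1"
    using \<open>odd (ring_char (OK Quot p))\<close> unfolding p \<open>OK = _\<close> by (rule base.two_unit)
  interpret ext: quadratic_extension F K v c \<sigma>
  proof (intro quadratic_extension.intro F.field_axioms base.finite_residue_field_axioms
      quadratic_extension_axioms.intro)
    show "v (\<one>\<^bsub>F\<^esub> \<oplus>\<^bsub>F\<^esub> \<one>\<^bsub>F\<^esub>) = 1" using two by simp
  qed (use assms local.complete in simp_all)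
  obtain \<theta> where \<theta>: "\<theta> \<in> carrier F" "\<theta> \<noteq> \<zero>\<^bsub>F\<^esub>" "\<sigma> \<theta> = \<ominus>\<^bsub>F\<^esub> \<theta>"
    "v (\<theta> \<otimes>\<^bsub>F\<^esub> \<theta>) = 1 \<or> v (\<theta> \<otimes>\<^bsub>F\<^esub> \<theta>) = c"
    using ext.generator_exists by blast
  interpret gen: quadratic_generator F K v c \<sigma> \<theta>
    by (intro quadratic_generator.intro ext.quadratic_extension_axioms quadratic_generator_axioms.intro \<theta>)
  have RF: "RF = gen.D.\<O>"
    unfolding gen.integral_closure_eq[symmetric] \<open>RF = _\<close> \<open>OK = _\<close> ..
  have P: "P = gen.D.Pn 1"
    using \<open>maximalideal P RF\<close> unfolding RF by (rule gen.D.maximalideal_\<O>)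
  have unr: "unramified p RF P \<longleftrightarrow> v gen.d = 1"
    unfolding p RF P by (rule gen.unramified_iff)
  have part_a: "order (unitary_group A V h) =
      q ^ (m * (m - 1) * (e - 1) div 2) * order (reduced_unitary_group A r V h)"
    if A: "A = OK Quot ideal_power OK p e" "maximalideal r A" "module A V" "free_of_rank A V m"
      "hermitian_form A (\<lambda>a. a) V h" "nondegenerate A V h"
    for A r h and V :: "('f set, 'v) module"
  proof -
    have "A = base.An e" unfolding A(1) p \<open>OK = _\<close> base.ideal_power_Pn ..
    with A have "order (unitary_group A V h)
        = base.Q ^ ((e - 1) * (m * (m - 1) div 2)) * order (reduced_unitary_group A r V h)"
      using base.order_orthogonal_group_quotient[OF two \<open>e \<ge> 1\<close>, of r V m h] by simp
    moreover have "(e - 1) * (m * (m - 1) div 2) = m * (m - 1) * (e - 1) div 2"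
    proof -
      have "even (m * (m - 1))" by (cases m) auto
      then show ?thesis by (simp add: div_mult_swap mult.commute)
    qed
    ultimately show ?thesis unfolding q by simp
  qed
  have part_b: "(unramified p RF P \<longrightarrow>
        order (unitary_group A V h) = q ^ (m\<^sup>2 * (e - 1)) * order (reduced_unitary_group A r V h)) \<and>
      (\<not> unramified p RF P \<and> even e \<longrightarrow>
        order (unitary_group A V h)
          = q ^ ((m\<^sup>2 * (e - 1) + m) div 2) * order (reduced_unitary_group A r V h)) \<and>
      (\<not> unramified p RF P \<and> odd e \<longrightarrow>
        order (unitary_group A V h)
          = q ^ (m\<^sup>2 * (e - 1) div 2) * order (reduced_unitary_group A r V h))"
    if A: "A = RF Quot ideal_power RF P e" "maximalideal r A" "module A V" "free_of_rank A V m"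
      "hermitian_form A (induced \<sigma>) V h" "nondegenerate A V h"
    for A r h and V :: "('f set, 'v) module"
  proof -
    have "A = gen.D.An e" unfolding A(1) P RF gen.D.ideal_power_Pn ..
    with A have *: "order (unitary_group A V h)
        = base.Q ^ ((gen.minus_level e - gen.minus_level 1) * m
            + ((gen.plus_level e - gen.plus_level 1) + (gen.minus_level e - gen.minus_level 1)) * (m * (m - 1) div 2))
          * order (reduced_unitary_group A r V h)"
      using gen.order_unitary_group_extension[OF \<open>e \<ge> 1\<close>, of r V m h] by simp
    show ?thesis
    proof (intro conjI impI)
      assume "unramified p RF P"
      then have "v gen.d = 1" using unr by simp
      then show "order (unitary_group A V h)
          = q ^ (m\<^sup>2 * (e - 1)) * order (reduced_unitary_group A r V h)"
        unfolding * gen.plus_level_def gen.minus_level_def q using exponent_unramified[of "e - 1" m] by simp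
    next
      assume r: "\<not> unramified p RF P \<and> even e"
      then obtain n where n: "e = 2 * n" by (elim conjE evenE)
      then have n1: "n \<ge> 1" using \<open>e \<ge> 1\<close> by simp
      have "gen.minus_level e - gen.minus_level 1 = n" "gen.plus_level e - gen.plus_level 1 = n - 1"
        using r unr n by (simp_all add: gen.plus_level_def gen.minus_level_def)
      then show "order (unitary_group A V h)
          = q ^ ((m\<^sup>2 * (e - 1) + m) div 2) * order (reduced_unitary_group A r V h)"
        unfolding * q n using exponent_ramified_even[OF n1, of m] by simp
    next
      assume r: "\<not> unramified p RF P \<and> odd e"
      then obtain n where n: "e = 2 * n + 1" by (elim conjE oddE)
      have "gen.minus_level e - gen.minus_level 1 = n" "gen.plus_level e - gen.plus_level 1 = n"
        using r unr n by (simp_all add: gen.plus_level_def gen.minus_level_def)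
      moreover have "m\<^sup>2 * (e - 1) div 2 = m\<^sup>2 * n" by (simp add: n)
      ultimately show "order (unitary_group A V h)
          = q ^ (m\<^sup>2 * (e - 1) div 2) * order (reduced_unitary_group A r V h)"
        unfolding * q using exponent_unramified[of n m] by simp
    qed
  qed
  show ?thesis using part_a part_b by blast
qed

end
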